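(* Let $(V,\omega)$ be a complex symplectic vector space of dimension $m$ and $k\ge 2$ an integer. Let $\gamma_l\in\mathcal P_{\tau_l}(V)$, $l=1,\dots,k$, be symplectic paths starting from the identity $I_V$, where $\tau_l\ge 0$, and let $\tilde\gamma\in\mathcal P_{T_k}(V)$ be the iteration of $\gamma_1,\dots,\gamma_k$. Put $M_l:=\gamma_l(\tau_l)$ and $\tilde M_l:=M_lM_{l-1}\cdots M_1$. For $M\in \mathrm{Sp}(V)$ write $\mathfrak N_1(M):=\ker(M-I_V)$ and $\nu_1(M):=\dim\ker(M-I_V)$. For $\mathcal M:=(M_1,\dots,M_k)$ define $$A(\mathcal M):=\dim\Big(\bigcap_{l=1}^k\mathfrak N_1(M_l)\Big),\qquad B(\mathcal M):=\sum_{l=2}^k\dim\big(\mathfrak N_1(M_l)\cap\mathfrak N_1(\tilde M_{l-1})\big)-\sum_{l=2}^{k-1}\nu_1(\tilde M_l).$$ Then $$\sum_{l=1}^k\nu_1(M_l)-B(\mathcal M)-m(k-1)\ \le\ i_1(\tilde\gamma)-\sum_{l=1}^k i_1(\gamma_l)\ \le\ B(\mathcal M)-\nu_1(\tilde M_k),$$ and $$B(\mathcal M)\le A(\mathcal M).$$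
   Context: A symplectic form on a finite-dimensional complex vector space $V$ is a non-degenerate skew-Hermitian (sesquilinear, linear in the first variable) form $\omega$; $\mathrm{Sp}(V)$ is the group of invertible linear maps preserving $\omega$. A subspace $\lambda$ is Lagrangian if it equals its $\omega$-annihilator $\lambda^\omega=\{x:\omega(x,y)=0\ \forall y\in\lambda\}$. $\mathcal P_\tau(V):=\{\gamma\in C([0,\tau],\mathrm{Sp}(V)):\gamma(0)=I_V\}$ (for $\tau=0$, the constant path at a point). Iteration. With $T_0=0$, $T_l:=\sum_{j=1}^l\tau_j$, $\tilde M_0=I_V$, the iteration of $\gamma_1,\dots,\gamma_k$ is $\tilde\gamma\in\mathcal P_{T_k}(V)$ defined by $\tilde\gamma(t)=\gamma_l(t-T_{l-1})\tilde M_{l-1}$ for $T_{l-1}\le t\le T_l$, $l=1,\dots,k$. Maslov index. Let $(X,\Omega)$ be a complex symplectic vector space of dimension $2N$ possessing Lagrangian subspaces. Choose an inner product (linear in the first variable) and $J\in \mathrm{GL}(X)$ with $\Omega(x,y)=\langle Jx,y\rangle$; $iJ$ is self-adjoint. Let $X^-$ (resp. $X^+$) be the span of eigenvectors of $iJ$ with positive (resp. negative) eigenvalues. For a continuous path $(\lambda(s),\mu(s))$, $s\in[a,b]$, of pairs of Lagrangian subspaces, write them as graphs of $U_\lambda(s),U_\mu(s):X^-\to X^+$; the operators $U_\lambda(s)U_\mu(s)^{-1}$ are unitary on $(X^+,-i\Omega|_{X^+})$ with eigenvalues $e^{i\theta_j(s)}$, $\theta_j$ continuous real, $j=1,\dots,N$.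 With $E(x)$ the smallest integer $\ge x$, $\mathrm{Mas}\{\lambda,\mu\}:=\sum_j\big(E(\theta_j(b)/2\pi)-E(\theta_j(a)/2\pi)\big)$ (independent of choices). A single Lagrangian in place of a path means the constant path. Maslov-type index. $V\oplus V$ carries the symplectic form $(-\omega)\oplus\omega$; for $A\in \mathrm{Sp}(V)$ the graph $\mathrm{Gr}(A)=\{(x,Ax):x\in V\}$ is Lagrangian in it. For a path $\gamma$ in $\mathrm{Sp}(V)$, $i_1(\gamma):=\mathrm{Mas}\{\mathrm{Gr}\circ\gamma,\mathrm{Gr}(I_V)\}$. *)

theory Defs
  imports "HOL-Analysis.Analysis"
begin

section \<open>Complex symplectic vector spaces\<close>

text \<open>
  A finite-dimensional complex vector space is a type with an explicit scalar multiplication, as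
  in \<^theory>\<open>HOL.Vector_Spaces\<close>; dimension zero is allowed.  Conjugate-linearity of the form
  in its second argument follows from the axioms below.
\<close>

locale complex_symplectic_space = vector_space scale
  for scale :: "complex \<Rightarrow> 'v::ab_group_add \<Rightarrow> 'v" (infixr \<open>*s\<close> 75) +
  fixes \<omega> :: "'v \<Rightarrow> 'v \<Rightarrow> complex"
  assumes finite_dim: "\<exists>B. finite B \<and> span B = UNIV"
    and form_add: "\<omega> (x + y) z = \<omega> x z + \<omega> y z"
    and form_scale: "\<omega> (c *s x) z = c * \<omega> x z"
    and form_skew: "\<omega> y x = - cnj (\<omega> x y)"
    and form_nondegenerate: "(\<And>y. \<omega> x y = 0) \<Longrightarrow> x = 0"
begin

definition Sp :: "('v \<Rightarrow> 'v) set" where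
  "Sp = {A. Vector_Spaces.linear scale scale A \<and> bij A \<and> (\<forall>x y. \<omega> (A x) (A y) = \<omega> x y)}"

text \<open>
  The type \<^typ>\<open>'v\<close> carries no topology.  The functionals sending \<open>A\<close> to \<open>f (A v)\<close>, with
  \<open>f\<close> linear, span the dual of the finite-dimensional space of endomorphisms, so the last
  condition is continuity for its canonical topology.  Only the values on \<open>{0..\<tau>}\<close> matter.
\<close>

definition symplectic_paths :: "real \<Rightarrow> (real \<Rightarrow> 'v \<Rightarrow> 'v) set" where
  "symplectic_paths \<tau> = {\<gamma>. (\<forall>t\<in>{0..\<tau>}. \<gamma> t \<in> Sp) \<and> \<gamma> 0 = id \<and>
     (\<forall>f v. Vector_Spaces.linear scale (*) f \<longrightarrow> continuous_on {0..\<tau>} (\<lambda>t. f (\<gamma> t v)))}"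

definition annihilator :: "'v set \<Rightarrow> 'v set" where
  "annihilator L = {x. \<forall>y\<in>L. \<omega> x y = 0}"

definition lagrangian :: "'v set \<Rightarrow> bool" where
  "lagrangian L \<longleftrightarrow> subspace L \<and> annihilator L = L"


section \<open>The Maslov index\<close>

definition inner_product :: "('v \<Rightarrow> 'v \<Rightarrow> complex) \<Rightarrow> bool" where
  "inner_product ip \<longleftrightarrow>
     (\<forall>x y z. ip (x + y) z = ip x z + ip y z) \<and>
     (\<forall>c x z. ip (c *s x) z = c * ip x z) \<and>
     (\<forall>x y. ip y x = cnj (ip x y)) \<and>
     (\<forall>x. x \<noteq> 0 \<longrightarrow> Re (ip x x) > 0)"

definition Xminus :: "('v \<Rightarrow> 'v) \<Rightarrow> 'v set" where
  "Xminus J = span {x. x \<noteq> 0 \<and> (\<exists>r>0. \<i> *s J x = complex_of_real r *s x)}"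

definition Xplus :: "('v \<Rightarrow> 'v) \<Rightarrow> 'v set" where
  "Xplus J = span {x. x \<noteq> 0 \<and> (\<exists>r<0. \<i> *s J x = complex_of_real r *s x)}"

text \<open>The operator \<open>Xminus J \<rightarrow> Xplus J\<close> whose graph \<open>{x + U x | x \<in> Xminus J}\<close> is \<open>L\<close>.\<close>

definition graph_operator :: "('v \<Rightarrow> 'v) \<Rightarrow> 'v set \<Rightarrow> 'v \<Rightarrow> 'v" where
  "graph_operator J L x = (THE y. y \<in> Xplus J \<and> x + y \<in> L)"

definition relative_operator :: "('v \<Rightarrow> 'v) \<Rightarrow> 'v set \<Rightarrow> 'v set \<Rightarrow> 'v \<Rightarrow> 'v" where
  "relative_operator J L K x =
     graph_operator J L (inv_into (Xminus J) (graph_operator J K) x)"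

text \<open>
  \<open>eigenangles J a b L K \<theta>\<close>: for every \<open>s\<close> the numbers \<open>cis (\<theta> j s)\<close>, \<open>j = 1, \<dots>, N\<close>, are the
  eigenvalues, with multiplicity, of the relative operator of \<open>L s\<close> and \<open>K s\<close> on \<open>Xplus J\<close>.
  For Lagrangian \<open>L s\<close> and \<open>K s\<close> that operator is unitary, so the multiplicity of \<open>z\<close> is the
  dimension of its eigenspace.
\<close>

definition eigenangles ::
    "('v \<Rightarrow> 'v) \<Rightarrow> real \<Rightarrow> real \<Rightarrow> (real \<Rightarrow> 'v set) \<Rightarrow> (real \<Rightarrow> 'v set) \<Rightarrow> (nat \<Rightarrow> real \<Rightarrow> real) \<Rightarrow> bool" where
  "eigenangles J a b L K \<theta> \<longleftrightarrow>
     (\<forall>j\<in>{1..dim UNIV div 2}. continuous_on {a..b} (\<theta> j)) \<and>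
     (\<forall>s\<in>{a..b}. \<forall>z. dim {x \<in> Xplus J. relative_operator J (L s) (K s) x = z *s x} =
        card {j \<in> {1..dim UNIV div 2}. cis (\<theta> j s) = z})"

text \<open>
  The value does not depend on the inner product, and hence \<open>J\<close>, nor on \<open>\<theta>\<close>.  The definition is
  meant for continuous paths \<open>L\<close>, \<open>K\<close> of Lagrangian subspaces on \<open>{a..b}\<close> with \<open>a \<le> b\<close>.
\<close>

definition maslov_index :: "real \<Rightarrow> real \<Rightarrow> (real \<Rightarrow> 'v set) \<Rightarrow> (real \<Rightarrow> 'v set) \<Rightarrow> int" where
  "maslov_index a b L K = (THE n. \<exists>ip J \<theta>.
     inner_product ip \<and> Vector_Spaces.linear scale scale J \<and> bij J \<and>
     (\<forall>x y. \<omega> x y = ip (J x) y) \<and> eigenangles J a b L K \<theta> \<and>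
     n = (\<Sum>j=1..dim UNIV div 2. \<lceil>\<theta> j b / (2 * pi)\<rceil> - \<lceil>\<theta> j a / (2 * pi)\<rceil>))"

end


section \<open>The Maslov-type index of a symplectic path\<close>

definition double_scale :: "(complex \<Rightarrow> 'v::ab_group_add \<Rightarrow> 'v) \<Rightarrow> complex \<Rightarrow> 'v \<times> 'v \<Rightarrow> 'v \<times> 'v" where
  "double_scale s = module_prod.scale s s"

definition double_form :: "('v \<Rightarrow> 'v \<Rightarrow> complex) \<Rightarrow> 'v \<times> 'v \<Rightarrow> 'v \<times> 'v \<Rightarrow> complex" where
  "double_form \<omega> p q = - \<omega> (fst p) (fst q) + \<omega> (snd p) (snd q)"

definition Gr :: "('v \<Rightarrow> 'v) \<Rightarrow> ('v \<times> 'v) set" where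
  "Gr A = {(x, A x) | x. True}"

context complex_symplectic_space
begin

lemma double_scale_apply: "double_scale scale c p = (c *s fst p, c *s snd p)"
proof -
  have "module_prod scale scale" by unfold_locales
  then show ?thesis by (simp add: double_scale_def module_prod.scale_def)
qed

lemma vector_space_double: "vector_space (double_scale scale)"
  by unfold_locales
    (auto simp: double_scale_apply scale_right_distrib scale_left_distrib)

lemma complex_symplectic_space_double:
  "complex_symplectic_space (double_scale scale) (double_form \<omega>)"
proof -
  interpret D: vector_space "double_scale scale" by (rule vector_space_double)
  obtain B where B: "finite B" "span B = UNIV" using finite_dim by blast
  define C where "C = (\<lambda>x. (x, 0)) ` B \<union> (\<lambda>x. (0, x)) ` B"
  have l: "(x, 0) \<in> D.span C" for x
  proof -
    have "x \<in> span B" using B by simp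
    then show ?thesis
    proof (induction rule: span_induct_alt)
      case base
      then show ?case using D.span_zero by (simp add: zero_prod_def)
    next
      case (step c x y)
      have "(x, 0) \<in> D.span C" using step by (auto intro: D.span_base simp: C_def)
      then have "double_scale scale c (x, 0) + (y, 0) \<in> D.span C"
        using step by (intro D.span_add D.span_scale)
      then show ?case by (simp add: double_scale_apply[of c "(x, 0)"])
    qed
  qed
  have r: "(0, x) \<in> D.span C" for x
  proof -
    have "x \<in> span B" using B by simp
    then show ?thesis
    proof (induction rule: span_induct_alt)
      case base
      then show ?case using D.span_zero by (simp add: zero_prod_def)
    next
      case (step c x y)
      have "(0, x) \<in> D.span C" using step by (auto intro: D.span_base simp: C_def)
      then have "double_scale scale c (0, x) + (0, y) \<in> D.span C"
        using step by (intro D.span_add D.span_scale)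
      then show ?case by (simp add: double_scale_apply[of c "(0, x)"])
    qed
  qed
  have "(x, y) \<in> D.span C" for x y
    using D.span_add[OF l[of x] r[of y]] by simp
  then have sp: "D.span C = UNIV" by auto
  have z: "\<omega> 0 y = 0" for y using form_scale[of 0 0 y] by simp
  have z': "\<omega> y 0 = 0" for y using form_skew[of y 0] z by simp
  show ?thesis
  proof unfold_locales
    show "\<exists>B. finite B \<and> D.span B = UNIV"
      using B sp by (intro exI[of _ C]) (auto simp: C_def)
    fix x
    assume h: "\<And>y. double_form \<omega> x y = 0"
    have "fst x = 0"
      by (rule form_nondegenerate) (use h[of "(_, 0)"] in \<open>simp add: double_form_def z'\<close>)
    moreover have "snd x = 0"
      by (rule form_nondegenerate) (use h[of "(0, _)"] in \<open>simp add: double_form_def z'\<close>)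
    ultimately show "x = 0" by (simp add: prod_eq_iff)
  next
    show "double_form \<omega> y x = - cnj (double_form \<omega> x y)" for x y
      using form_skew[of "fst y" "fst x"] form_skew[of "snd y" "snd x"]
      by (simp add: double_form_def)
  qed (auto simp: double_form_def double_scale_apply form_add form_scale algebra_simps)
qed

lemma lagrangian_Gr:
  assumes "A \<in> Sp"
  shows "complex_symplectic_space.lagrangian (double_scale scale) (double_form \<omega>) (Gr A)"
proof -
  interpret D: complex_symplectic_space "double_scale scale" "double_form \<omega>"
    by (rule complex_symplectic_space_double)
  interpret A: Vector_Spaces.linear scale scale A using assms by (simp add: Sp_def)
  have pres: "\<omega> (A x) (A y) = \<omega> x y" for x y using assms by (simp add: Sp_def)
  have surj: "surj A" using assms by (simp add: Sp_def bij_def)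
  have diff: "\<omega> (x - y) z = \<omega> x z - \<omega> y z" for x y z
    using form_add[of "x - y" y z] by simp
  have "D.subspace (Gr A)"
    unfolding D.subspace_def
    by (auto simp: Gr_def zero_prod_def double_scale_apply A.add A.scale A.zero)
  moreover have "D.annihilator (Gr A) = Gr A"
  proof
    show "Gr A \<subseteq> D.annihilator (Gr A)"
      by (auto simp: D.annihilator_def Gr_def double_form_def pres)
    show "D.annihilator (Gr A) \<subseteq> Gr A"
    proof
      fix p assume p: "p \<in> D.annihilator (Gr A)"
      have "\<omega> (snd p - A (fst p)) z = 0" for z
      proof -
        obtain y where y: "z = A y" using surj by (metis surjD)
        have "(y, z) \<in> Gr A" using y by (auto simp: Gr_def)
        then have "double_form \<omega> p (y, z) = 0"
          using p unfolding D.annihilator_def by blast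
        then have "- \<omega> (fst p) y + \<omega> (snd p) (A y) = 0" by (simp add: double_form_def y)
        then show ?thesis by (simp add: diff y pres)
      qed
      then have "snd p - A (fst p) = 0" by (rule form_nondegenerate)
      then show "p \<in> Gr A" by (auto simp: Gr_def prod_eq_iff)
    qed
  qed
  ultimately show ?thesis by (simp add: D.lagrangian_def)
qed

definition i1 :: "real \<Rightarrow> (real \<Rightarrow> 'v \<Rightarrow> 'v) \<Rightarrow> int" where
  "i1 \<tau> \<gamma> = complex_symplectic_space.maslov_index (double_scale scale) (double_form \<omega>) 0 \<tau>
     (\<lambda>s. Gr (\<gamma> s)) (\<lambda>s. Gr id)"

end


section \<open>Iteration of symplectic paths\<close>

text \<open>Families are indexed by \<open>l = 1, \<dots>, k\<close>.\<close>

definition total_time :: "(nat \<Rightarrow> real) \<Rightarrow> nat \<Rightarrow> real" where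
  "total_time \<tau> l = (\<Sum>j=1..l. \<tau> j)"

fun cumulative :: "(nat \<Rightarrow> 'v \<Rightarrow> 'v) \<Rightarrow> nat \<Rightarrow> 'v \<Rightarrow> 'v" where
  "cumulative M 0 = id"
| "cumulative M (Suc l) = M (Suc l) \<circ> cumulative M l"

text \<open>The recursion is only a way to glue the pieces; see \<open>iteration_eq\<close> below.\<close>

fun iteration :: "(nat \<Rightarrow> real) \<Rightarrow> (nat \<Rightarrow> real \<Rightarrow> 'v \<Rightarrow> 'v) \<Rightarrow> nat \<Rightarrow> real \<Rightarrow> 'v \<Rightarrow> 'v" where
  "iteration \<tau> \<gamma> 0 t = id"
| "iteration \<tau> \<gamma> (Suc k) t =
     (if t \<le> total_time \<tau> k then iteration \<tau> \<gamma> k t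
      else \<gamma> (Suc k) (t - total_time \<tau> k) \<circ> cumulative (\<lambda>l. \<gamma> l (\<tau> l)) k)"

lemma total_time_mono:
  assumes "\<And>l. l \<in> {1..k} \<Longrightarrow> \<tau> l \<ge> 0" "i \<le> j" "j \<le> k"
  shows "total_time \<tau> i \<le> total_time \<tau> j"
  unfolding total_time_def using assms by (intro sum_mono2) auto

lemma iteration_eq:
  assumes "\<And>l. l \<in> {1..k} \<Longrightarrow> \<tau> l \<ge> 0" "\<And>l. l \<in> {1..k} \<Longrightarrow> \<gamma> l 0 = id"
    and "l \<in> {1..k}" "t \<in> {total_time \<tau> (l - 1)..total_time \<tau> l}"
  shows "iteration \<tau> \<gamma> k t = \<gamma> l (t - total_time \<tau> (l - 1)) \<circ> cumulative (\<lambda>l. \<gamma> l (\<tau> l)) (l - 1)"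
  using assms
proof (induction k arbitrary: l t)
  case 0
  then show ?case by simp
next
  case (Suc k)
  note IH = Suc.IH and pos = Suc.prems(1) and start = Suc.prems(2)
    and l = Suc.prems(3) and t = Suc.prems(4)
  have end_value: "iteration \<tau> \<gamma> k (total_time \<tau> k) = cumulative (\<lambda>l. \<gamma> l (\<tau> l)) k"
  proof (cases k)
    case (Suc j)
    have "total_time \<tau> j \<le> total_time \<tau> k"
      by (rule total_time_mono[where k = "Suc k"]) (use pos Suc in auto)
    then have "iteration \<tau> \<gamma> k (total_time \<tau> k)
        = \<gamma> k (total_time \<tau> k - total_time \<tau> (k - 1)) \<circ> cumulative (\<lambda>l. \<gamma> l (\<tau> l)) (k - 1)"
      by (intro IH) (use pos start Suc in auto)
    moreover have "total_time \<tau> k - total_time \<tau> (k - 1) = \<tau> k"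
      using Suc by (simp add: total_time_def)
    ultimately show ?thesis using Suc by simp
  qed simp
  show ?case
  proof (cases "l = Suc k")
    case True
    then show ?thesis using t start[of "Suc k"] end_value by auto
  next
    case False
    then have lk: "l \<in> {1..k}" using l by auto
    have "total_time \<tau> l \<le> total_time \<tau> k"
      by (rule total_time_mono[where k = "Suc k"]) (use pos lk in auto)
    then have "t \<le> total_time \<tau> k" using t by simp
    then show ?thesis using IH[OF _ _ lk t] pos start by simp
  qed
qed


section \<open>Nullities\<close>

context complex_symplectic_space
begin

definition N1 :: "('v \<Rightarrow> 'v) \<Rightarrow> 'v set" where
  "N1 M = {x. M x - x = 0}"

definition nu1 :: "('v \<Rightarrow> 'v) \<Rightarrow> nat" where
  "nu1 M = dim (N1 M)"

definition A_index :: "nat \<Rightarrow> (nat \<Rightarrow> 'v \<Rightarrow> 'v) \<Rightarrow> int" where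
  "A_index k M = int (dim (\<Inter>l\<in>{1..k}. N1 (M l)))"

definition B_index :: "nat \<Rightarrow> (nat \<Rightarrow> 'v \<Rightarrow> 'v) \<Rightarrow> int" where
  "B_index k M =
     (\<Sum>l=2..k. int (dim (N1 (M l) \<inter> N1 (cumulative M (l - 1))))) -
     (\<Sum>l=2..k-1. int (nu1 (cumulative M l)))"

end

end

theory Submission
  imports Defs "HOL-Computational_Algebra.Fundamental_Theorem_Algebra" "Jordan_Normal_Form.Determinant"
begin

text \<open>
  Let \<open>\<sigma>(W)\<close> be the sum of the eigenangles of a unitary \<open>W\<close>, measured in turns and taken in
  \<open>[0, 1)\<close>.  A ceiling is its argument plus a fractional part, so along a path of unitaries the
  ceiling sum changes by the variation of the argument of the determinant plus a function of the
  endpoints.  Multiplying the path by a fixed unitary \<open>C\<close> does not affect the first part.  The graphs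
  of \<open>\<gamma>(t) \<circ> M\<close> and \<open>I\<close> are carried by a symplectic map to those of \<open>\<gamma>(t)\<close> and \<open>M\<^sup>-\<^sup>1\<close>, hence the
  two indices to be compared differ by such a multiplication, and everything reduces to
  \<open>\<sigma>(A C) + dim ker (A C - 1) \<le> \<sigma>(A) + \<sigma>(C) + dim (ker (A - 1) \<inter> ker (C - 1))\<close>.  For a complex
  reflection \<open>C\<close> this follows from interlacing and integrality (determinants); in general \<open>C\<close> is a
  product of reflections along its eigenbasis.  The second inequality comes from the inverses.

  The index does not depend on the inner product because the eigenvalues on short arcs next to \<open>1\<close>
  are counted by forms which, for two inner products, differ by a quantity that is negligible on
  such arcs, while the multiplicity of \<open>1\<close> itself is a dimension of an intersection.
\<close>

no_notation vector_scalar_mult (infixl \<open>*s\<close> 70)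
unbundle no m_inv_syntax

section \<open>Unitary operators\<close>

text \<open>One device carries all the counting: a half-plane \<open>0 \<le> Re (c * z) + c0\<close>
  cuts an arc out of the unit circle, and the eigenvalues of a unitary \<open>W\<close> on that arc
  are counted by the Hermitian form \<open>Re (c * ip (W x) x) + c0 * Re (ip x x)\<close>.
  Interlacing, continuity of eigenvalues and the comparison of inner products are all read off from
  such forms.

  Interlacing alone loses up to one full turn per reflection. The determinant makes the defect an
  integer, and \<open>0 < ang z < 1\<close> decides which integer, separating the cases with and
  without a new fixed vector.

  Since \<open>maslov_index\<close> is a definite description over all inner products, its
  independence must be known before any value can be computed. Polarizations are therefore described
  by a projection \<open>P\<close> and the form \<open>H\<close> alone, without an inner product on
  the double space; a symplectic map then carries a polarization to another one by mere conjugation.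

  The condition \<open>\<gamma> 0 = id\<close> enters through \<open>angsum id = 0\<close>: at the
  initial end only the terms of the fixed unitary \<open>C\<close> and a dimension survive.\<close>

lemma (in finite_dimensional_vector_space) sum_scale_poly_eq_0:
  fixes T :: "'b \<Rightarrow> 'b"
  assumes T: "Vector_Spaces.linear scale scale T"
  shows "\<exists>p. p \<noteq> 0 \<and> (\<Sum>i\<le>degree p. coeff p i *s (T ^^ i) v) = 0"
proof -
  define d where "d = dim (UNIV :: 'b set)"
  let ?f = "\<lambda>i. (T ^^ i) v"
  have "\<exists>a. (\<exists>i\<le>d. a i \<noteq> 0) \<and> (\<Sum>i\<le>d. a i *s ?f i) = 0"
  \<comment> \<open>\<open>dependent\<close> speaks of sets and does not see repetitions, so two
    equal powers need their own relation, with coefficients \<open>1\<close> and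
    \<open>- 1\<close>.\<close>
  proof (cases "inj_on ?f {..d}")
    case False
    then obtain i j where ij: "i \<le> d" "j \<le> d" "i \<noteq> j" "?f i = ?f j"
      by (auto simp: inj_on_def)
    define a where "a k = (if k = i then 1 else if k = j then - 1 else 0 :: 'a)" for k
    have "(\<Sum>k\<le>d. a k *s ?f k) = (\<Sum>k\<in>{i,j}. a k *s ?f k)"
      by (rule sum.mono_neutral_right) (use ij in \<open>auto simp: a_def\<close>)
    also have "\<dots> = 0" using ij by (simp add: a_def)
    finally show ?thesis using ij(1) by (intro exI[of _ a]) (auto simp: a_def)
  next
    case True
    then have "card (?f ` {..d}) = Suc d" by (simp add: card_image)
    moreover have "card (?f ` {..d}) \<le> d" if "independent (?f ` {..d})"
      using independent_card_le_dim[OF subset_UNIV that] by (simp add: d_def)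
    ultimately have "dependent (?f ` {..d})" by fastforce
    then obtain u where u: "\<exists>x\<in>?f ` {..d}. u x \<noteq> 0" "(\<Sum>x\<in>?f ` {..d}. u x *s x) = 0"
      by (subst (asm) dependent_finite) auto
    have "(\<Sum>i\<le>d. u (?f i) *s ?f i) = 0"
      using u(2) sum.reindex[OF True, of "\<lambda>x. u x *s x"] by simp
    then show ?thesis using u(1) by (intro exI[of _ "\<lambda>i. u (?f i)"]) auto
  qed
  then obtain a i where a: "i \<le> d" "a i \<noteq> 0" "(\<Sum>i\<le>d. a i *s ?f i) = 0" by blast
  define p where "p = (\<Sum>i\<le>d. monom (a i) i)"
  have cf: "coeff p j = (if j \<le> d then a j else 0)" for j
    by (simp add: p_def coeff_sum)
  have "(\<Sum>i\<le>degree p. coeff p i *s ?f i) = (\<Sum>i\<le>d. coeff p i *s ?f i)"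
  proof (rule sum.mono_neutral_left)
    show "{..degree p} \<subseteq> {..d}" by (auto intro!: degree_le order.trans[OF _ degree_le] simp: cf)
  qed (auto simp: coeff_eq_0)
  also have "\<dots> = (\<Sum>i\<le>d. a i *s ?f i)" by (simp add: cf)
  finally have "(\<Sum>i\<le>degree p. coeff p i *s ?f i) = 0" using a by simp
  moreover have "p \<noteq> 0" using cf[of i] a by auto
  ultimately show ?thesis by blast
qed

text \<open>The shifted coefficients of \<open>X * q\<close> produce \<open>T\<close> applied to
  \<open>P q v\<close>, so a linear factor of the polynomial acts as the operator
  \<open>T - z\<close>.\<close>

lemma (in vector_space) sum_scale_coeff_linear_factor:
  fixes T :: "'b \<Rightarrow> 'b"
  assumes T: "Vector_Spaces.linear scale scale T"
  defines "P \<equiv> \<lambda>p v. \<Sum>i\<le>degree p. coeff p i *s (T ^^ i) v"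
  shows "P ([:- z, 1:] * q) v = T (P q v) - z *s P q v"
proof -
  interpret T: Vector_Spaces.linear scale scale T by (rule T)
  have P: "P p v = (\<Sum>i\<le>n. coeff p i *s (T ^^ i) v)" if "degree p \<le> n" for p n
    unfolding P_def by (rule sum.mono_neutral_left) (use that in \<open>auto simp: coeff_eq_0\<close>)
  define n where "n = degree q"
  have dg: "degree ([:- z, 1:] * q) \<le> Suc n"
    by (rule order.trans[OF degree_mult_le]) (simp add: n_def)
  have cz: "coeff ([:- z, 1:] * q) i = (case i of 0 \<Rightarrow> 0 | Suc j \<Rightarrow> coeff q j) - z * coeff q i" for i
    by (simp add: coeff_pCons split: nat.split)
  have "P ([:- z, 1:] * q) v = (\<Sum>i\<le>Suc n. (case i of 0 \<Rightarrow> 0 | Suc j \<Rightarrow> coeff q j) *s (T ^^ i) v)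
      - (\<Sum>i\<le>Suc n. (z * coeff q i) *s (T ^^ i) v)"
    unfolding P[OF dg] cz by (simp only: scale_left_diff_distrib sum_subtractf)
  also have "(\<Sum>i\<le>Suc n. (case i of 0 \<Rightarrow> 0 | Suc j \<Rightarrow> coeff q j) *s (T ^^ i) v)
      = (\<Sum>i\<le>n. coeff q i *s (T ^^ Suc i) v)"
    by (subst sum.atMost_Suc_shift) simp
  also have "\<dots> = T (P q v)"
    by (simp add: P_def n_def T.sum T.scale)
  also have "(\<Sum>i\<le>Suc n. (z * coeff q i) *s (T ^^ i) v) = z *s P q v"
    by (subst P[of q "Suc n"]) (simp_all add: n_def scale_sum_right scale_right_distrib)
  finally show ?thesis .
qed

lemma sum_mult_delta:
  fixes c :: "'a \<Rightarrow> complex"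
  assumes "finite A" "i \<in> A"
  shows "(\<Sum>j\<in>A. c j * (if j = i then 1 else 0)) = c i"
proof -
  have "(\<Sum>j\<in>A. c j * (if j = i then 1 else 0)) = (\<Sum>j\<in>A. if j = i then c j else 0)"
    by (rule sum.cong) auto
  also have "\<dots> = c i" using assms by simp
  finally show ?thesis .
qed

text \<open>A nonzero polynomial of least degree annihilating \<open>v\<close> has a root
  \<open>z\<close>. Its cofactor \<open>q\<close> has smaller degree, so \<open>P q\<close> is
  nonzero, and \<open>T - z\<close> kills it. The invariant subspace \<open>S\<close> is there for
  the induction along orthogonal complements.\<close>

lemma eigenvector_exists:
  fixes scale :: "complex \<Rightarrow> 'v::ab_group_add \<Rightarrow> 'v" and Basis :: "'v set"
  assumes "finite_dimensional_vector_space scale Basis"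
    and T: "Vector_Spaces.linear scale scale T"
    and S: "module.subspace scale S" "\<And>x. x \<in> S \<Longrightarrow> T x \<in> S"
    and v: "v \<in> S" "v \<noteq> 0"
  shows "\<exists>z x. x \<in> S \<and> x \<noteq> 0 \<and> T x = scale z x"
proof -
  interpret finite_dimensional_vector_space scale Basis by fact
  interpret T: Vector_Spaces.linear scale scale T by (rule T)
  define P where "P p = (\<Sum>i\<le>degree p. scale (coeff p i) ((T ^^ i) v))" for p
  obtain p where "p \<noteq> 0" "P p = 0" using sum_scale_poly_eq_0[OF T, of v] by (auto simp: P_def)
  then obtain p where p: "p \<noteq> 0" "P p = 0"
    and min: "\<And>q. q \<noteq> 0 \<Longrightarrow> P q = 0 \<Longrightarrow> degree p \<le> degree q"
    using ex_has_least_nat[of "\<lambda>p. p \<noteq> 0 \<and> P p = 0" p degree] by blast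
  have "degree p \<noteq> 0"
  proof
    assume "degree p = 0"
    then have "scale (coeff p 0) v = 0" using p by (simp add: P_def)
    then show False using v p \<open>degree p = 0\<close> by (metis leading_coeff_0_iff scale_eq_0_iff)
  qed
  then obtain z where "poly p z = 0"
    using fundamental_theorem_of_algebra[of p] constant_degree[of p] by auto
  then obtain q where q: "p = [:- z, 1:] * q" using poly_eq_0_iff_dvd by blast
  then have q0: "q \<noteq> 0" using p by auto
  have "degree p = degree [:- z, 1:] + degree q" unfolding q by (rule degree_mult_eq) (use q0 in auto)
  then have "degree p = Suc (degree q)" by simp
  then have "P q \<noteq> 0" using min[of q] q0 by fastforce
  moreover have "T (P q) = scale z (P q)"
    using sum_scale_coeff_linear_factor[OF T, of z q v] p q by (simp add: P_def)
  moreover have "(T ^^ i) v \<in> S" for i by (induction i) (auto simp: v S)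
  then have "P q \<in> S" unfolding P_def by (intro subspace_sum subspace_scale S)
  ultimately show ?thesis by blast
qed

section \<open>Hermitian spaces, orthonormal bases and diagonalization\<close>

locale hermitian_space = finite_dimensional_vector_space scale Basis
  for scale :: "complex \<Rightarrow> 'v::ab_group_add \<Rightarrow> 'v" (infixr \<open>*s\<close> 75) and Basis +
  fixes ip :: "'v \<Rightarrow> 'v \<Rightarrow> complex"
  assumes ip_add: "ip (x + y) z = ip x z + ip y z"
    and ip_scale: "ip (c *s x) z = c * ip x z"
    and ip_cnj: "ip y x = cnj (ip x y)"
    and ip_pos: "x \<noteq> 0 \<Longrightarrow> Re (ip x x) > 0"
begin

definition Idx :: "nat set" where "Idx = {1..dim (UNIV :: 'v set)}"

lemma finite_Idx [simp]: "finite Idx"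
  by (simp add: Idx_def)

lemma card_Idx: "card Idx = dim (UNIV :: 'v set)"
  by (simp add: Idx_def)

lemma ip_add_right: "ip z (x + y) = ip z x + ip z y"
  by (metis complex_cnj_add ip_add ip_cnj)

lemma ip_scale_right: "ip z (c *s x) = cnj c * ip z x"
  by (metis complex_cnj_mult ip_scale ip_cnj)

lemma ip_zero [simp]: "ip 0 x = 0" "ip x 0 = 0"
  using ip_scale[of 0 0 x] ip_scale_right[of x 0 0] by auto

lemma ip_minus: "ip (- x) z = - ip x z" "ip z (- x) = - ip z x"
  using ip_scale[of "-1" x z] ip_scale_right[of z "-1" x] by (simp_all add: scale_minus_left)

lemma ip_diff: "ip (x - y) z = ip x z - ip y z" "ip z (x - y) = ip z x - ip z y"
  using ip_add[of x "- y" z] ip_add_right[of z x "- y"] by (simp_all add: ip_minus)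

lemma ip_sum: "ip (sum f A) z = (\<Sum>i\<in>A. ip (f i) z)" "ip z (sum f A) = (\<Sum>i\<in>A. ip z (f i))"
  by (induction A rule: infinite_finite_induct; simp add: ip_add ip_add_right)+

lemma ip_self_real [simp]: "Im (ip x x) = 0"
  using ip_cnj[of x x] by (simp add: complex_eq_iff)

lemma ip_self_nonneg [simp]: "0 \<le> Re (ip x x)"
  using ip_pos[of x] by (cases "x = 0") auto

lemma ip_self_eq_0: "ip x x = 0 \<longleftrightarrow> x = 0"
  using ip_pos[of x] by (cases "x = 0") auto

definition onb :: "(nat \<Rightarrow> 'v) \<Rightarrow> bool" where
  "onb e \<longleftrightarrow> (\<forall>i\<in>Idx. \<forall>j\<in>Idx. ip (e i) (e j) = (if i = j then 1 else 0))"

lemma orthonormal_family: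
  assumes "finite I" "\<And>i j. i \<in> I \<Longrightarrow> j \<in> I \<Longrightarrow> ip (e i) (e j) = (if i = j then 1 else 0)"
  shows "independent (e ` I)" "inj_on e I"
proof -
  show inj: "inj_on e I"
    by (rule inj_onI) (metis assms(2) zero_neq_one)
  have "u i = 0" if "(\<Sum>j\<in>I. u j *s e j) = 0" "i \<in> I" for u i
  proof -
    have "0 = ip (\<Sum>j\<in>I. u j *s e j) (e i)" using that by simp
    also have "\<dots> = (\<Sum>j\<in>I. u j * (if j = i then 1 else 0))"
      using that(2) by (simp add: ip_sum ip_scale assms(2))
    also have "\<dots> = u i" using that(2) assms(1) by (rule sum_mult_delta[rotated])
    finally show ?thesis by simp
  qed
  note * = this
  show "independent (e ` I)"
  proof (rule independent_if_scalars_zero)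
    show "finite (e ` I)" using assms by simp
    fix f x assume f: "(\<Sum>x\<in>e ` I. f x *s x) = 0" and "x \<in> e ` I"
    then obtain i where "i \<in> I" "x = e i" by auto
    moreover have "(\<Sum>i\<in>I. f (e i) *s e i) = 0"
      using f sum.reindex[OF inj, of "\<lambda>x. f x *s x"] by simp
    ultimately show "f x = 0" using *[of "\<lambda>i. f (e i)"] by blast
  qed
qed

lemma onb_expand:
  assumes "onb e"
  shows "x = (\<Sum>j\<in>Idx. ip x (e j) *s e j)"
proof -
  have on: "ip (e i) (e j) = (if i = j then 1 else 0)" if "i \<in> Idx" "j \<in> Idx" for i j
    using assms that by (auto simp: onb_def)
  have "UNIV \<subseteq> span (e ` Idx)"
    by (rule card_ge_dim_independent)
       (use orthonormal_family[of "Idx" e] on in \<open>auto simp: card_image card_Idx\<close>)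
  then have sp: "span (e ` Idx) = UNIV" by auto
  define r where "r = x - (\<Sum>j\<in>Idx. ip x (e j) *s e j)"
  have re: "ip r (e i) = 0" if "i \<in> Idx" for i
  proof -
    have "ip r (e i) = ip x (e i) - (\<Sum>j\<in>Idx. ip x (e j) * (if j = i then 1 else 0))"
      unfolding r_def using that by (simp add: ip_diff ip_sum ip_scale on)
    also have "\<dots> = 0" using that by (subst sum_mult_delta) auto
    finally show ?thesis .
  qed
  have "ip r r = 0"
  proof -
    have "ip r y = 0" if "y \<in> span (e ` Idx)" for y
      using that
      by (induction rule: span_induct_alt) (auto simp: ip_add_right ip_scale_right re)
    then show ?thesis using sp by auto
  qed
  then have "r = 0" using ip_self_eq_0 by blast
  then show ?thesis by (simp add: r_def)
qed

text \<open>The hypothesis on orthogonal complements is what unitary and self-adjoint operators share.\<close>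

lemma eigenbasis_exists:
  assumes T: "Vector_Spaces.linear scale scale T"
    and orth: "\<And>z v x. T v = z *s v \<Longrightarrow> v \<noteq> 0 \<Longrightarrow> ip x v = 0 \<Longrightarrow> ip (T x) v = 0"
  shows "\<exists>e z. onb e \<and> (\<forall>j\<in>Idx. T (e j) = z j *s e j)"
proof -
  interpret T: Vector_Spaces.linear scale scale T by (rule T)
  have "\<exists>e z. (\<forall>i\<in>{1..n}. \<forall>j\<in>{1..n}. ip (e i) (e j) = (if i = j then 1 else 0)) \<and>
      (\<forall>j\<in>{1..n}. T (e j) = z j *s e j)" if "n \<le> dim (UNIV :: 'v set)" for n
    using that
  proof (induction n)
    case (Suc n)
    then obtain e z where on: "\<And>i j. i \<in> {1..n} \<Longrightarrow> j \<in> {1..n} \<Longrightarrow> ip (e i) (e j) = (if i = j then 1 else 0)"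
      and ev: "\<And>j. j \<in> {1..n} \<Longrightarrow> T (e j) = z j *s e j"
      by (metis Suc_leD)
    \<comment> \<open>The orthogonal complement of the eigenvectors found so far:
      \<open>orth\<close> makes it invariant, and a Gram-Schmidt remainder shows that it is
      nonzero.\<close>
    define S where "S = {x. \<forall>j\<in>{1..n}. ip x (e j) = 0}"
    have sS: "subspace S"
      by (auto simp: S_def subspace_def ip_add ip_scale)
    have TS: "T x \<in> S" if "x \<in> S" for x
    proof -
      have "e j \<noteq> 0" if "j \<in> {1..n}" for j using on[OF that that] by auto
      then show ?thesis using that orth ev unfolding S_def by blast
    qed
    have "\<exists>v\<in>S. v \<noteq> 0"
    proof -
      have "dim (span (e ` {1..n})) \<le> n"
        using dim_le_card[of "span (e ` {1..n})" "e ` {1..n}"] card_image_le[of "{1..n}" e] by simp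
      then have "span (e ` {1..n}) \<noteq> UNIV" using Suc.prems by (metis not_less_eq_eq)
      then obtain x where x: "x \<notin> span (e ` {1..n})" by auto
      define v where "v = x - (\<Sum>j=1..n. ip x (e j) *s e j)"
      have "v \<noteq> 0"
      proof
        assume "v = 0"
        then have "x = (\<Sum>j=1..n. ip x (e j) *s e j)" by (simp add: v_def)
        moreover have "\<dots> \<in> span (e ` {1..n})"
          by (intro span_sum span_scale span_base) auto
        ultimately show False using x by simp
      qed
      moreover have "ip v (e i) = 0" if "i \<in> {1..n}" for i
      proof -
        have "ip v (e i) = ip x (e i) - (\<Sum>j=1..n. ip x (e j) * (if j = i then 1 else 0))"
          unfolding v_def using that by (simp add: ip_diff ip_sum ip_scale on del: atLeastAtMost_iff)
        also have "\<dots> = 0" using that by (subst sum_mult_delta) auto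
        finally show ?thesis .
      qed
      ultimately show ?thesis unfolding S_def by blast
    qed
    then obtain x c where x: "x \<in> S" "x \<noteq> 0" "T x = c *s x"
      using eigenvector_exists[OF finite_dimensional_vector_space_axioms T sS TS] by blast
    define r where "r = Re (ip x x)"
    define t where "t = 1 / sqrt r"
    define v where "v = complex_of_real t *s x"
    have r: "r > 0" "ip x x = complex_of_real r"
      using ip_pos[OF x(2)] by (simp_all add: r_def complex_eq_iff)
    have "ip v v = complex_of_real (t\<^sup>2 * r)"
      by (simp add: v_def ip_scale ip_scale_right r(2) power2_eq_square)
    also have "t\<^sup>2 * r = 1"
      using r by (simp add: t_def power_divide)
    finally have vv: "ip v v = 1" by simp
    have vS: "v \<in> S" unfolding v_def by (rule subspace_scale[OF sS x(1)])
    have Tv: "T v = c *s v" by (simp add: v_def T.scale x scale_left_commute)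
    have v0: "ip v (e j) = 0" "ip (e j) v = 0" if "j \<in> {1..n}" for j
      using vS that ip_cnj[of "e j" v] by (auto simp: S_def)
    have up: "{1..Suc n} = insert (Suc n) {1..n}" by auto
    show ?case
      by (rule exI[of _ "e(Suc n := v)"], rule exI[of _ "z(Suc n := c)"])
         (use on ev vv v0 Tv in \<open>auto simp: up\<close>)
  qed auto
  from this[of "dim (UNIV :: 'v set)"] show ?thesis unfolding onb_def Idx_def by blast
qed

definition unitary :: "('v \<Rightarrow> 'v) \<Rightarrow> bool" where
  "unitary W \<longleftrightarrow> Vector_Spaces.linear scale scale W \<and> (\<forall>x y. ip (W x) (W y) = ip x y)"

definition diag :: "('v \<Rightarrow> 'v) \<Rightarrow> (nat \<Rightarrow> 'v) \<Rightarrow> (nat \<Rightarrow> complex) \<Rightarrow> bool" where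
  "diag W e z \<longleftrightarrow> Vector_Spaces.linear scale scale W \<and> onb e \<and> (\<forall>j\<in>Idx. W (e j) = z j *s e j)"

lemma diag_apply:
  assumes "diag W e z"
  shows "W x = (\<Sum>j\<in>Idx. (z j * ip x (e j)) *s e j)"
proof -
  interpret W: Vector_Spaces.linear scale scale W using assms by (simp add: diag_def)
  have "W x = W (\<Sum>j\<in>Idx. ip x (e j) *s e j)"
    using onb_expand[of e x] assms by (simp add: diag_def)
  also have "\<dots> = (\<Sum>j\<in>Idx. (z j * ip x (e j)) *s e j)"
    using assms by (simp add: W.sum W.scale diag_def mult.commute)
  finally show ?thesis .
qed

lemma onb_coord:
  assumes "onb e" "i \<in> Idx"
  shows "ip (\<Sum>j\<in>Idx. c j *s e j) (e i) = c i"
proof -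
  have "ip (\<Sum>j\<in>Idx. c j *s e j) (e i) = (\<Sum>j\<in>Idx. c j * (if j = i then 1 else 0))"
    using assms by (simp add: ip_sum ip_scale onb_def)
  also have "\<dots> = c i" using assms by (intro sum_mult_delta) auto
  finally show ?thesis .
qed

lemma onb_parseval:
  assumes "onb e"
  shows "ip x y = (\<Sum>j\<in>Idx. ip x (e j) * cnj (ip y (e j)))"
proof -
  have "ip x y = ip x (\<Sum>j\<in>Idx. ip y (e j) *s e j)" using onb_expand[OF assms, of y] by simp
  also have "\<dots> = (\<Sum>j\<in>Idx. ip x (e j) * cnj (ip y (e j)))"
    by (simp add: ip_sum ip_scale_right mult.commute)
  finally show ?thesis .
qed

lemma onb_dim_span:
  assumes "onb e" "I \<subseteq> Idx"
  shows "dim (span (e ` I)) = card I"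
proof -
  have I: "finite I" using finite_subset[OF assms(2)] by simp
  have "ip (e i) (e j) = (if i = j then 1 else 0)" if "i \<in> I" "j \<in> I" for i j
    using assms(1) subsetD[OF assms(2) that(1)] subsetD[OF assms(2) that(2)] by (simp add: onb_def)
  from orthonormal_family[OF I this] show ?thesis
    by (metis dim_span_eq_card_independent card_image)
qed

lemma onb_in_span_iff:
  assumes "onb e" "I \<subseteq> Idx"
  shows "x \<in> span (e ` I) \<longleftrightarrow> (\<forall>j\<in>Idx-I. ip x (e j) = 0)"
proof
  assume "x \<in> span (e ` I)"
  then show "\<forall>j\<in>Idx-I. ip x (e j) = 0"
  proof (induction rule: span_induct_alt)
    case (step c x y)
    from step(1) obtain i where "i \<in> I" "x = e i" by blast
    have "ip (e i) (e j) = 0" if j: "j \<in> Idx - I" for j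
    proof -
      have "i \<in> Idx" "j \<in> Idx" "i \<noteq> j" using assms(2) \<open>i \<in> I\<close> j by auto
      then show ?thesis using assms(1) unfolding onb_def by simp
    qed
    then show ?case using step \<open>x = e i\<close> by (simp add: ip_add ip_scale)
  qed auto
next
  assume *: "\<forall>j\<in>Idx-I. ip x (e j) = 0"
  have "x = (\<Sum>j\<in>Idx. ip x (e j) *s e j)" by (rule onb_expand[OF assms(1)])
  also have "\<dots> \<in> span (e ` I)"
  proof (rule span_sum)
    fix j assume "j \<in> Idx"
    then show "ip x (e j) *s e j \<in> span (e ` I)"
      using * by (cases "j \<in> I") (auto intro: span_scale span_base span_zero)
  qed
  finally show "x \<in> span (e ` I)" .
qed

text \<open>In coordinates the equation kills exactly the entries with
  \<open>z j \<noteq> c\<close>. Hence the operator determines the eigenvalue list of a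
  diagonalization up to order, which later makes \<open>angsum\<close> well defined.\<close>

lemma diag_eigenspace_dim:
  assumes "diag W e z"
  shows "dim {x. W x = c *s x} = card {j\<in>Idx. z j = c}"
proof -
  have e: "onb e" using assms by (simp add: diag_def)
  let ?I = "{j\<in>Idx. z j = c}"
  have "{x. W x = c *s x} = span (e ` ?I)"
  proof (rule Set.set_eqI)
    fix x
    have "W x = c *s x \<longleftrightarrow> (\<forall>j\<in>Idx. z j * ip x (e j) = c * ip x (e j))"
    proof
      assume "W x = c *s x"
      then have "(\<Sum>j\<in>Idx. (z j * ip x (e j)) *s e j) = c *s x" using diag_apply[OF assms] by simp
      then show "\<forall>j\<in>Idx. z j * ip x (e j) = c * ip x (e j)"
        using onb_coord[OF e, of _ "\<lambda>j. z j * ip x (e j)"] by (auto simp: ip_scale)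
    next
      assume *: "\<forall>j\<in>Idx. z j * ip x (e j) = c * ip x (e j)"
      have "W x = (\<Sum>j\<in>Idx. (z j * ip x (e j)) *s e j)" by (rule diag_apply[OF assms])
      also have "\<dots> = c *s (\<Sum>j\<in>Idx. ip x (e j) *s e j)"
        unfolding scale_sum_right scale_scale by (rule sum.cong) (use * in auto)
      finally show "W x = c *s x" using onb_expand[OF e, of x] by simp
    qed
    also have "\<dots> \<longleftrightarrow> (\<forall>j\<in>Idx-?I. ip x (e j) = 0)" by auto
    also have "\<dots> \<longleftrightarrow> x \<in> span (e ` ?I)" by (rule onb_in_span_iff[symmetric]) (use e in auto)
    finally show "x \<in> {x. W x = c *s x} \<longleftrightarrow> x \<in> span (e ` ?I)" by simp
  qed
  then show ?thesis using onb_dim_span[OF e, of ?I] by (simp del: dim_span)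
qed

text \<open>An eigenvector of a unitary has a nonzero eigenvalue, so orthogonality to it passes from
  \<open>x\<close> to \<open>W x\<close>, as \<open>eigenbasis_exists\<close> requires.\<close>

lemma unitary_diag:
  assumes "unitary W"
  shows "\<exists>e z. diag W e z"
proof -
  have W: "Vector_Spaces.linear scale scale W" using assms by (simp add: unitary_def)
  have "ip (W x) v = 0" if "W v = z *s v" "v \<noteq> 0" "ip x v = 0" for z v x
  proof -
    have "ip (W x) (z *s v) = 0" using assms that by (metis unitary_def)
    moreover have "z \<noteq> 0"
      using assms that by (metis unitary_def ip_self_eq_0 ip_zero(1) scale_zero_left)
    ultimately show ?thesis by (simp add: ip_scale_right)
  qed
  then show ?thesis using eigenbasis_exists[OF W] W by (auto simp: diag_def)
qed

lemma unitary_diag_norm: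
  assumes "unitary W" "diag W e z" "j \<in> Idx"
  shows "cmod (z j) = 1"
proof -
  have "ip (W (e j)) (W (e j)) = ip (e j) (e j)" using assms(1) unfolding unitary_def by blast
  then have "ip (W (e j)) (W (e j)) = 1" using assms by (simp add: diag_def onb_def)
  moreover have "ip (W (e j)) (W (e j)) = z j * cnj (z j)"
    using assms by (auto simp: diag_def onb_def ip_scale ip_scale_right)
  ultimately show ?thesis
    using norm_ge_zero[of "z j"]
    by (auto simp: power2_eq_1_iff simp flip: complex_norm_square of_real_power simp del: norm_ge_zero)
qed

lemma diag_unitary:
  assumes "diag W e z" "\<And>j. j \<in> Idx \<Longrightarrow> cmod (z j) = 1"
  shows "unitary W"
proof -
  have e: "onb e" using assms by (simp add: diag_def)
  have "ip (W x) (W y) = ip x y" for x y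
  proof -
    have c: "ip (W x) (e j) = z j * ip x (e j)" if "j \<in> Idx" for x j
      using diag_apply[OF assms(1), of x] onb_coord[OF e that] by simp
    have zz: "z j * cnj (z j) = 1" if "j \<in> Idx" for j
      using assms(2)[OF that] by (simp flip: complex_norm_square)
    have "ip (W x) (W y) = (\<Sum>j\<in>Idx. (z j * cnj (z j)) * (ip x (e j) * cnj (ip y (e j))))"
      by (subst onb_parseval[OF e]) (auto intro!: sum.cong simp: c mult_ac)
    also have "\<dots> = ip x y" by (simp add: zz onb_parseval[OF e, of x y])
    finally show ?thesis .
  qed
  then show ?thesis using assms by (simp add: unitary_def diag_def)
qed

end

section \<open>Counting eigenvalues on arcs by Hermitian forms\<close>

context hermitian_space
begin

text \<open>The sign of each weight depends only on the side of a line on which \<open>z j\<close>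
  lies, so the inertia of the form is a count of eigenvalues.\<close>

lemma diag_quadratic:
  assumes "diag W e z"
  shows "Re (c * ip (W x) x) + c0 * Re (ip x x) = (\<Sum>j\<in>Idx. (Re (c * z j) + c0) * (cmod (ip x (e j)))\<^sup>2)"
proof -
  have e: "onb e" using assms by (simp add: diag_def)
  have c: "ip (W x) (e j) = z j * ip x (e j)" if "j \<in> Idx" for j
    using diag_apply[OF assms(1), of x] onb_coord[OF e that] by simp
  have "c * ip (W x) x + c0 * ip x x
      = (\<Sum>j\<in>Idx. (c * z j + c0) * complex_of_real ((cmod (ip x (e j)))\<^sup>2))"
    by (subst (1 2) onb_parseval[OF e])
       (auto simp: complex_norm_square sum_distrib_left sum.distrib[symmetric] c algebra_simps
         simp del: of_real_power intro!: sum.cong)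
  then have "Re (c * ip (W x) x + c0 * ip x x)
      = Re (\<Sum>j\<in>Idx. (c * z j + c0) * complex_of_real ((cmod (ip x (e j)))\<^sup>2))" by simp
  then show ?thesis by (simp del: of_real_power)
qed

text \<open>By hypothesis \<open>F\<close> meets the span of the \<open>e j\<close> with
  \<open>j\<close> outside \<open>I\<close> trivially, and that span has codimension
  \<open>card I\<close>.\<close>

lemma dim_le_count:
  assumes e: "onb e" and F: "subspace F"
    and I: "I \<subseteq> Idx" "\<And>x. x \<in> F \<Longrightarrow> (\<And>j. j \<in> I \<Longrightarrow> ip x (e j) = 0) \<Longrightarrow> x = 0"
  shows "dim F \<le> card I"
proof -
  let ?G = "span (e ` (Idx - I))"
  have "F \<inter> ?G = {0}"
  proof -
    have "x = 0" if "x \<in> F" "x \<in> ?G" for x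
    proof (rule I(2)[OF that(1)])
      fix j assume "j \<in> I"
      then show "ip x (e j) = 0" using that(2) onb_in_span_iff[OF e, of "Idx - I"] I(1) by auto
    qed
    then show ?thesis using subspace_0[OF F] span_zero by blast
  qed
  then have "dim {x + y |x y. x \<in> F \<and> y \<in> ?G} = dim F + dim ?G"
    using dim_sums_Int[OF F subspace_span, of "e ` (Idx - I)"] by (simp del: dim_span)
  moreover have "dim ?G = card Idx - card I"
    using onb_dim_span[OF e, of "Idx - I"] I(1) card_Diff_subset[of I Idx]
    by (simp add: finite_subset[OF I(1)] del: dim_span)
  moreover have "dim {x + y |x y. x \<in> F \<and> y \<in> ?G} \<le> card Idx"
    unfolding card_Idx by (rule dim_subset) simp
  ultimately show ?thesis using card_mono[OF finite_Idx I(1)] by linarith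
qed

lemma count_pos:
  assumes "diag W e z" "subspace F"
    and F: "\<And>x. x \<in> F \<Longrightarrow> x \<noteq> 0 \<Longrightarrow> 0 < Re (c * ip (W x) x) + c0 * Re (ip x x)"
  shows "dim F \<le> card {j\<in>Idx. 0 < Re (c * z j) + c0}"
proof (rule dim_le_count)
  show "onb e" using assms by (simp add: diag_def)
  fix x assume x: "x \<in> F" "\<And>j. j \<in> {j\<in>Idx. 0 < Re (c * z j) + c0} \<Longrightarrow> ip x (e j) = 0"
  have "(\<Sum>j\<in>Idx. (Re (c * z j) + c0) * (cmod (ip x (e j)))\<^sup>2) \<le> 0"
  proof (rule sum_nonpos)
    fix j assume "j \<in> Idx"
    then show "(Re (c * z j) + c0) * (cmod (ip x (e j)))\<^sup>2 \<le> 0"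
      using x(2)[of j] by (cases "0 < Re (c * z j) + c0") (auto simp: mult_nonpos_nonneg)
  qed
  then show "x = 0" using F[OF x(1)] diag_quadratic[OF assms(1), of c x c0] by fastforce
qed (use assms in auto)

text \<open>If the coordinates with nonnegative weight vanish, the form is a sum of terms
  \<open>\<le> 0\<close>. Being \<open>\<ge> 0\<close> on \<open>F\<close>, it forces every term to
  be \<open>0\<close>, and the remaining weights are nonzero, so the other coordinates vanish
  too.\<close>

lemma count_nonneg:
  assumes "diag W e z" "subspace F"
    and F: "\<And>x. x \<in> F \<Longrightarrow> 0 \<le> Re (c * ip (W x) x) + c0 * Re (ip x x)"
  shows "dim F \<le> card {j\<in>Idx. 0 \<le> Re (c * z j) + c0}"
proof (rule dim_le_count)
  show e: "onb e" using assms by (simp add: diag_def)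
  fix x assume x: "x \<in> F" "\<And>j. j \<in> {j\<in>Idx. 0 \<le> Re (c * z j) + c0} \<Longrightarrow> ip x (e j) = 0"
  have le: "(Re (c * z j) + c0) * (cmod (ip x (e j)))\<^sup>2 \<le> 0" if "j \<in> Idx" for j
    using x(2)[of j] that by (cases "0 \<le> Re (c * z j) + c0") (auto simp: mult_nonpos_nonneg)
  have "(\<Sum>j\<in>Idx. (Re (c * z j) + c0) * (cmod (ip x (e j)))\<^sup>2) = 0"
    using sum_nonpos[OF le] F[OF x(1)] diag_quadratic[OF assms(1), of c x c0] by fastforce
  then have z: "\<forall>j\<in>Idx. (Re (c * z j) + c0) * (cmod (ip x (e j)))\<^sup>2 = 0"
    using sum_nonneg_eq_0_iff[of Idx "\<lambda>j. - ((Re (c * z j) + c0) * (cmod (ip x (e j)))\<^sup>2)"] le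
    by (simp add: sum_negf)
  have "ip x (e j) = 0" if "j \<in> Idx" for j
    using z x(2)[of j] that by (cases "0 \<le> Re (c * z j) + c0") auto
  then show "x = 0" using onb_expand[OF e, of x] by simp
qed (use assms in auto)

text \<open>Converse to \<open>count_pos\<close>: the span of these eigenvectors is a subspace that
  attains the count.\<close>

lemma eigenspan_pos:
  assumes "diag W e z" "x \<in> span (e ` {j\<in>Idx. 0 < Re (c * z j) + c0})" "x \<noteq> 0"
  shows "0 < Re (c * ip (W x) x) + c0 * Re (ip x x)"
proof -
  have e: "onb e" using assms by (simp add: diag_def)
  let ?I = "{j\<in>Idx. 0 < Re (c * z j) + c0}"
  have x: "ip x (e j) = 0" if "j \<in> Idx - ?I" for j
    using assms(2) onb_in_span_iff[OF e, of ?I] that by blast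
  obtain j where j: "j \<in> Idx" "ip x (e j) \<noteq> 0"
  proof (rule ccontr)
    assume "\<not> thesis"
    then have "\<forall>j\<in>Idx. ip x (e j) = 0" using that by blast
    then show False using onb_expand[OF e, of x] assms(3) by simp
  qed
  have j': "0 < Re (c * z j) + c0" using j x[of j] by blast
  have "0 < (\<Sum>j\<in>Idx. (Re (c * z j) + c0) * (cmod (ip x (e j)))\<^sup>2)"
  proof (rule sum_pos2[OF finite_Idx j(1)])
    show "0 < (Re (c * z j) + c0) * (cmod (ip x (e j)))\<^sup>2"
      using j' j(2) by (intro mult_pos_pos) simp_all
    fix i assume "i \<in> Idx"
    then show "0 \<le> (Re (c * z i) + c0) * (cmod (ip x (e i)))\<^sup>2"
      using x[of i] by (cases "i \<in> ?I") auto
  qed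
  then show ?thesis using diag_quadratic[OF assms(1)] by simp
qed

lemma eigenspan_nonneg:
  assumes "diag W e z" "x \<in> span (e ` {j\<in>Idx. 0 \<le> Re (c * z j) + c0})"
  shows "0 \<le> Re (c * ip (W x) x) + c0 * Re (ip x x)"
proof -
  have e: "onb e" using assms by (simp add: diag_def)
  let ?I = "{j\<in>Idx. 0 \<le> Re (c * z j) + c0}"
  have x: "ip x (e j) = 0" if "j \<in> Idx - ?I" for j
    using assms(2) onb_in_span_iff[OF e, of ?I] that by blast
  have "0 \<le> (\<Sum>j\<in>Idx. (Re (c * z j) + c0) * (cmod (ip x (e j)))\<^sup>2)"
  proof (rule sum_nonneg)
    fix i assume "i \<in> Idx"
    then show "0 \<le> (Re (c * z i) + c0) * (cmod (ip x (e i)))\<^sup>2"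
      using x[of i] by (cases "i \<in> ?I") auto
  qed
  then show ?thesis using diag_quadratic[OF assms(1)] by simp
qed

lemma dim_hyperplane:
  assumes E: "subspace E"
  shows "dim E \<le> dim {x\<in>E. ip x v = 0} + 1"
proof (cases "\<forall>x\<in>E. ip x v = 0")
  case True
  then have "{x\<in>E. ip x v = 0} = E" by auto
  then show ?thesis by simp
next
  case False
  then obtain w where w: "w \<in> E" "ip w v \<noteq> 0" by blast
  have "E \<subseteq> span (insert w {x\<in>E. ip x v = 0})"
  proof
    fix x assume x: "x \<in> E"
    let ?c = "ip x v / ip w v"
    have "x - ?c *s w \<in> {x\<in>E. ip x v = 0}"
      using w x E by (auto simp: ip_diff ip_scale intro!: subspace_diff subspace_scale)
    then have "x - ?c *s w + ?c *s w \<in> span (insert w {x\<in>E. ip x v = 0})"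
      by (intro span_add span_scale) (auto intro: span_base)
    then show "x \<in> span (insert w {x\<in>E. ip x v = 0})" by simp
  qed
  then have "dim E \<le> dim (insert w {x\<in>E. ip x v = 0})" by (rule dim_mono)
  then show ?thesis by (auto simp: dim_insert split: if_splits)
qed

text \<open>Compressing to \<open>v\<^sup>\<bottom>\<close>, where \<open>A\<close> and \<open>A \<circ> R\<close> agree, loses one dimension; a fixed vector of
  \<open>A \<circ> R\<close> outside \<open>v\<^sup>\<bottom>\<close> on the boundary of the arc restores it.\<close>

lemma rank_one_count:
  assumes A: "diag A e a" and B: "diag B f b" "unitary B"
    and AB: "\<And>x. ip x v = 0 \<Longrightarrow> B x = A x"
  shows "card {j\<in>Idx. 0 \<le> Re (c * a j) + c0} \<le> card {j\<in>Idx. 0 \<le> Re (c * b j) + c0} + 1"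
    and "B u = u \<Longrightarrow> ip u v \<noteq> 0 \<Longrightarrow> Re c + c0 = 0 \<Longrightarrow>
      card {j\<in>Idx. 0 \<le> Re (c * a j) + c0} \<le> card {j\<in>Idx. 0 \<le> Re (c * b j) + c0}"
proof -
  have e: "onb e" using A by (simp add: diag_def)
  let ?I = "{j\<in>Idx. 0 \<le> Re (c * a j) + c0}"
  define E where "E = span (e ` ?I)"
  define F where "F = {x\<in>E. ip x v = 0}"
  have sE: "subspace E" by (simp add: E_def)
  have sF: "subspace F" using sE by (auto simp: F_def subspace_def ip_add ip_scale)
  have dE: "dim E = card ?I" unfolding E_def by (rule onb_dim_span[OF e]) auto
  have nn: "0 \<le> Re (c * ip (B x) x) + c0 * Re (ip x x)" if "x \<in> F" for x
    using eigenspan_nonneg[OF A, of x c c0] that AB[of x] by (auto simp: F_def E_def)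
  have dF: "dim E \<le> dim F + 1" unfolding F_def by (rule dim_hyperplane[OF sE])
  have "dim F \<le> card {j\<in>Idx. 0 \<le> Re (c * b j) + c0}"
    by (rule count_nonneg[OF B(1) sF nn])
  then show "card ?I \<le> card {j\<in>Idx. 0 \<le> Re (c * b j) + c0} + 1" using dE dF by simp
  have spF: "span F = F" using sF by (simp only: span_eq_iff)
  assume u: "B u = u" "ip u v \<noteq> 0" "Re c + c0 = 0"
  interpret B: Vector_Spaces.linear scale scale B using B by (simp add: diag_def)
  \<comment> \<open>\<open>Re c + c0 = 0\<close> puts the eigenvalue \<open>1\<close> on the
    boundary line, so the form equals \<open>Re (c * (ip (B x) x - ip x x))\<close>. As
    \<open>B\<close> is unitary and fixes \<open>u\<close>, all terms with \<open>u\<close> cancel,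
    cross terms included, and \<open>u\<close> may be added to \<open>F\<close>.\<close>
  have "0 \<le> Re (c * ip (B x) x) + c0 * Re (ip x x)" if x: "x \<in> span (insert u F)" for x
  proof -
    obtain k where "x - k *s u \<in> F"
      using x unfolding span_breakdown_eq spF by blast
    then obtain y where y: "y \<in> F" "x = y + k *s u" by (metis diff_add_cancel)
    have Bu: "ip (B y) u = ip y u" using B(2) u(1) by (metis unitary_def)
    have "ip (B x) x = ip (B y) y + cnj k * ip y u + k * ip u y + k * cnj k * ip u u"
      by (simp add: y B.add B.scale u ip_add ip_add_right ip_scale ip_scale_right Bu algebra_simps)
    moreover have "ip x x = ip y y + cnj k * ip y u + k * ip u y + k * cnj k * ip u u"
      by (simp add: y ip_add ip_add_right ip_scale ip_scale_right algebra_simps)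
    ultimately have d: "ip (B x) x - ip x x = ip (B y) y - ip y y" by simp
    have c0: "c0 = - Re c" using u(3) by simp
    have im: "Im (ip x x) = 0" "Im (ip y y) = 0" by auto
    have "Re (c * ip (B x) x) + c0 * Re (ip x x) = Re (c * (ip (B x) x - ip x x))"
      by (simp add: c0 im algebra_simps)
    also have "\<dots> = Re (c * ip (B y) y) + c0 * Re (ip y y)"
      unfolding d by (simp add: c0 im algebra_simps)
    finally show ?thesis using nn[OF y(1)] by simp
  qed
  then have "dim (span (insert u F)) \<le> card {j\<in>Idx. 0 \<le> Re (c * b j) + c0}"
    by (rule count_nonneg[OF B(1) subspace_span])
  moreover have "u \<notin> F" using u by (simp add: F_def)
  then have "dim (span (insert u F)) = dim F + 1"
    by (simp add: dim_insert spF)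
  ultimately show "card ?I \<le> card {j\<in>Idx. 0 \<le> Re (c * b j) + c0}" using dE dF by linarith
qed

end

section \<open>Angle sums\<close>

text \<open>The counts say that the two image multisets coincide.\<close>

lemma equal_counts_permutation:
  assumes "finite I" "\<And>c. card {j\<in>I. f j = c} = card {j\<in>I. g j = c}"
  obtains p where "p permutes I" "\<forall>j\<in>I. f j = g (p j)"
proof -
  have "count (image_mset f (mset_set I)) c = card {j\<in>I. f j = c}" for f :: "'a \<Rightarrow> 'b" and c
  proof -
    have "{j \<in> I. c = f j} = {j \<in> I. f j = c}" by auto
    then show ?thesis by (simp add: count_image_mset' assms(1))
  qed
  then have "image_mset f (mset_set I) = image_mset g (mset_set I)"
    by (intro multiset_eqI) (simp add: assms(2))
  then show thesis using image_mset_eq_implies_permutes[OF assms(1)] that by metis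
qed

lemma equal_counts_sum:
  fixes F :: "'b \<Rightarrow> 'c::comm_monoid_add"
  assumes "finite I" "\<And>c. card {j\<in>I. f j = c} = card {j\<in>I. g j = c}"
  shows "(\<Sum>j\<in>I. F (f j)) = (\<Sum>j\<in>I. F (g j))"
proof -
  obtain p where p: "p permutes I" "\<forall>j\<in>I. f j = g (p j)"
    using equal_counts_permutation[OF assms] .
  have "(\<Sum>j\<in>I. F (f j)) = (\<Sum>j\<in>I. F (g (p j)))" using p by simp
  also have "\<dots> = (\<Sum>j\<in>I. F (g j))"
    using sum.permute[OF p(1), of "\<lambda>j. F (g j)"] by (simp add: o_def)
  finally show ?thesis .
qed

definition ang :: "complex \<Rightarrow> real" where
  "ang z = Arg2pi z / (2 * pi)"

lemma cis_eq_cis_imp: "cis s = cis t \<Longrightarrow> \<exists>n::int. s = t + 2 * pi * of_int n"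
proof -
  assume "cis s = cis t"
  then have "cis (s - t) = 1" by (simp flip: cis_divide)
  then have "cos (s - t) = 1" by (simp add: complex_eq_iff)
  then obtain n :: int where "s - t = n * 2 * pi" by (auto simp: cos_one_2pi_int)
  then show ?thesis by (intro exI[of _ n]) (simp add: algebra_simps)
qed

lemma ang_bounds: "0 \<le> ang z" "ang z < 1"
  using Arg2pi_ge_0[of z] Arg2pi_lt_2pi[of z] by (simp_all add: ang_def)

lemma cis_ang: "cmod z = 1 \<Longrightarrow> cis (2 * pi * ang z) = z"
  using complex_norm_eq_1_exp[of z] by (simp add: ang_def cis_conv_exp)

lemma ang_cis_frac: "ang (cis t) = frac (t / (2 * pi))"
proof -
  have "0 \<le> frac (t / (2 * pi))" "frac (t / (2 * pi)) < 1" by (simp_all add: frac_lt_1)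
  moreover have "cis t = cis (2 * pi * frac (t / (2 * pi)))"
  proof -
    have "2 * pi * frac (t / (2 * pi)) = t - 2 * pi * of_int \<lfloor>t / (2 * pi)\<rfloor>"
      by (simp add: frac_def field_simps)
    then show ?thesis by (simp flip: cis_divide add: cis_multiple_2pi)
  qed
  ultimately have "Arg2pi (cis t) = 2 * pi * frac (t / (2 * pi))"
    by (intro Arg2pi_unique[of 1]) (auto simp: cis_conv_exp)
  then show ?thesis by (simp add: ang_def)
qed

lemma ang_eq_0_iff: "cmod z = 1 \<Longrightarrow> ang z = 0 \<longleftrightarrow> z = 1"
  using cis_ang[of z] Arg2pi_of_real[of 1] by (auto simp: ang_def)

text \<open>The arc from \<open>1\<close> to \<open>cis (2 * pi * x)\<close> has midpoint
  \<open>cis (pi * x)\<close> and half-width \<open>pi * x\<close>; the half-plane is bounded by the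
  line through its endpoints. This line passes through \<open>1\<close>, as the second part of
  \<open>rank_one_count\<close> demands.\<close>

lemma ang_le_iff:
  assumes z: "cmod z = 1" and x: "0 \<le> x" "x < 1"
  shows "0 \<le> Re (cis (- (pi * x)) * z) + (- cos (pi * x)) \<longleftrightarrow> ang z \<le> x"
proof -
  define a where "a = ang z"
  have a: "0 \<le> a" "a < 1" "z = cis (2 * pi * a)" using ang_bounds cis_ang[OF z] by (auto simp: a_def)
  have re: "Re (cis (- (pi * x)) * z) = cos (2 * pi * a - pi * x)"
    by (simp add: a cis_mult)
  have px: "0 \<le> pi * x" "pi * x \<le> pi" using x by simp_all
  have "cos (pi * x) \<le> cos (2 * pi * a - pi * x) \<longleftrightarrow> a \<le> x"
  proof (cases "2 * pi * a - pi * x \<le> pi")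
    case True
    let ?y = "\<bar>2 * pi * a - pi * x\<bar>"
    have "- pi \<le> 2 * pi * a - pi * x" using px a by (smt (verit) mult_nonneg_nonneg pi_gt_zero)
    then have y: "0 \<le> ?y" "?y \<le> pi" using True by auto
    have pa: "0 \<le> pi * a" using a by simp
    have "cos (pi * x) \<le> cos ?y \<longleftrightarrow> ?y \<le> pi * x"
      by (rule cos_mono_le_eq) (use y px in auto)
    also have "\<dots> \<longleftrightarrow> pi * a \<le> pi * x"
      using pa by (simp only: abs_le_iff) linarith
    also have "\<dots> \<longleftrightarrow> a \<le> x" by simp
    finally show ?thesis by simp
  next
    case False
    \<comment> \<open>Beyond \<open>pi\<close> the angle is reflected; the result exceeds
      \<open>pi * x\<close> because \<open>a < 1\<close>.\<close>
    let ?y = "2 * pi - (2 * pi * a - pi * x)"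
    have pa: "pi * a < pi" using a by simp
    have y: "?y \<le> pi" "pi * x < ?y" using False pa by auto
    have "cos ?y < cos (pi * x)" by (rule cos_monotone_0_pi) (use y px in auto)
    moreover have "cos ?y = cos (2 * pi * a - pi * x)" by (simp only: cos_2pi_minus)
    moreover have "\<not> a \<le> x"
    proof
      assume "a \<le> x"
      then have "pi * a \<le> pi * x" by simp
      then show False using False px by linarith
    qed
    ultimately show ?thesis by simp
  qed
  moreover have "0 \<le> u + - w \<longleftrightarrow> w \<le> u" for u w :: real by linarith
  ultimately show ?thesis unfolding re a_def by simp
qed

text \<open>Layer-cake argument: the counting function \<open>card {j\<in>I. s j \<le> x}\<close>
  has integral \<open>\<Sum>j\<in>I. 1 - s j\<close> over \<open>[0, 1]\<close>, so a pointwise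
  bound on counts integrates to a bound on sums.\<close>

lemma sum_le_of_counts:
  fixes s t :: "'i \<Rightarrow> real"
  assumes I: "finite I" and s: "\<And>j. j \<in> I \<Longrightarrow> 0 \<le> s j \<and> s j < 1" and t: "\<And>j. j \<in> I \<Longrightarrow> 0 \<le> t j \<and> t j < 1"
    and le: "\<And>x. 0 \<le> x \<Longrightarrow> x < 1 \<Longrightarrow> card {j\<in>I. s j \<le> x} \<le> card {j\<in>I. t j \<le> x} + e"
  shows "sum t I \<le> sum s I + real e"
proof -
  have step: "((\<lambda>x. if r \<le> x then 1 else 0) has_integral (1 - r)) {0..1::real}" if "0 \<le> r \<and> r < 1" for r :: real
  proof -
    have "((\<lambda>x::real. 1::real) has_integral (1 - r)) {r..1}"
      using has_integral_const_real[of "1::real" r 1] that by simp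
    then have "((\<lambda>x. if x \<in> {r..1} then 1 else 0) has_integral (1 - r)) {0..1::real}"
      by (subst has_integral_restrict) (use that in auto)
    then show ?thesis by (rule has_integral_eq[rotated]) auto
  qed
  have int: "((\<lambda>x. real (card {j\<in>I. r j \<le> x})) has_integral (\<Sum>j\<in>I. 1 - r j)) {0..1::real}"
    if "\<And>j. j \<in> I \<Longrightarrow> 0 \<le> r j \<and> r j < 1" for r :: "'i \<Rightarrow> real"
  proof -
    have "((\<lambda>x. \<Sum>j\<in>I. if r j \<le> x then 1 else 0) has_integral (\<Sum>j\<in>I. 1 - r j)) {0..1::real}"
      by (rule has_integral_sum[OF I]) (rule step[OF that])
    moreover have "(\<Sum>j\<in>I. if r j \<le> x then 1 else 0) = real (card {j\<in>I. r j \<le> x})" for x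
      using I by (simp add: sum.If_cases Int_def)
    ultimately show ?thesis by simp
  qed
  have "((\<lambda>x. real (card {j\<in>I. t j \<le> x}) + real e) has_integral ((\<Sum>j\<in>I. 1 - t j) + real e)) {0..1::real}"
    by (rule has_integral_add[OF int[OF t]]) (use has_integral_const_real[of "real e" 0 1] in simp_all)
  with int[OF s] have "(\<Sum>j\<in>I. 1 - s j) \<le> (\<Sum>j\<in>I. 1 - t j) + real e"
  proof (rule has_integral_le)
    fix x :: real assume x: "x \<in> {0..1}"
    show "real (card {j\<in>I. s j \<le> x}) \<le> real (card {j\<in>I. t j \<le> x}) + real e"
    \<comment> \<open>The hypothesis stops short of \<open>x = 1\<close>, where both counts equal
      \<open>card I\<close>.\<close>
    proof (cases "x < 1")
      case True
      then show ?thesis using le[of x] x by (simp flip: of_nat_add)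
    next
      case False
      then have "{j\<in>I. s j \<le> x} = I" "{j\<in>I. t j \<le> x} = I" using s t x by fastforce+
      then show ?thesis by simp
    qed
  qed
  then show ?thesis by (simp add: sum_subtractf)
qed

text \<open>The matrix determinant, reduced to the three properties used below; \<open>Suc\<close>
  translates between matrix indices from \<open>0\<close> and the indices
  \<open>1..n\<close>.\<close>

lemma determinant_function_exists:
  fixes n :: nat
  shows "\<exists>D :: (nat \<Rightarrow> nat \<Rightarrow> complex) \<Rightarrow> complex.
    (\<forall>A B. D (\<lambda>i j. \<Sum>k=1..n. A i k * B k j) = D A * D B) \<and>
    (\<forall>d. D (\<lambda>i j. if i = j then d i else 0) = (\<Prod>i=1..n. d i)) \<and>
    (\<forall>A B. (\<forall>i\<in>{1..n}. \<forall>j\<in>{1..n}. A i j = B i j) \<longrightarrow> D A = D B)"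
proof -
  define F :: "(nat \<Rightarrow> nat \<Rightarrow> complex) \<Rightarrow> complex mat"
    where "F A = mat n n (\<lambda>(i, j). A (Suc i) (Suc j))" for A
  have F: "F A \<in> carrier_mat n n" for A by (simp add: F_def)
  have "det (F (\<lambda>i j. \<Sum>k=1..n. A i k * B k j)) = det (F A) * det (F B)" for A B
  proof -
    have "F (\<lambda>i j. \<Sum>k=1..n. A i k * B k j) = F A * F B"
      by (rule eq_matI)
         (auto simp: F_def scalar_prod_def intro!: sum.reindex_bij_witness[of _ Suc "\<lambda>i. i - 1"])
    then show ?thesis using det_mult[OF F F] by simp
  qed
  moreover have "det (F (\<lambda>i j. if i = j then d i else 0)) = (\<Prod>i=1..n. d i)" for d
  proof -
    have "upper_triangular (F (\<lambda>i j. if i = j then d i else 0))"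
      by (auto simp: F_def upper_triangular_def)
    then have "det (F (\<lambda>i j. if i = j then d i else 0))
        = prod_list (diag_mat (F (\<lambda>i j. if i = j then d i else 0)))"
      by (rule det_upper_triangular[OF _ F])
    also have "\<dots> = (\<Prod>i<n. d (Suc i))"
      by (simp add: diag_mat_def F_def prod.list_conv_set_nth atLeast0LessThan)
    also have "\<dots> = (\<Prod>i=1..n. d i)"
      by (rule prod.reindex_bij_witness[of _ "\<lambda>i. i - 1" Suc]) auto
    finally show ?thesis .
  qed
  moreover have "det (F A) = det (F B)" if "\<forall>i\<in>{1..n}. \<forall>j\<in>{1..n}. A i j = B i j" for A B
  proof -
    have "F A = F B" unfolding F_def by (rule eq_matI) (use that in auto)
    then show ?thesis by simp
  qed
  ultimately show ?thesis by (intro exI[of _ "\<lambda>A. det (F A)"]) blast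
qed

section \<open>Angle sums and determinants of unitaries\<close>

context hermitian_space
begin

lemma unitary_linear: "unitary W \<Longrightarrow> Vector_Spaces.linear scale scale W"
  by (simp add: unitary_def)

lemma unitary_comp: "unitary A \<Longrightarrow> unitary B \<Longrightarrow> unitary (A \<circ> B)"
  by (auto simp: unitary_def intro: Vector_Spaces.linear_compose)

lemma unitary_id: "unitary id"
  by (simp add: unitary_def linear_id)

text \<open>\<open>SOME\<close> picks the eigenvalue list of one diagonalization;
  \<open>angsum_eq\<close> shows that any other list gives the same sum.\<close>

definition angsum :: "('v \<Rightarrow> 'v) \<Rightarrow> real" where
  "angsum W = (\<Sum>j\<in>Idx. ang ((SOME z. \<exists>e. diag W e z) j))"

lemma angsum_eq:
  assumes "\<And>c. dim {x. W x = c *s x} = card {j\<in>Idx. z j = c}" "unitary W"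
  shows "angsum W = (\<Sum>j\<in>Idx. ang (z j))"
proof -
  obtain e z' where "diag W e z'" using unitary_diag[OF assms(2)] by blast
  then have "\<exists>e. diag W e (SOME z. \<exists>e. diag W e z)" using someI_ex[of "\<lambda>z. \<exists>e. diag W e z"] by blast
  then obtain e where "diag W e (SOME z. \<exists>e. diag W e z)" by blast
  from diag_eigenspace_dim[OF this] show ?thesis
    unfolding angsum_def by (intro equal_counts_sum) (auto simp: assms(1))
qed

lemma angsum_diag: "diag W e z \<Longrightarrow> unitary W \<Longrightarrow> angsum W = (\<Sum>j\<in>Idx. ang (z j))"
  by (rule angsum_eq) (rule diag_eigenspace_dim)

lemma onb_exists: "\<exists>e. onb e"
  using unitary_diag[OF unitary_id] by (auto simp: diag_def)

text \<open>This is the determinant of the matrix in a fixed orthonormal basis \<open>b\<close>. For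
  a diagonalized operator the matrix factors as \<open>P L Q\<close> with \<open>Q P\<close> the
  identity, so only the diagonal factor \<open>L\<close> contributes.\<close>

lemma eigenproduct_exists:
  "\<exists>X :: ('v \<Rightarrow> 'v) \<Rightarrow> complex. (\<forall>W e z. diag W e z \<longrightarrow> X W = (\<Prod>j\<in>Idx. z j)) \<and>
    (\<forall>A B. Vector_Spaces.linear scale scale A \<longrightarrow> X (A \<circ> B) = X A * X B)"
proof -
  obtain b where b: "onb b" using onb_exists by blast
  obtain D where D: "(\<forall>A B. D (\<lambda>i j. \<Sum>k\<in>Idx. A i k * B k j) = D A * D B) \<and>
    (\<forall>d. D (\<lambda>i j. if i = j then d i else 0) = (\<Prod>i\<in>Idx. d i)) \<and>
    (\<forall>A B :: nat \<Rightarrow> nat \<Rightarrow> complex. (\<forall>i\<in>Idx. \<forall>j\<in>Idx. A i j = B i j) \<longrightarrow> D A = (D B :: complex))"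
    using determinant_function_exists[of "dim (UNIV :: 'v set)", folded Idx_def] by (elim exE)
  note mult = D[THEN conjunct1, rule_format] and dg = D[THEN conjunct2, THEN conjunct1, rule_format]
  have cong: "D A = D B" if "\<And>i j. i \<in> Idx \<Longrightarrow> j \<in> Idx \<Longrightarrow> A i j = B i j" for A B
    using D[THEN conjunct2, THEN conjunct2, rule_format, of A B] that by simp
  define X where "X W = D (\<lambda>i j. ip (W (b j)) (b i))" for W
  have "X W = (\<Prod>j\<in>Idx. z j)" if W: "diag W e z" for W e z
  proof -
    have e: "onb e" using W by (simp add: diag_def)
    define P where "P i j = ip (e j) (b i)" for i j
    define Q where "Q i j = ip (b j) (e i)" for i j
    define L where "L i j = (if i = j then z i else 0)" for i j :: nat
    have "ip (W (b j)) (b i) = (\<Sum>k\<in>Idx. (\<Sum>l\<in>Idx. P i l * L l k) * Q k j)" if "i \<in> Idx" "j \<in> Idx" for i j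
    proof -
      have "(\<Sum>l\<in>Idx. P i l * L l k) = P i k * z k" if "k \<in> Idx" for k
      proof -
        have "(\<Sum>l\<in>Idx. P i l * L l k) = (\<Sum>l\<in>Idx. (P i l * z l) * (if l = k then 1 else 0))"
          by (rule sum.cong) (auto simp: L_def)
        then show ?thesis using sum_mult_delta[OF finite_Idx that, of "\<lambda>l. P i l * z l"] by simp
      qed
      then have "(\<Sum>k\<in>Idx. (\<Sum>l\<in>Idx. P i l * L l k) * Q k j) = (\<Sum>k\<in>Idx. P i k * z k * Q k j)"
        by simp
      also have "\<dots> = ip (W (b j)) (b i)"
        by (subst diag_apply[OF W]) (simp add: ip_sum ip_scale P_def Q_def mult_ac)
      finally show ?thesis by simp
    qed
    then have "X W = D (\<lambda>i j. \<Sum>k\<in>Idx. (\<Sum>l\<in>Idx. P i l * L l k) * Q k j)"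
      unfolding X_def by (rule cong)
    also have "\<dots> = D P * D L * D Q" by (simp add: mult)
    also have "D P * D L * D Q = D L * (D Q * D P)" by simp
    also have "D Q * D P = D (\<lambda>i j. \<Sum>k\<in>Idx. Q i k * P k j)" by (simp add: mult)
    also have "\<dots> = D (\<lambda>i j. if i = j then 1 else 0)"
    proof (rule cong)
      fix i j assume ij: "i \<in> Idx" "j \<in> Idx"
      have "(\<Sum>k\<in>Idx. Q i k * P k j) = ip (e j) (e i)"
        by (subst onb_parseval[OF b])
           (simp add: P_def Q_def mult.commute ip_cnj[of "b _" "e i"])
      then show "(\<Sum>k\<in>Idx. Q i k * P k j) = (if i = j then 1 else 0)"
        using e ij by (auto simp: onb_def)
    qed
    also have "\<dots> = 1" by (simp add: dg)
    finally show ?thesis using dg[of z] by (simp add: L_def[abs_def])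
  qed
  moreover have "X (A \<circ> B) = X A * X B" if A: "Vector_Spaces.linear scale scale A" for A B
  proof -
    interpret A: Vector_Spaces.linear scale scale A by (rule A)
    have "ip ((A \<circ> B) (b j)) (b i) = (\<Sum>k\<in>Idx. ip (A (b k)) (b i) * ip (B (b j)) (b k))" for i j
    proof -
      have "A (B (b j)) = A (\<Sum>k\<in>Idx. ip (B (b j)) (b k) *s b k)" using onb_expand[OF b] by simp
      then show ?thesis by (simp add: A.sum A.scale ip_sum ip_scale mult.commute)
    qed
    then show ?thesis unfolding X_def by (simp add: mult)
  qed
  ultimately show ?thesis by (intro exI[of _ X]) blast
qed

definition eigenproduct :: "('v \<Rightarrow> 'v) \<Rightarrow> complex" where
  "eigenproduct = (SOME X. (\<forall>W e z. diag W e z \<longrightarrow> X W = (\<Prod>j\<in>Idx. z j)) \<and>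
    (\<forall>A B. Vector_Spaces.linear scale scale A \<longrightarrow> X (A \<circ> B) = X A * X B))"

lemma eigenproduct_diag: "diag W e z \<Longrightarrow> eigenproduct W = (\<Prod>j\<in>Idx. z j)"
  and eigenproduct_comp:
    "Vector_Spaces.linear scale scale A \<Longrightarrow> eigenproduct (A \<circ> B) = eigenproduct A * eigenproduct B"
  using someI_ex[OF eigenproduct_exists] unfolding eigenproduct_def by blast+

text \<open>A multiplicative quantity determines the angle sum modulo integers; this is the source
  of all integrality below.\<close>

lemma eigenproduct_angsum:
  assumes "unitary W"
  shows "eigenproduct W = cis (2 * pi * angsum W)"
proof -
  obtain e z where d: "diag W e z" using unitary_diag[OF assms] by blast
  have "eigenproduct W = (\<Prod>j\<in>Idx. cis (2 * pi * ang (z j)))"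
    unfolding eigenproduct_diag[OF d] by (rule prod.cong) (auto simp: cis_ang unitary_diag_norm[OF assms d])
  also have "\<dots> = cis (\<Sum>j\<in>Idx. 2 * pi * ang (z j))" by (simp add: cis_conv_exp exp_sum sum_distrib_left)
  finally show ?thesis by (simp add: angsum_diag[OF d assms] sum_distrib_left)
qed

text \<open>For a unit vector \<open>v\<close>, the operator with eigenvalue \<open>z\<close> on
  \<open>v\<close> and \<open>1\<close> on the hyperplane orthogonal to \<open>v\<close>.\<close>

definition reflection :: "complex \<Rightarrow> 'v \<Rightarrow> 'v \<Rightarrow> 'v" where
  "reflection z v x = x + ((z - 1) * ip x v) *s v"

lemma reflection_diag:
  assumes "onb e" "k \<in> Idx"
  shows "diag (reflection z (e k)) e (\<lambda>j. if j = k then z else 1)"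
proof -
  have "Vector_Spaces.linear scale scale (reflection z (e k))"
    by unfold_locales (auto simp: reflection_def ip_add ip_scale algebra_simps)
  moreover have "reflection z (e k) (e j) = (if j = k then z else 1) *s e j" if "j \<in> Idx" for j
    using assms that by (auto simp: reflection_def onb_def scale_left_diff_distrib)
  ultimately show ?thesis using assms by (simp add: diag_def)
qed

text \<open>Interlacing yields \<open>angsum B \<le> angsum A + 1\<close>, determinants make
  \<open>n = angsum A + ang z - angsum B\<close> an integer, and \<open>0 < ang z\<close> gives
  \<open>n > -1\<close>, that is \<open>n \<ge> 0\<close>. A fixed vector of \<open>B\<close> off
  the hyperplane improves interlacing to \<open>angsum B \<le> angsum A\<close>, and then
  \<open>n > 0\<close>.\<close>

lemma angsum_reflection:
  assumes A: "unitary A" and e: "onb e" "k \<in> Idx" and z: "cmod z = 1" "z \<noteq> 1"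
  defines "B \<equiv> A \<circ> reflection z (e k)"
  shows "angsum B \<le> angsum A + ang z"
    and "B u = u \<Longrightarrow> ip u (e k) \<noteq> 0 \<Longrightarrow> angsum B + 1 \<le> angsum A + ang z"
proof -
  let ?R = "reflection z (e k)"
  have dR: "diag ?R e (\<lambda>j. if j = k then z else 1)" by (rule reflection_diag[OF e])
  have R: "unitary ?R" by (rule diag_unitary[OF dR]) (simp add: z)
  have B: "unitary B" unfolding B_def by (rule unitary_comp[OF A R])
  obtain f a where dA: "diag A f a" using unitary_diag[OF A] by blast
  obtain g b where dB: "diag B g b" using unitary_diag[OF B] by blast
  have AB: "B x = A x" if "ip x (e k) = 0" for x
    using that by (simp add: B_def reflection_def)
  have cA: "card {j\<in>Idx. 0 \<le> Re (cis (- (pi * x)) * a j) + - cos (pi * x)} = card {j\<in>Idx. ang (a j) \<le> x}"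
    if "0 \<le> x" "x < 1" for x
    using ang_le_iff[OF unitary_diag_norm[OF A dA] that] by (intro arg_cong[of _ _ card]) blast
  have cB: "card {j\<in>Idx. 0 \<le> Re (cis (- (pi * x)) * b j) + - cos (pi * x)} = card {j\<in>Idx. ang (b j) \<le> x}"
    if "0 \<le> x" "x < 1" for x
    using ang_le_iff[OF unitary_diag_norm[OF B dB] that] by (intro arg_cong[of _ _ card]) blast
  have le: "angsum B \<le> angsum A + real d"
    if "\<And>x. 0 \<le> x \<Longrightarrow> x < 1 \<Longrightarrow> card {j\<in>Idx. ang (a j) \<le> x} \<le> card {j\<in>Idx. ang (b j) \<le> x} + d" for d
    unfolding angsum_diag[OF dA A] angsum_diag[OF dB B]
    by (rule sum_le_of_counts[OF finite_Idx _ _ that]) (auto simp: ang_bounds)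
  have le1: "angsum B \<le> angsum A + 1"
  proof -
    have "angsum B \<le> angsum A + real 1"
    proof (rule le)
      fix x :: real assume x: "0 \<le> x" "x < 1"
      show "card {j\<in>Idx. ang (a j) \<le> x} \<le> card {j\<in>Idx. ang (b j) \<le> x} + 1"
        using rank_one_count(1)[OF dA dB B AB, where c = "cis (- (pi * x))" and ?c0.0 = "- cos (pi * x)"]
        by (simp only: cA[OF x] cB[OF x])
    qed
    then show ?thesis by simp
  qed
  have int: "\<exists>n::int. angsum A + ang z - angsum B = of_int n"
  proof -
    have "eigenproduct B = eigenproduct A * eigenproduct ?R"
      unfolding B_def by (rule eigenproduct_comp[OF unitary_linear[OF A]])
    also have "eigenproduct ?R = z"
    proof -
      have "eigenproduct ?R = (\<Prod>j\<in>Idx. if j = k then z else 1)" by (rule eigenproduct_diag[OF dR])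
      also have "\<dots> = z" using e by simp
      finally show ?thesis .
    qed
    also have "z = cis (2 * pi * ang z)" by (simp add: cis_ang z)
    finally have "cis (2 * pi * (angsum A + ang z - angsum B)) = 1"
      by (simp add: eigenproduct_angsum A B cis_mult right_diff_distrib distrib_left flip: cis_divide)
    then obtain n :: int where "2 * pi * (angsum A + ang z - angsum B) = 0 + 2 * pi * of_int n"
      using cis_eq_cis_imp[of _ 0] by (metis cis_zero)
    then show ?thesis by auto
  qed
  then obtain n :: int where n: "angsum A + ang z - angsum B = of_int n" by blast
  have az: "0 < ang z" "ang z < 1" using ang_bounds[of z] ang_eq_0_iff[OF z(1)] z(2) by auto
  have "of_int n > (-1::real)" using le1 n az by linarith
  then have "n \<ge> 0" by linarith
  then show "angsum B \<le> angsum A + ang z" using n by (simp add: algebra_simps)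
  assume u: "B u = u" "ip u (e k) \<noteq> 0"
  have "angsum B \<le> angsum A + real 0"
  proof (rule le)
    fix x :: real assume x: "0 \<le> x" "x < 1"
    have "card {j\<in>Idx. 0 \<le> Re (cis (- (pi * x)) * a j) + - cos (pi * x)} \<le>
        card {j\<in>Idx. 0 \<le> Re (cis (- (pi * x)) * b j) + - cos (pi * x)}"
      by (rule rank_one_count(2)[OF dA dB B AB u]) simp_all
    then show "card {j\<in>Idx. ang (a j) \<le> x} \<le> card {j\<in>Idx. ang (b j) \<le> x} + 0"
      by (simp only: cA[OF x] cB[OF x] add_0_right)
  qed
  then have "of_int n > (0::real)" using n az by simp
  then have "n \<ge> 1" by simp
  then have "1 \<le> angsum A + ang z - angsum B" unfolding n by simp
  then show "angsum B + 1 \<le> angsum A + ang z" by linarith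
qed

text \<open>The second factor is split into reflections along its eigenbasis.  A reflection that
  enlarges the subspace \<open>L\<close> of fixed vectors below has a fixed vector off its hyperplane.\<close>

lemma angsum_comp_le:
  assumes A: "unitary A" and C: "unitary C"
  shows "angsum (A \<circ> C) + real (dim {x. A (C x) = x})
    \<le> angsum A + angsum C + real (dim {x. A x = x \<and> C x = x})"
proof -
  let ?n = "dim (UNIV :: 'v set)"
  obtain e z where dC: "diag C e z" using unitary_diag[OF C] by blast
  then have e: "onb e" by (simp add: diag_def)
  have on: "ip (e i) (e j) = (if i = j then 1 else 0)" if "i \<in> Idx" "j \<in> Idx" for i j
    using e that by (simp add: onb_def)
  have z: "cmod (z j) = 1" if "j \<in> Idx" for j by (rule unitary_diag_norm[OF C dC that])
  interpret A: Vector_Spaces.linear scale scale A by (rule unitary_linear[OF A])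
  \<comment> \<open>The product of the first \<open>n\<close> reflections, written as a sum because
    it is then visibly linear and diagonal in \<open>e\<close>.\<close>
  define Cn where "Cn n x = x + (\<Sum>j=1..n. ((z j - 1) * ip x (e j)) *s e j)" for n x
  \<comment> \<open>The orthogonality condition concerns the factors not yet used. So
    \<open>L\<close> begins with the common fixed vectors of \<open>A\<close> and \<open>C\<close>,
    ends with the fixed vectors of \<open>A \<circ> C\<close>, and gains at most one dimension per
    reflection.\<close>
  define L where "L n = {x. A (Cn n x) = x \<and> (\<forall>j\<in>{Suc n..?n}. z j \<noteq> 1 \<longrightarrow> ip x (e j) = 0)}" for n
  have lin: "Vector_Spaces.linear scale scale (Cn n)" for n
    by unfold_locales
       (auto simp: Cn_def ip_add ip_scale sum.distrib sum_subtractf scale_sum_right algebra_simps)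
  have dCn: "diag (Cn n) e (\<lambda>j. if j \<le> n then z j else 1)" if "n \<le> ?n" for n
  proof -
    have "Cn n (e i) = (if i \<le> n then z i else 1) *s e i" if i: "i \<in> Idx" for i
    proof -
      have "(\<Sum>j=1..n. ((z j - 1) * ip (e i) (e j)) *s e j)
          = (\<Sum>j=1..n. if j = i then (z i - 1) *s e i else 0)"
        by (rule sum.cong) (use i \<open>n \<le> ?n\<close> on in \<open>auto simp: Idx_def\<close>)
      also have "\<dots> = (if i \<le> n then (z i - 1) *s e i else 0)"
        using i by (simp add: Idx_def)
      finally show ?thesis by (simp add: Cn_def scale_left_diff_distrib)
    qed
    then show ?thesis using lin e by (simp add: diag_def)
  qed
  have U: "unitary (Cn n)" if "n \<le> ?n" for n
    by (rule diag_unitary[OF dCn[OF that]]) (simp add: z)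
  have sL: "subspace (L n)" for n
  proof -
    interpret Cn: Vector_Spaces.linear scale scale "Cn n" by (rule lin)
    show ?thesis
      by (auto simp: L_def subspace_def Cn.add Cn.scale Cn.zero A.add A.scale A.zero ip_add ip_scale)
  qed
  have main: "angsum (A \<circ> Cn n) + real (dim (L n)) \<le> angsum A + (\<Sum>j=1..n. ang (z j)) + real (dim (L 0))"
    if "n \<le> ?n" for n
    using that
  proof (induction n)
    case 0
    have "A \<circ> Cn 0 = A" by (auto simp: Cn_def)
    then show ?case by simp
  next
    case (Suc n)
    let ?k = "Suc n"
    have k: "?k \<in> Idx" using Suc.prems by (auto simp: Idx_def)
    have IH: "angsum (A \<circ> Cn n) + real (dim (L n)) \<le> angsum A + (\<Sum>j=1..n. ang (z j)) + real (dim (L 0))"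
      by (rule Suc.IH) (use Suc.prems in simp)
    have S: "(\<Sum>j=1..?k. ang (z j)) = (\<Sum>j=1..n. ang (z j)) + ang (z ?k)" by simp
    have U': "unitary (A \<circ> Cn n)" using Suc.prems by (intro unitary_comp A U) simp
    have insS: "{?k..?n} = insert ?k {Suc ?k..?n}" using Suc.prems by auto
    show ?case
    proof (cases "z ?k = 1")
      case True
      then have "Cn ?k = Cn n" by (auto simp: Cn_def)
      moreover have "L ?k = L n" unfolding L_def insS using True \<open>Cn ?k = Cn n\<close> by auto
      moreover have "ang (z ?k) = 0" using True ang_eq_0_iff[of 1] by simp
      ultimately show ?thesis using IH unfolding S by (simp only: add_0_right)
    next
      case False
      have Cs: "Cn ?k = Cn n \<circ> reflection (z ?k) (e ?k)"
      proof
        fix x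
        have "(\<Sum>j=1..n. ((z j - 1) * ip (reflection (z ?k) (e ?k) x) (e j)) *s e j)
          = (\<Sum>j=1..n. ((z j - 1) * ip x (e j)) *s e j)"
        proof (rule sum.cong)
          fix j assume "j \<in> {1..n}"
          then have "j \<in> Idx" "j \<noteq> ?k" using Suc.prems by (auto simp: Idx_def)
          then have "ip (e ?k) (e j) = 0" using on[OF k] by simp
          then show "((z j - 1) * ip (reflection (z ?k) (e ?k) x) (e j)) *s e j = ((z j - 1) * ip x (e j)) *s e j"
            by (simp add: reflection_def ip_add ip_scale)
        qed simp
        then show "Cn ?k x = (Cn n \<circ> reflection (z ?k) (e ?k)) x"
          by (simp add: Cn_def reflection_def)
      qed
      have AC: "A \<circ> Cn ?k = (A \<circ> Cn n) \<circ> reflection (z ?k) (e ?k)" by (simp add: Cs o_assoc)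
      have Ln: "L n = {x \<in> L ?k. ip x (e ?k) = 0}"
      proof -
        have "Cn ?k x = Cn n x" if "ip x (e ?k) = 0" for x
          using that by (simp add: Cs reflection_def)
        then show ?thesis unfolding L_def insS using False by auto
      qed
      note refl = angsum_reflection[OF U' e k z[OF k] False]
      show ?thesis
      proof (cases "L ?k \<subseteq> L n")
        case True
        then have "dim (L ?k) \<le> dim (L n)" by (rule dim_subset)
        then show ?thesis using refl(1) IH unfolding AC S by linarith
      next
        case nsub: False
        then obtain u where u: "u \<in> L ?k" "ip u (e ?k) \<noteq> 0" unfolding Ln by blast
        have "dim (L ?k) \<le> dim (L n) + 1" unfolding Ln by (rule dim_hyperplane[OF sL])
        moreover have "angsum (A \<circ> Cn ?k) + 1 \<le> angsum (A \<circ> Cn n) + ang (z ?k)"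
          unfolding AC by (rule refl(2)[of u]) (use u in \<open>auto simp: L_def Cs\<close>)
        ultimately show ?thesis using IH unfolding S by linarith
      qed
    qed
  qed
  have CN: "Cn ?n = C"
  proof
    fix x
    show "Cn ?n x = C x"
      using diag_apply[OF dCn[of ?n], of x] diag_apply[OF dC, of x] by (simp add: Idx_def)
  qed
  have L0: "L 0 = {x. A x = x \<and> C x = x}"
  proof -
    have "(\<forall>j\<in>Idx. z j \<noteq> 1 \<longrightarrow> ip x (e j) = 0) \<longleftrightarrow> C x = x" for x
    proof
      assume *: "\<forall>j\<in>Idx. z j \<noteq> 1 \<longrightarrow> ip x (e j) = 0"
      have "C x = (\<Sum>j\<in>Idx. (z j * ip x (e j)) *s e j)" by (rule diag_apply[OF dC])
      also have "\<dots> = (\<Sum>j\<in>Idx. ip x (e j) *s e j)" by (rule sum.cong) (use * in auto)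
      finally show "C x = x" using onb_expand[OF e, of x] by simp
    next
      assume *: "C x = x"
      have "z j * ip x (e j) = ip x (e j)" if "j \<in> Idx" for j
        using diag_apply[OF dC, of x] onb_coord[OF e that] * by metis
      then show "\<forall>j\<in>Idx. z j \<noteq> 1 \<longrightarrow> ip x (e j) = 0" by fastforce
    qed
    then show ?thesis by (auto simp: L_def Cn_def Idx_def)
  qed
  have LN: "L ?n = {x. A (C x) = x}" unfolding L_def CN by auto
  have aC: "(\<Sum>j=1..?n. ang (z j)) = angsum C" using angsum_diag[OF dC C] by (simp add: Idx_def)
  show ?thesis using main[OF order_refl] unfolding CN L0 LN aC .
qed

end

section \<open>Continuous eigenangles\<close>

lemma cos_less_cos_iff:
  assumes "0 \<le> h" "h \<le> pi" "- h \<le> y" "y \<le> 2 * pi - h"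
  shows "cos h < cos y \<longleftrightarrow> - h < y \<and> y < h"
proof (cases "y \<le> pi")
  case True
  have "cos h < cos \<bar>y\<bar> \<longleftrightarrow> \<bar>y\<bar> < h"
    by (rule cos_mono_less_eq) (use assms True in auto)
  then show ?thesis by (simp add: abs_less_iff) linarith
next
  case False
  have "cos (2 * pi - y) \<le> cos h" by (rule cos_monotone_0_pi_le) (use assms False in auto)
  then show ?thesis using False assms by (auto simp: cos_2pi_minus)
qed

lemma card_permutes:
  assumes "p permutes I"
  shows "card {j\<in>I. P (p j)} = card {j\<in>I. P j}"
proof -
  have "{j\<in>I. P j} = p ` {j\<in>I. P (p j)}"
    using permutes_in_image[OF assms] permutes_surj[OF assms] by (auto simp: image_iff) (metis surjD)
  moreover have "inj_on p {j\<in>I. P (p j)}" using permutes_inj[OF assms] by (rule inj_on_subset) simp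
  ultimately show ?thesis by (simp add: card_image)
qed

lemma sorted_enumeration:
  fixes r :: "nat \<Rightarrow> 'a::linorder"
  obtains t where "\<And>i j. 1 \<le> i \<Longrightarrow> i \<le> j \<Longrightarrow> j \<le> n \<Longrightarrow> t i \<le> t j"
    and "\<And>P. card {j\<in>{1..n}. P (t j)} = card {j\<in>{1..n}. P (r j)}"
proof -
  define l where "l = sort (map (\<lambda>j. r (Suc j)) [0..<n])"
  have len: "length l = n" by (simp add: l_def)
  have shift: "card {j\<in>{1..n}. P (f (j - 1))} = card {j. j < n \<and> P (f j)}" for P and f :: "nat \<Rightarrow> 'a"
    by (rule bij_betw_same_card[of "\<lambda>j. j - 1"], rule bij_betwI[of _ _ _ Suc]) auto
  have "card {j\<in>{1..n}. P (l ! (j - 1))} = card {j\<in>{1..n}. P (r j)}" for P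
  proof -
    have "card {j\<in>{1..n}. P (l ! (j - 1))} = length (filter P l)"
      unfolding shift by (simp add: length_filter_conv_card len)
    also have "\<dots> = size (filter_mset P (mset l))" by (metis mset_filter size_mset)
    also have "mset l = mset (map (\<lambda>j. r (Suc j)) [0..<n])" by (simp add: l_def)
    also have "size (filter_mset P (mset (map (\<lambda>j. r (Suc j)) [0..<n]))) = length (filter P (map (\<lambda>j. r (Suc j)) [0..<n]))"
      by (metis mset_filter size_mset)
    also have "\<dots> = card {j. j < n \<and> P (r (Suc j))}" by (simp add: length_filter_conv_card cong: conj_cong)
    also have "\<dots> = card {j\<in>{1..n}. P (r (Suc (j - 1)))}" by (rule shift[symmetric])
    also have "{j\<in>{1..n}. P (r (Suc (j - 1)))} = {j\<in>{1..n}. P (r j)}" by auto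
    finally show ?thesis .
  qed
  moreover have "l ! (i - 1) \<le> l ! (j - 1)" if "1 \<le> i" "i \<le> j" "j \<le> n" for i j
    using that by (intro sorted_nth_mono) (auto simp: l_def)
  ultimately show thesis using that[of "\<lambda>j. l ! (j - 1)"] by blast
qed

text \<open>Expresses one sorted entry through counts over the whole family; lower semicontinuity of
  the counts on both sides of \<open>x\<close> then becomes continuity of the \<open>k\<close>-th
  entry.\<close>

lemma sorted_less_iff:
  fixes t :: "nat \<Rightarrow> 'a::linorder"
  assumes t: "\<And>i j. 1 \<le> i \<Longrightarrow> i \<le> j \<Longrightarrow> j \<le> n \<Longrightarrow> t i \<le> t j" and k: "k \<in> {1..n}"
  shows "t k < x \<longleftrightarrow> k \<le> card {j\<in>{1..n}. t j < x}"
    and "x < t k \<longleftrightarrow> n + 1 - k \<le> card {j\<in>{1..n}. x < t j}"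
proof -
  show "t k < x \<longleftrightarrow> k \<le> card {j\<in>{1..n}. t j < x}"
  proof
    assume "t k < x"
    then have "t j < x" if "1 \<le> j" "j \<le> k" for j using t[of j k] that k by auto
    then have "{1..k} \<subseteq> {j\<in>{1..n}. t j < x}" using k by auto
    from card_mono[OF _ this] show "k \<le> card {j\<in>{1..n}. t j < x}" by simp
  next
    assume *: "k \<le> card {j\<in>{1..n}. t j < x}"
    show "t k < x"
    proof (rule ccontr)
      assume n: "\<not> t k < x"
      have "{j\<in>{1..n}. t j < x} \<subseteq> {1..<k}"
      proof
        fix j assume j: "j \<in> {j\<in>{1..n}. t j < x}"
        then have "\<not> k \<le> j" using t[of k j] k n by auto
        then show "j \<in> {1..<k}" using j by auto
      qed
      from card_mono[OF _ this] have "card {j\<in>{1..n}. t j < x} \<le> k - 1" by simp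
      then show False using * k unfolding atLeastAtMost_iff by arith
    qed
  qed
  show "x < t k \<longleftrightarrow> n + 1 - k \<le> card {j\<in>{1..n}. x < t j}"
  proof
    assume "x < t k"
    then have "x < t j" if "k \<le> j" "j \<le> n" for j using t[of k j] that k by auto
    then have "{k..n} \<subseteq> {j\<in>{1..n}. x < t j}" using k by auto
    from card_mono[OF _ this] show "n + 1 - k \<le> card {j\<in>{1..n}. x < t j}" by simp
  next
    assume *: "n + 1 - k \<le> card {j\<in>{1..n}. x < t j}"
    show "x < t k"
    proof (rule ccontr)
      assume n: "\<not> x < t k"
      have "{j\<in>{1..n}. x < t j} \<subseteq> {k<..n}"
      proof
        fix j assume j: "j \<in> {j\<in>{1..n}. x < t j}"
        then have "\<not> j \<le> k" using t[of j k] k n by auto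
        then show "j \<in> {k<..n}" using j by auto
      qed
      from card_mono[OF _ this] have "card {j\<in>{1..n}. x < t j} \<le> n - k" by simp
      then show False using * k unfolding atLeastAtMost_iff by arith
    qed
  qed
qed

section \<open>Continuous eigenvalues along a path of unitaries\<close>

context hermitian_space
begin

lemma coord_le:
  assumes "onb e" "j \<in> Idx"
  shows "(cmod (ip x (e j)))\<^sup>2 \<le> Re (ip x x)"
proof -
  have "ip x x = (\<Sum>j\<in>Idx. complex_of_real ((cmod (ip x (e j)))\<^sup>2))"
    by (subst onb_parseval[OF assms(1)]) (simp add: complex_norm_square del: of_real_power)
  then have "Re (ip x x) = (\<Sum>j\<in>Idx. (cmod (ip x (e j)))\<^sup>2)" by (simp del: of_real_power)
  then show ?thesis using member_le_sum[OF assms(2), of "\<lambda>j. (cmod (ip x (e j)))\<^sup>2"] by simp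
qed

lemma sesquilinear_bound:
  assumes e: "onb e"
    and B: "\<And>x y z. B (x + y) z = B x z + B y z" "\<And>c x z. B (c *s x) z = c * B x z"
      "\<And>x y z. B z (x + y) = B z x + B z y" "\<And>c x z. B z (c *s x) = cnj c * B z x"
  shows "cmod (B x x) \<le> (\<Sum>i\<in>Idx. \<Sum>j\<in>Idx. cmod (B (e i) (e j))) * Re (ip x x)"
proof -
  have B0: "B 0 z = 0" "B z 0 = 0" for z using B(2)[of 0 0 z] B(4)[of z 0 0] by simp_all
  have Bs: "B (sum f A) z = (\<Sum>i\<in>A. B (f i) z)" "B z (sum f A) = (\<Sum>i\<in>A. B z (f i))"
    for f z and A :: "nat set"
    by (induction A rule: infinite_finite_induct; simp add: B B0)+
  let ?X = "\<Sum>j\<in>Idx. ip x (e j) *s e j"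
  have "B x x = B ?X ?X" using onb_expand[OF e, of x] by simp
  also have "\<dots> = (\<Sum>i\<in>Idx. \<Sum>j\<in>Idx. ip x (e i) * cnj (ip x (e j)) * B (e i) (e j))"
    by (simp only: Bs(1), simp only: Bs(2), simp add: B mult_ac)
  finally have "cmod (B x x) \<le> (\<Sum>i\<in>Idx. \<Sum>j\<in>Idx. cmod (ip x (e i) * cnj (ip x (e j)) * B (e i) (e j)))"
    by (simp only:) (intro order.trans[OF norm_sum] sum_mono norm_sum)
  also have "\<dots> \<le> (\<Sum>i\<in>Idx. \<Sum>j\<in>Idx. cmod (B (e i) (e j)) * Re (ip x x))"
  proof (intro sum_mono)
    fix i j assume ij: "i \<in> Idx" "j \<in> Idx"
    have "cmod (ip x (e i)) * cmod (ip x (e j)) \<le> sqrt (Re (ip x x)) * sqrt (Re (ip x x))"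
      using coord_le[OF e ij(1)] coord_le[OF e ij(2)] by (intro mult_mono real_le_rsqrt) auto
    then have "cmod (ip x (e i)) * cmod (ip x (e j)) \<le> Re (ip x x)" by simp
    from mult_left_mono[OF this, of "cmod (B (e i) (e j))"]
    show "cmod (ip x (e i) * cnj (ip x (e j)) * B (e i) (e j)) \<le> cmod (B (e i) (e j)) * Re (ip x x)"
      by (simp add: norm_mult mult_ac)
  qed
  finally show ?thesis by (simp add: sum_distrib_right)
qed

definition unitary_path :: "real set \<Rightarrow> (real \<Rightarrow> 'v \<Rightarrow> 'v) \<Rightarrow> bool" where
  "unitary_path S W \<longleftrightarrow> (\<forall>s\<in>S. unitary (W s)) \<and> (\<forall>x y. continuous_on S (\<lambda>s. ip (W s x) y))"

lemma unitary_path_subset: "unitary_path S W \<Longrightarrow> T \<subseteq> S \<Longrightarrow> unitary_path T W"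
  unfolding unitary_path_def by (blast intro: continuous_on_subset)

text \<open>On the span \<open>F\<close> of the eigenvectors counted at \<open>s0\<close> the form
  is at least \<open>\<mu>\<close> times the squared norm. Passing to \<open>W s\<close> changes it
  by at most \<open>cmod c * \<delta> s\<close> times the squared norm, and
  \<open>\<delta> s\<close> tends to \<open>0\<close>, so the form stays positive definite on
  \<open>F\<close>.\<close>

lemma count_lower_semicontinuous:
  assumes W: "unitary_path S W" and s0: "s0 \<in> S" and d: "diag (W s0) e z"
  shows "\<forall>\<^sub>F s in at s0 within S. \<forall>f w. diag (W s) f w \<longrightarrow>
    card {j\<in>Idx. 0 < Re (c * z j) + c0} \<le> card {j\<in>Idx. 0 < Re (c * w j) + c0}"
proof -
  have e: "onb e" using d by (simp add: diag_def)
  define I where "I = {j\<in>Idx. 0 < Re (c * z j) + c0}"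
  define F where "F = span (e ` I)"
  have dF: "dim F = card I" unfolding F_def by (rule onb_dim_span[OF e]) (auto simp: I_def)
  \<comment> \<open>Inserting \<open>1\<close> keeps the minimum defined and positive when
    \<open>I\<close> is empty.\<close>
  define \<mu> where "\<mu> = Min (insert 1 ((\<lambda>j. Re (c * z j) + c0) ` I))"
  have fI: "finite I" by (simp add: I_def)
  have mu: "\<mu> > 0" "\<And>j. j \<in> I \<Longrightarrow> \<mu> \<le> Re (c * z j) + c0"
    using fI by (auto simp: \<mu>_def I_def)
  have Q0: "\<mu> * Re (ip x x) \<le> Re (c * ip (W s0 x) x) + c0 * Re (ip x x)" if "x \<in> F" for x
  proof -
    have x: "ip x (e j) = 0" if "j \<in> Idx - I" for j
      using \<open>x \<in> F\<close> onb_in_span_iff[OF e, of I] that by (auto simp: F_def I_def)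
    have "\<mu> * Re (ip x x) = (\<Sum>j\<in>Idx. \<mu> * (cmod (ip x (e j)))\<^sup>2)"
      using diag_quadratic[OF d, of 0 x \<mu>] by simp
    also have "\<dots> \<le> (\<Sum>j\<in>Idx. (Re (c * z j) + c0) * (cmod (ip x (e j)))\<^sup>2)"
    proof (rule sum_mono)
      fix j assume "j \<in> Idx"
      then show "\<mu> * (cmod (ip x (e j)))\<^sup>2 \<le> (Re (c * z j) + c0) * (cmod (ip x (e j)))\<^sup>2"
        using x[of j] mu(2)[of j] by (cases "j \<in> I") (auto intro: mult_right_mono)
    qed
    finally show ?thesis using diag_quadratic[OF d] by simp
  qed
  define \<delta> where "\<delta> s = (\<Sum>i\<in>Idx. \<Sum>j\<in>Idx. cmod (ip (W s (e i)) (e j) - ip (W s0 (e i)) (e j)))" for s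
  have ct: "((\<lambda>s. ip (W s x) y) \<longlongrightarrow> ip (W s0 x) y) (at s0 within S)" for x y
    using W s0 by (simp add: unitary_path_def continuous_on_def)
  have "((\<lambda>s. cmod c * \<delta> s) \<longlongrightarrow> cmod c * (\<Sum>i\<in>Idx. \<Sum>j\<in>Idx. cmod (ip (W s0 (e i)) (e j) - ip (W s0 (e i)) (e j)))) (at s0 within S)"
    unfolding \<delta>_def by (intro tendsto_intros ct)
  then have "((\<lambda>s. cmod c * \<delta> s) \<longlongrightarrow> 0) (at s0 within S)" by simp
  then have ev: "\<forall>\<^sub>F s in at s0 within S. cmod c * \<delta> s < \<mu>" by (rule order_tendstoD) (rule mu(1))
  have evS: "\<forall>\<^sub>F s in at s0 within S. s \<in> S" by (simp add: eventually_at_filter)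
  show ?thesis
    using ev evS
  proof eventually_elim
    case (elim s)
    have lin: "Vector_Spaces.linear scale scale (W s)" "Vector_Spaces.linear scale scale (W s0)"
      using W s0 elim by (auto simp: unitary_path_def unitary_def)
    interpret Ws: Vector_Spaces.linear scale scale "W s" by (rule lin)
    interpret W0: Vector_Spaces.linear scale scale "W s0" by (rule lin)
    have pos: "0 < Re (c * ip (W s x) x) + c0 * Re (ip x x)" if x: "x \<in> F" "x \<noteq> 0" for x
    proof -
      have "cmod (ip (W s x) x - ip (W s0 x) x) \<le> \<delta> s * Re (ip x x)"
        unfolding \<delta>_def
        by (rule sesquilinear_bound[OF e, of "\<lambda>x y. ip (W s x) y - ip (W s0 x) y"])
           (auto simp: Ws.add W0.add Ws.scale W0.scale ip_add ip_scale ip_add_right ip_scale_right algebra_simps)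
      then have "cmod (c * (ip (W s x) x - ip (W s0 x) x)) \<le> (cmod c * \<delta> s) * Re (ip x x)"
        using mult_left_mono[of _ _ "cmod c"] by (simp add: norm_mult mult.assoc)
      also have "\<dots> < \<mu> * Re (ip x x)" using elim(1) ip_pos[OF x(2)] by simp
      finally have "\<bar>Re (c * (ip (W s x) x - ip (W s0 x) x))\<bar> < \<mu> * Re (ip x x)"
        using abs_Re_le_cmod le_less_trans by blast
      moreover have "Re (c * (ip (W s x) x - ip (W s0 x) x)) = Re (c * ip (W s x) x) - Re (c * ip (W s0 x) x)"
        by (simp only: right_diff_distrib minus_complex.sel)
      ultimately show ?thesis using Q0[OF x(1)] by linarith
    qed
    show ?case
    proof (intro allI impI)
      fix f w assume "diag (W s) f w"
      from count_pos[OF this _ pos, of F] show "card {j\<in>Idx. 0 < Re (c * z j) + c0} \<le> card {j\<in>Idx. 0 < Re (c * w j) + c0}"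
        unfolding dF I_def by (simp add: F_def del: times_complex.sel)
    qed
  qed
qed

text \<open>The counterpart of \<open>eigenangles\<close> for operators acting on the whole space
  instead of \<open>Xplus J\<close>.\<close>

definition lifts :: "real \<Rightarrow> real \<Rightarrow> (real \<Rightarrow> 'v \<Rightarrow> 'v) \<Rightarrow> (nat \<Rightarrow> real \<Rightarrow> real) \<Rightarrow> bool" where
  "lifts a b W \<theta> \<longleftrightarrow> (\<forall>j\<in>Idx. continuous_on {a..b} (\<theta> j)) \<and>
    (\<forall>s\<in>{a..b}. \<forall>z. dim {x. W s x = z *s x} = card {j\<in>Idx. cis (\<theta> j s) = z})"

text \<open>At \<open>b\<close> both families list the same eigenvalues, so they differ there by a
  permutation and multiples of \<open>2 * pi\<close>; the second family is corrected by
  both.\<close>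

lemma lifts_glue:
  assumes th: "lifts a b W \<theta>" "lifts b c W \<theta>'" and "a \<le> b" "b \<le> c"
  shows "\<exists>\<phi>. lifts a c W \<phi>"
proof -
  have "card {j\<in>Idx. cis (\<theta> j b) = z} = card {j\<in>Idx. cis (\<theta>' j b) = z}" for z
  proof -
    have "dim {x. W b x = z *s x} = card {j\<in>Idx. cis (\<theta> j b) = z}"
      using th(1) \<open>a \<le> b\<close> by (simp add: lifts_def)
    moreover have "dim {x. W b x = z *s x} = card {j\<in>Idx. cis (\<theta>' j b) = z}"
      using th(2) \<open>b \<le> c\<close> by (simp add: lifts_def)
    ultimately show ?thesis by simp
  qed
  then obtain p where p: "p permutes Idx" "\<forall>j\<in>Idx. cis (\<theta> j b) = cis (\<theta>' (p j) b)"
    by (rule equal_counts_permutation[OF finite_Idx, of "\<lambda>j. cis (\<theta> j b)" "\<lambda>j. cis (\<theta>' j b)"])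
  have "\<forall>j\<in>Idx. \<exists>n::int. \<theta> j b = \<theta>' (p j) b + 2 * pi * of_int n"
    using p(2) cis_eq_cis_imp by blast
  then obtain n :: "nat \<Rightarrow> int" where n: "\<And>j. j \<in> Idx \<Longrightarrow> \<theta> j b = \<theta>' (p j) b + 2 * pi * of_int (n j)"
    by metis
  define \<phi> where "\<phi> j s = (if s \<le> b then \<theta> j s else \<theta>' (p j) s + 2 * pi * of_int (n j))" for j s
  have pI: "p j \<in> Idx" if "j \<in> Idx" for j using permutes_in_image[OF p(1)] that by simp
  have "continuous_on {a..c} (\<phi> j)" if j: "j \<in> Idx" for j
  proof -
    have eq: "{a..c} = {a..b} \<union> {b..c}" using assms(3,4) by auto
    have "continuous_on ({a..b} \<union> {b..c}) (\<lambda>s. if s \<le> b then \<theta> j s else \<theta>' (p j) s + 2 * pi * of_int (n j))"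
      by (rule continuous_on_cases)
         (use th j pI[OF j] n[OF j] in \<open>auto simp: lifts_def intro!: continuous_intros\<close>)
    then show ?thesis by (simp add: eq \<phi>_def[abs_def])
  qed
  moreover have "dim {x. W s x = z *s x} = card {j\<in>Idx. cis (\<phi> j s) = z}" if s: "s \<in> {a..c}" for s z
  proof (cases "s \<le> b")
    case True
    then show ?thesis using th(1) s by (simp add: \<phi>_def lifts_def)
  next
    case False
    then have "card {j\<in>Idx. cis (\<phi> j s) = z} = card {j\<in>Idx. cis (\<theta>' (p j) s) = z}"
      by (simp add: \<phi>_def cis_multiple_2pi flip: cis_mult)
    also have "\<dots> = card {j\<in>Idx. cis (\<theta>' j s) = z}" by (rule card_permutes[OF p(1)])
    finally show ?thesis using th(2) s False by (simp add: lifts_def)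
  qed
  ultimately show ?thesis unfolding lifts_def by blast
qed

text \<open>As \<open>cis \<alpha>\<close> is never an eigenvalue, all arguments can be taken
  strictly between \<open>\<alpha>\<close> and \<open>\<alpha> + 2 * pi\<close> and sorted.
  Arguments below \<open>x\<close> correspond to an open arc, and so do those above
  \<open>x\<close>; both counts are lower semicontinuous, hence each sorted argument is
  continuous.\<close>

lemma lifts_local:
  assumes W: "unitary_path {a..b} W" and cut: "\<And>s x. s \<in> {a..b} \<Longrightarrow> W s x = cis \<alpha> *s x \<Longrightarrow> x = 0"
  shows "\<exists>\<theta>. lifts a b W \<theta>"
proof -
  have U: "unitary (W s)" if "s \<in> {a..b}" for s using W that by (simp add: unitary_path_def)
  have "\<forall>s\<in>{a..b}. \<exists>z. \<exists>e. diag (W s) e z" using U unitary_diag by blast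
  then obtain w where w: "\<And>s. s \<in> {a..b} \<Longrightarrow> \<exists>e. diag (W s) e (w s)" by metis
  have wu: "cmod (w s j) = 1" if "s \<in> {a..b}" "j \<in> Idx" for s j
    using w[OF that(1)] unitary_diag_norm[OF U[OF that(1)] _ that(2)] by blast
  define A where "A z = \<alpha> + 2 * pi * ang (cis (- \<alpha>) * z)" for z
  have cisA: "cis (A z) = z" if "cmod z = 1" for z
  proof -
    have "cis (A z) = cis \<alpha> * cis (2 * pi * ang (cis (- \<alpha>) * z))" by (simp add: A_def cis_mult)
    also have "\<dots> = cis \<alpha> * (cis (- \<alpha>) * z)" using that by (simp add: cis_ang norm_mult)
    also have "\<dots> = z" by (simp add: cis_mult flip: mult.assoc)
    finally show ?thesis .
  qed
  have A: "\<alpha> < A (w s j)" "A (w s j) < \<alpha> + 2 * pi" if s: "s \<in> {a..b}" and j: "j \<in> Idx" for s j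
  proof -
    show "A (w s j) < \<alpha> + 2 * pi" using ang_bounds(2) by (simp add: A_def)
    have "w s j \<noteq> cis \<alpha>"
    proof
      assume *: "w s j = cis \<alpha>"
      obtain e where d: "diag (W s) e (w s)" using w[OF s] by blast
      have "e j = 0" by (rule cut[OF s]) (use d j * in \<open>simp add: diag_def\<close>)
      moreover have "ip (e j) (e j) = 1" using d j by (simp add: diag_def onb_def)
      ultimately show False by simp
    qed
    then have "cis (- \<alpha>) * w s j \<noteq> 1"
      using cisA[OF wu[OF s j]] by (auto simp: A_def ang_def Arg2pi_of_real[of 1, simplified])
    then have "ang (cis (- \<alpha>) * w s j) \<noteq> 0"
      using ang_eq_0_iff[of "cis (- \<alpha>) * w s j"] wu[OF s j] by (simp add: norm_mult)
    then show "\<alpha> < A (w s j)" using ang_bounds(1)[of "cis (- \<alpha>) * w s j"] by (simp add: A_def)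
  qed
  define n where "n = dim (UNIV :: 'v set)"
  have "\<exists>t. (\<forall>i j. 1 \<le> i \<longrightarrow> i \<le> j \<longrightarrow> j \<le> n \<longrightarrow> t i \<le> t j) \<and>
     (\<forall>P. card {j\<in>{1..n}. P (t j)} = card {j\<in>{1..n}. P (A (w s j))})" for s
    by (rule sorted_enumeration[of n "\<lambda>j. A (w s j)"]) blast
  then obtain t where mono: "\<And>s i j. 1 \<le> i \<Longrightarrow> i \<le> j \<Longrightarrow> j \<le> n \<Longrightarrow> t s i \<le> t s j"
    and tc: "\<And>s P. card {j\<in>Idx. P (t s j)} = card {j\<in>Idx. P (A (w s j))}"
    unfolding Idx_def n_def by metis
  have less1: "t s k < x \<longleftrightarrow> k \<le> card {j\<in>Idx. A (w s j) < x}"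
    and less2: "x < t s k \<longleftrightarrow> n + 1 - k \<le> card {j\<in>Idx. x < A (w s j)}" if "k \<in> Idx" for s k x
    using sorted_less_iff[of n "t s" k x, OF mono] that tc[of "\<lambda>y. y < x" s] tc[of "\<lambda>y. x < y" s]
    by (simp_all add: Idx_def n_def)
  have tb: "\<alpha> < t s k" "t s k < \<alpha> + 2 * pi" if "s \<in> {a..b}" "k \<in> Idx" for s k
  proof -
    have S: "{j\<in>Idx. A (w s j) < \<alpha> + 2 * pi} = Idx" "{j\<in>Idx. \<alpha> < A (w s j)} = Idx"
      using A[OF that(1)] by auto
    show "\<alpha> < t s k" "t s k < \<alpha> + 2 * pi"
      unfolding less1[OF that(2)] less2[OF that(2)] S card_Idx using that(2) by (auto simp: Idx_def n_def)
  qed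
  \<comment> \<open>The open arc from \<open>\<alpha>\<close> to \<open>x\<close> has its midpoint
    at \<open>(\<alpha> + x) / 2\<close> and half-width \<open>(x - \<alpha>) / 2\<close>;
    \<open>arc2\<close> treats the complementary arc from \<open>x\<close> to
    \<open>\<alpha> + 2 * pi\<close>.\<close>
  have arc1: "A (w s j) < x \<longleftrightarrow> 0 < Re (cis (- ((\<alpha> + x) / 2)) * w s j) + - cos ((x - \<alpha>) / 2)"
    if s: "s \<in> {a..b}" "j \<in> Idx" and x: "\<alpha> < x" "x < \<alpha> + 2 * pi" for s j x
  proof -
    let ?h = "(x - \<alpha>) / 2" and ?y = "A (w s j) - (\<alpha> + x) / 2"
    have "cis (- ((\<alpha> + x) / 2)) * w s j = cis ?y"
      using cisA[OF wu[OF s]] by (metis cis_mult add.commute uminus_add_conv_diff)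
    moreover have "cos ?h < cos ?y \<longleftrightarrow> - ?h < ?y \<and> ?y < ?h"
      by (rule cos_less_cos_iff) (use A[OF s] x in \<open>auto simp: field_simps\<close>)
    moreover have "- ?h < ?y \<and> ?y < ?h \<longleftrightarrow> A (w s j) < x"
      using A[OF s] by (auto simp: field_simps)
    ultimately show ?thesis by simp
  qed
  have arc2: "x < A (w s j) \<longleftrightarrow>
      0 < Re (cis (- ((\<alpha> + 2 * pi + x) / 2)) * w s j) + - cos ((\<alpha> + 2 * pi - x) / 2)"
    if s: "s \<in> {a..b}" "j \<in> Idx" and x: "\<alpha> < x" "x < \<alpha> + 2 * pi" for s j x
  proof -
    let ?h = "(\<alpha> + 2 * pi - x) / 2" and ?y = "(\<alpha> + 2 * pi + x) / 2 - A (w s j)"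
    have "cis (- ((\<alpha> + 2 * pi + x) / 2)) * w s j = cis (- ?y)"
      using cisA[OF wu[OF s]] by (metis cis_mult add.commute uminus_add_conv_diff minus_diff_eq)
    then have "Re (cis (- ((\<alpha> + 2 * pi + x) / 2)) * w s j) = cos ?y" by (simp only: cis.sel cos_minus)
    moreover have "cos ?h < cos ?y \<longleftrightarrow> - ?h < ?y \<and> ?y < ?h"
      by (rule cos_less_cos_iff) (use A[OF s] x in \<open>auto simp: field_simps\<close>)
    moreover have "- ?h < ?y \<and> ?y < ?h \<longleftrightarrow> x < A (w s j)"
      using A[OF s] by (auto simp: field_simps)
    ultimately show ?thesis by (simp only: less_minus_iff) linarith
  qed
  have cont: "continuous_on {a..b} (\<lambda>s. t s k)" if k: "k \<in> Idx" for k
    unfolding continuous_on_def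
  proof
    fix s0 assume s0: "s0 \<in> {a..b}"
    obtain e where d: "diag (W s0) e (w s0)" using w[OF s0] by blast
    note semi = count_lower_semicontinuous[OF W s0 d]
    have evS: "\<forall>\<^sub>F s in at s0 within {a..b}. s \<in> {a..b}" by (simp add: eventually_at_filter)
    show "((\<lambda>s. t s k) \<longlongrightarrow> t s0 k) (at s0 within {a..b})"
    proof (rule order_tendstoI)
      fix x assume x: "t s0 k < x"
      show "\<forall>\<^sub>F s in at s0 within {a..b}. t s k < x"
      proof (cases "x < \<alpha> + 2 * pi")
        case False
        show ?thesis using evS by eventually_elim (use tb[OF _ k] False in force)
      next
        case True
        have ax: "\<alpha> < x" using tb[OF s0 k] x by simp
        have cnt: "card {j\<in>Idx. A (w s j) < x}
          = card {j\<in>Idx. 0 < Re (cis (- ((\<alpha> + x) / 2)) * w s j) + - cos ((x - \<alpha>) / 2)}" if "s \<in> {a..b}" for s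
          using arc1[OF that _ ax True] by (intro arg_cong[of _ _ card]) blast
        show ?thesis using evS semi[of "cis (- ((\<alpha> + x) / 2))" "- cos ((x - \<alpha>) / 2)"]
        proof eventually_elim
          case (elim s)
          then have "card {j\<in>Idx. A (w s0 j) < x} \<le> card {j\<in>Idx. A (w s j) < x}"
            unfolding cnt[OF s0] cnt[OF elim(1)] using w[OF elim(1)] by blast
          then show ?case using x unfolding less1[OF k] by linarith
        qed
      qed
    next
      fix x assume x: "x < t s0 k"
      show "\<forall>\<^sub>F s in at s0 within {a..b}. x < t s k"
      proof (cases "\<alpha> < x")
        case False
        show ?thesis using evS by eventually_elim (use tb[OF _ k] False in force)
      next
        case True
        have ax: "x < \<alpha> + 2 * pi" using tb[OF s0 k] x by simp
        have cnt: "card {j\<in>Idx. x < A (w s j)}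
          = card {j\<in>Idx. 0 < Re (cis (- ((\<alpha> + 2 * pi + x) / 2)) * w s j) + - cos ((\<alpha> + 2 * pi - x) / 2)}"
          if "s \<in> {a..b}" for s
          using arc2[OF that _ True ax] by (intro arg_cong[of _ _ card]) blast
        show ?thesis using evS semi[of "cis (- ((\<alpha> + 2 * pi + x) / 2))" "- cos ((\<alpha> + 2 * pi - x) / 2)"]
        proof eventually_elim
          case (elim s)
          then have "card {j\<in>Idx. x < A (w s0 j)} \<le> card {j\<in>Idx. x < A (w s j)}"
            unfolding cnt[OF s0] cnt[OF elim(1)] using w[OF elim(1)] by blast
          then show ?case using x unfolding less2[OF k] by linarith
        qed
      qed
    qed
  qed
  have "dim {x. W s x = z *s x} = card {j\<in>Idx. cis (t s j) = z}" if s: "s \<in> {a..b}" for s z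
  proof -
    obtain e where d: "diag (W s) e (w s)" using w[OF s] by blast
    have "dim {x. W s x = z *s x} = card {j\<in>Idx. w s j = z}" by (rule diag_eigenspace_dim[OF d])
    also have "{j\<in>Idx. w s j = z} = {j\<in>Idx. cis (A (w s j)) = z}" using cisA[OF wu[OF s]] by auto
    also have "card \<dots> = card {j\<in>Idx. cis (t s j) = z}" by (rule tc[symmetric])
    finally show ?thesis .
  qed
  then show ?thesis using cont by (intro exI[of _ "\<lambda>j s. t s j"]) (simp add: lifts_def)
qed

text \<open>Bisection reduces the claim to a neighbourhood of one parameter. There some point of the
  circle avoids the finitely many eigenvalues and goes on avoiding them nearby, so
  \<open>lifts_local\<close> applies.\<close>

lemma lifts_exist:
  assumes W: "unitary_path {a..b} W" and "a \<le> b"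
  shows "\<exists>\<theta>. lifts a b W \<theta>"
proof -
  define P where "P p q \<longleftrightarrow> a \<le> p \<and> q \<le> b \<longrightarrow> (\<exists>\<theta>. lifts p q W \<theta>)" for p q
  from \<open>a \<le> b\<close> have "P a b"
  proof (induction rule: Bolzano)
    case (trans p q r)
    then show ?case using lifts_glue by (meson P_def order.trans)
  next
    case (local s0)
    then have s0: "s0 \<in> {a..b}" by simp
    then have U0: "unitary (W s0)" using W by (simp add: unitary_path_def)
    obtain e z where d: "diag (W s0) e z" using unitary_diag[OF U0] by blast
    \<comment> \<open>Serves to show that the circle is infinite, so that some
      \<open>cis \<alpha>\<close> is not an eigenvalue at \<open>s0\<close>.\<close>
    have "inj_on cis {0..<1}"
    proof (rule inj_onI)
      fix u v :: real assume uv: "u \<in> {0..<1}" "v \<in> {0..<1}" "cis u = cis v"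
      obtain n :: int where n: "u = v + 2 * pi * of_int n" using cis_eq_cis_imp[OF uv(3)] by blast
      have "\<bar>2 * pi * of_int n\<bar> < 1" using n uv by auto
      then have "2 * pi * \<bar>of_int n\<bar> < 1" by (simp add: abs_mult)
      moreover have "2 * pi * \<bar>of_int n\<bar> \<ge> 1" if "n \<noteq> 0"
      proof -
        have "(1::real) \<le> \<bar>of_int n\<bar>" using that by linarith
        then show ?thesis using mult_mono[of 1 "2 * pi" 1 "\<bar>real_of_int n\<bar>"] pi_ge_two by simp
      qed
      ultimately have "n = 0" by linarith
      then show "u = v" using n by simp
    qed
    then have "infinite (cis ` {0..<1::real})" by (simp add: finite_image_iff infinite_Ico)
    then have "\<not> cis ` {0..<1::real} \<subseteq> z ` Idx" using finite_subset[of _ "z ` Idx"] by auto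
    then obtain \<alpha> where "cis \<alpha> \<notin> z ` Idx" by blast
    then have al: "z j \<noteq> cis \<alpha>" if "j \<in> Idx" for j using that by (metis image_eqI)
    have lt1: "Re (cis (- \<alpha>) * z j) < 1" if "j \<in> Idx" for j
    proof (rule ccontr)
      assume "\<not> Re (cis (- \<alpha>) * z j) < 1"
      moreover have n1: "cmod (cis (- \<alpha>) * z j) = 1" using unitary_diag_norm[OF U0 d that] by (simp add: norm_mult)
      ultimately have "Re (cis (- \<alpha>) * z j) = 1" using complex_Re_le_cmod[of "cis (- \<alpha>) * z j"] by linarith
      then have "cis (- \<alpha>) * z j = 1" using n1 by (simp add: complex_eq_iff cmod_def del: times_complex.sel)
      then have "cis \<alpha> * (cis (- \<alpha>) * z j) = cis \<alpha>" by simp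
      then have "z j = cis \<alpha>" by (simp add: cis_mult flip: mult.assoc)
      then show False using al that by blast
    qed
    define M where "M = Max (insert 0 ((\<lambda>j. Re (cis (- \<alpha>) * z j)) ` Idx))"
    \<comment> \<open>Strictly between \<open>M\<close> and \<open>1\<close>: the half-plane
      \<open>0 < Re (- cis (- \<alpha>) * z) + c0\<close> contains every eigenvalue at
      \<open>s0\<close> but not \<open>cis \<alpha>\<close>.\<close>
    define c0 where "c0 = (1 + M) / 2"
    have M1: "M < 1"
      unfolding M_def using lt1 by (subst Max_less_iff) (auto simp del: times_complex.sel)
    have M2: "Re (cis (- \<alpha>) * z j) \<le> M" if "j \<in> Idx" for j
      unfolding M_def using that by (intro Max_ge) auto
    have c0: "c0 < 1" "M < c0"
      using M1 by (simp_all add: c0_def)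
    have all: "{j\<in>Idx. 0 < Re (- cis (- \<alpha>) * z j) + c0} = Idx"
      using M2 c0(2) by (auto simp del: times_complex.sel intro: le_less_trans)
    have "\<forall>\<^sub>F s in at s0 within {a..b}. \<forall>f w. diag (W s) f w \<longrightarrow>
      card {j\<in>Idx. 0 < Re (- cis (- \<alpha>) * z j) + c0} \<le> card {j\<in>Idx. 0 < Re (- cis (- \<alpha>) * w j) + c0}"
      by (rule count_lower_semicontinuous[OF W s0 d])
    then obtain \<delta> where "\<delta> > 0" and
      del: "\<And>s f w. s \<in> {a..b} \<Longrightarrow> s \<noteq> s0 \<Longrightarrow> dist s s0 < \<delta> \<Longrightarrow> diag (W s) f w \<Longrightarrow>
        card Idx \<le> card {j\<in>Idx. 0 < Re (- cis (- \<alpha>) * w j) + c0}"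
      unfolding eventually_at all by blast
    have cut: "x = 0" if s: "s \<in> {a..b}" "dist s s0 < \<delta>" and x: "W s x = cis \<alpha> *s x" for s x
    proof -
      have U: "unitary (W s)" using W s by (simp add: unitary_path_def)
      obtain f w where fw: "diag (W s) f w" using unitary_diag[OF U] by blast
      have "w j \<noteq> cis \<alpha>" if j: "j \<in> Idx" for j
      proof (cases "s = s0")
        case True
        have "card {j\<in>Idx. w j = cis \<alpha>} = card {j\<in>Idx. z j = cis \<alpha>}"
          using diag_eigenspace_dim[OF fw, of "cis \<alpha>"] diag_eigenspace_dim[OF d, of "cis \<alpha>"] True by simp
        also have "{j\<in>Idx. z j = cis \<alpha>} = {}" using al by blast
        finally show ?thesis using j by auto
      next
        case False
        have "{j\<in>Idx. 0 < Re (- cis (- \<alpha>) * w j) + c0} = Idx"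
          using del[OF s(1) False s(2) fw] by (intro card_seteq) auto
        then have "0 < Re (- cis (- \<alpha>) * w j) + c0" using j by blast
        moreover have "Re (- cis (- \<alpha>) * cis \<alpha>) = -1" unfolding mult_minus_left cis_mult by simp
        moreover have "0 < Re (- cis (- \<alpha>) * cis \<alpha>) + c0" if "w j = cis \<alpha>" using calculation(1) that by simp
        ultimately show ?thesis using c0(1) by fastforce
      qed
      then have "{j\<in>Idx. w j = cis \<alpha>} = {}" by auto
      then have "dim {x. W s x = cis \<alpha> *s x} = 0" using diag_eigenspace_dim[OF fw, of "cis \<alpha>"] by simp
      then show ?thesis using x by (auto simp: dim_eq_0)
    qed
    have "P p q" if "p \<le> s0 \<and> s0 \<le> q \<and> q - p < \<delta>" for p q
      unfolding P_def
    proof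
      assume pq: "a \<le> p \<and> q \<le> b"
      show "\<exists>\<theta>. lifts p q W \<theta>"
      proof (rule lifts_local)
        show "unitary_path {p..q} W" by (rule unitary_path_subset[OF W]) (use pq in auto)
        show "x = 0" if "s \<in> {p..q}" "W s x = cis \<alpha> *s x" for s x
          by (rule cut[OF _ _ that(2)]) (use that \<open>p \<le> s0 \<and> _\<close> pq in \<open>auto simp: dist_real_def\<close>)
      qed
    qed
    then show ?case using \<open>\<delta> > 0\<close> by blast
  qed
  then show ?thesis by (simp add: P_def)
qed

end

section \<open>Ceiling sums of eigenangles\<close>

lemma not_Ints_if_abs_less_1: "0 < \<bar>r\<bar> \<Longrightarrow> \<bar>r\<bar> < 1 \<Longrightarrow> (r::real) \<notin> \<int>"
proof
  assume r: "0 < \<bar>r\<bar>" "\<bar>r\<bar> < 1" "r \<in> \<int>"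
  then obtain k :: int where "r = of_int k" by (auto elim: Ints_cases)
  then have "0 < \<bar>k\<bar>" "\<bar>k\<bar> < 1" using r by linarith+
  then show False by simp
qed

lemma cis_eq_1_iff: "cis t = 1 \<longleftrightarrow> t / (2 * pi) \<in> \<int>"
proof
  assume "cis t = 1"
  then obtain n :: int where "t = 0 + 2 * pi * of_int n" using cis_eq_cis_imp[of t 0] by (metis cis_zero)
  then show "t / (2 * pi) \<in> \<int>" by simp
next
  assume "t / (2 * pi) \<in> \<int>"
  then obtain n :: int where "t / (2 * pi) = of_int n" by (auto elim: Ints_cases)
  then have "t = 2 * pi * of_int n" by (simp add: field_simps)
  then show "cis t = 1" by (simp add: cis_multiple_2pi)
qed

abbreviation ceiling_change :: "'i set \<Rightarrow> ('i \<Rightarrow> real \<Rightarrow> real) \<Rightarrow> real \<Rightarrow> real \<Rightarrow> int" where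
  "ceiling_change I \<theta> a b \<equiv> \<Sum>j\<in>I. \<lceil>\<theta> j b / (2 * pi)\<rceil> - \<lceil>\<theta> j a / (2 * pi)\<rceil>"

text \<open>On the unit circle \<open>crossing t\<close> is positive exactly on an arc from \<open>1\<close> to \<open>cis \<epsilon>\<close>, where
  \<open>cot (\<epsilon> / 2) = 2 * t\<close>.  It is the real part of an affine function of \<open>z\<close>, so that the
  eigenvalues on the arc are counted by a Hermitian form.\<close>

definition crossing :: "real \<Rightarrow> complex \<Rightarrow> real" where
  "crossing t z = Im z - t * (2 - 2 * Re z)"

text \<open>The half-angle factorization shows the sign near \<open>1\<close>: for small
  \<open>x\<close> the second factor is positive, so the sign is that of \<open>x\<close>.\<close>

lemma crossing_cis: "crossing t (cis x) = 2 * sin (x / 2) * (cos (x / 2) - 2 * t * sin (x / 2))"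
proof -
  have s: "sin x = 2 * sin (x / 2) * cos (x / 2)" using sin_double[of "x / 2"] by simp
  have c: "cos x = 1 - 2 * (sin (x / 2))\<^sup>2" using cos_double_sin[of "x / 2"] by simp
  show ?thesis
    unfolding crossing_def cis.sel s c by (simp add: power2_eq_square algebra_simps)
qed

lemma crossing_1 [simp]: "crossing t 1 = 0"
  by (simp add: crossing_def)

lemma crossing_antimono: "cmod z = 1 \<Longrightarrow> s \<le> t \<Longrightarrow> crossing t z \<le> crossing s z"
  using complex_Re_le_cmod[of z] by (simp add: crossing_def mult_right_mono)

text \<open>Bookkeeping for an angle \<open>y\<close> close to \<open>x\<close>. If
  \<open>cis x = 1\<close>, then \<open>cis y\<close> is either still \<open>1\<close>, or just
  above, or just below, and the ceiling, being left continuous, rises by one exactly in the second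
  case. If \<open>cis x \<noteq> 1\<close>, nothing changes.\<close>

abbreviation crossing_step :: "real \<Rightarrow> real \<Rightarrow> real \<Rightarrow> bool" where
  "crossing_step t x y \<equiv>
    of_bool (cis y = 1) + of_bool (0 < crossing t (cis y)) + of_bool (0 < crossing t (cnj (cis y)))
      = (of_bool (cis x = 1) :: nat) \<and>
    \<lceil>y / (2 * pi)\<rceil> - \<lceil>x / (2 * pi)\<rceil> = of_bool (0 < crossing t (cis y))"

abbreviation crossing_steps :: "'i set \<Rightarrow> real \<Rightarrow> ('i \<Rightarrow> real \<Rightarrow> real) \<Rightarrow> real \<Rightarrow> real \<Rightarrow> bool" where
  "crossing_steps I t f s0 s \<equiv>
    card {j\<in>I. cis (f j s) = 1} + card {j\<in>I. 0 < crossing t (cis (f j s))} +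
      card {j\<in>I. 0 < crossing t (cnj (cis (f j s)))} = card {j\<in>I. cis (f j s0) = 1} \<and>
    (\<Sum>j\<in>I. \<lceil>f j s / (2 * pi)\<rceil>) - (\<Sum>j\<in>I. \<lceil>f j s0 / (2 * pi)\<rceil>)
      = int (card {j\<in>I. 0 < crossing t (cis (f j s))})"

text \<open>If \<open>cis x = 1\<close>, every \<open>t \<ge> 0\<close> works: the arc then covers
  all angles slightly above \<open>x\<close>. Otherwise \<open>t\<close> must keep both arcs away
  from \<open>cis x\<close>, that is \<open>\<bar>sin x\<bar> < t * (2 - 2 * cos x)\<close>, which
  dictates \<open>t0\<close>. The neighbourhood may shrink as \<open>t\<close> grows.\<close>

lemma local_crossing:
  fixes f :: "real \<Rightarrow> real"
  assumes f: "(f \<longlongrightarrow> x) F"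
  shows "\<exists>t0. \<forall>t\<ge>t0. \<forall>\<^sub>F s in F.
    crossing_step t x (f s)"
proof (cases "cis x = 1")
  case True
  then obtain n :: int where n: "x / (2 * pi) = of_int n" by (auto simp: cis_eq_1_iff elim: Ints_cases)
  have x: "x = 2 * pi * of_int n" using n by (simp add: field_simps)
  have "\<forall>\<^sub>F s in F. crossing_step t x (f s)" if "t \<ge> 0" for t
  proof -
    have lim: "((\<lambda>s. f s - x) \<longlongrightarrow> x - x) F" by (intro tendsto_intros f)
    have "((\<lambda>s. cos ((f s - x) / 2) - 2 * t * \<bar>sin ((f s - x) / 2)\<bar>) \<longlongrightarrow> cos ((x - x) / 2) - 2 * t * \<bar>sin ((x - x) / 2)\<bar>) F"
      by (intro tendsto_intros lim) auto
    then have ev1: "\<forall>\<^sub>F s in F. 0 < cos ((f s - x) / 2) - 2 * t * \<bar>sin ((f s - x) / 2)\<bar>"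
      by (rule order_tendstoD) simp
    have ev2: "\<forall>\<^sub>F s in F. f s - x < pi" by (rule order_tendstoD(2)[OF lim]) simp
    have ev3: "\<forall>\<^sub>F s in F. - pi < f s - x" by (rule order_tendstoD(1)[OF lim]) simp
    show ?thesis using ev1 ev2 ev3
    proof eventually_elim
      case (elim s)
      define y where "y = f s - x"
      have fs: "cis (f s) = cis y"
        using True by (simp add: y_def flip: cis_divide)
      have cy: "cnj (cis y) = cis (- y)" by (simp add: cis_cnj)
      have y: "- pi < y" "y < pi" "0 < cos (y / 2) - 2 * t * \<bar>sin (y / 2)\<bar>" using elim by (auto simp: y_def)
      have p1: "0 < cos (y / 2) - 2 * t * sin (y / 2)" "0 < cos (y / 2) + 2 * t * sin (y / 2)"
        using y(3) that mult_left_mono[OF abs_ge_self[of "sin (y / 2)"], of "2 * t"]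
          mult_left_mono[OF abs_ge_minus_self[of "sin (y / 2)"], of "2 * t"] by auto
      have c1: "0 < crossing t (cis y) \<longleftrightarrow> 0 < sin (y / 2)" using p1(1) by (simp add: crossing_cis zero_less_mult_iff)
      have c2: "0 < crossing t (cis (- y)) \<longleftrightarrow> sin (y / 2) < 0" using p1(2) by (simp add: crossing_cis zero_less_mult_iff mult_less_0_iff)
      have fx: "f s / (2 * pi) = of_int n + y / (2 * pi)" by (simp add: y_def n[symmetric] diff_divide_distrib)
      have ceil_n: "\<lceil>x / (2 * pi)\<rceil> = n" by (simp add: n)
      consider "y = 0" | "0 < y" | "y < 0" by linarith
      then show ?case
      proof cases
        case 1
        then show ?thesis by (simp add: fs fx ceil_n True)
      next
        case 2
        have s: "0 < sin (y / 2)" using y 2 by (intro sin_gt_zero) auto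
        have b: "0 < y / (2 * pi)" "y / (2 * pi) < 1" using y 2 by (simp_all add: field_simps)
        then have "y / (2 * pi) \<notin> \<int>" by (intro not_Ints_if_abs_less_1) linarith+
        then have "cis y \<noteq> 1" by (simp add: cis_eq_1_iff)
        moreover have "\<lceil>f s / (2 * pi)\<rceil> = n + 1" by (rule ceiling_unique) (use b fx in auto)
        ultimately have "\<lceil>f s / (2 * pi)\<rceil> = n + 1" "cis y \<noteq> 1" by auto
        then show ?thesis using s by (simp add: fs cy c1 c2 ceil_n True)
      next
        case 3
        have "0 < sin (- y / 2)" using y 3 by (intro sin_gt_zero) auto
        then have s: "sin (y / 2) < 0" by simp
        have b: "y / (2 * pi) < 0" "-1 < y / (2 * pi)" using y 3 by (simp_all add: field_simps)
        then have "y / (2 * pi) \<notin> \<int>" by (intro not_Ints_if_abs_less_1) linarith+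
        then have "cis y \<noteq> 1" by (simp add: cis_eq_1_iff)
        moreover have "\<lceil>f s / (2 * pi)\<rceil> = n" by (rule ceiling_unique) (use b fx in auto)
        ultimately have "\<lceil>f s / (2 * pi)\<rceil> = n" "cis y \<noteq> 1" by auto
        then show ?thesis using s by (simp add: fs cy c1 c2 ceil_n True)
      qed
    qed
  qed
  then show ?thesis by blast
next
  case False
  have "Re (cis x) \<noteq> 1"
  proof
    assume *: "Re (cis x) = 1"
    moreover have "(Re (cis x))\<^sup>2 + (Im (cis x))\<^sup>2 = 1" by simp
    ultimately have "Im (cis x) = 0" by simp
    with * False show False by (simp add: complex_eq_iff)
  qed
  then have "cos x < 1" using cos_le_one[of x] by (simp add: less_le)
  then have r: "0 < 2 - 2 * cos x" by simp
  define t0 where "t0 = (\<bar>sin x\<bar> + 1) / (2 - 2 * cos x)"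
  have "\<forall>\<^sub>F s in F. crossing_step t x (f s)" if "t \<ge> t0" for t
  proof -
    have "\<bar>sin x\<bar> + 1 = t0 * (2 - 2 * cos x)" using r by (simp add: t0_def)
    also have "\<dots> \<le> t * (2 - 2 * cos x)" using that r by (intro mult_right_mono) auto
    finally have t: "\<bar>sin x\<bar> < t * (2 - 2 * cos x)" by simp
    have l1: "((\<lambda>s. sin (f s) - t * (2 - 2 * cos (f s))) \<longlongrightarrow> sin x - t * (2 - 2 * cos x)) F"
      by (intro tendsto_intros f)
    have l2: "((\<lambda>s. - sin (f s) - t * (2 - 2 * cos (f s))) \<longlongrightarrow> - sin x - t * (2 - 2 * cos x)) F"
      by (intro tendsto_intros f)
    have l3: "((\<lambda>s. f s / (2 * pi)) \<longlongrightarrow> x / (2 * pi)) F"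
      by (intro tendsto_intros f) simp
    have ni: "x / (2 * pi) \<notin> \<int>" using False by (simp add: cis_eq_1_iff)
    have "x / (2 * pi) \<noteq> of_int \<lceil>x / (2 * pi)\<rceil>" using ni by (metis Ints_of_int)
    then have up: "x / (2 * pi) < of_int \<lceil>x / (2 * pi)\<rceil>" using le_of_int_ceiling[of "x / (2 * pi)"] by linarith
    have lo: "of_int \<lceil>x / (2 * pi)\<rceil> - 1 < x / (2 * pi)" using ceiling_correct[of "x / (2 * pi)"] by simp
    have ev1: "\<forall>\<^sub>F s in F. sin (f s) - t * (2 - 2 * cos (f s)) < 0" by (rule order_tendstoD(2)[OF l1]) (use t in linarith)
    have ev2: "\<forall>\<^sub>F s in F. - sin (f s) - t * (2 - 2 * cos (f s)) < 0" by (rule order_tendstoD(2)[OF l2]) (use t in linarith)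
    show ?thesis using ev1 ev2 order_tendstoD(1)[OF l3 lo] order_tendstoD(2)[OF l3 up]
    proof eventually_elim
      case (elim s)
      have "crossing t (cis (f s)) < 0" "crossing t (cnj (cis (f s))) < 0" using elim by (simp_all add: crossing_def)
      moreover from this have "cis (f s) \<noteq> 1" by auto
      moreover have "\<lceil>f s / (2 * pi)\<rceil> = \<lceil>x / (2 * pi)\<rceil>" using elim by (intro ceiling_unique) auto
      ultimately show ?case using False by simp
    qed
  qed
  then show ?thesis by blast
qed

lemma local_crossing_family:
  fixes f :: "'i \<Rightarrow> real \<Rightarrow> real"
  assumes I: "finite I" and f: "\<And>j. j \<in> I \<Longrightarrow> (f j \<longlongrightarrow> f j s0) F"
  shows "\<exists>t0. \<forall>t\<ge>t0. \<forall>\<^sub>F s in F.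
    crossing_steps I t f s0 s"
proof -
  have "\<forall>j\<in>I. \<exists>t0. \<forall>t\<ge>t0. \<forall>\<^sub>F s in F.
    crossing_step t (f j s0) (f j s)"
    using local_crossing[OF f] by blast
  from bchoice[OF this] obtain T where "\<forall>j\<in>I. \<forall>t\<ge>T j. \<forall>\<^sub>F s in F.
    crossing_step t (f j s0) (f j s)"
    by (rule exE)
  then have T: "\<forall>\<^sub>F s in F.
    crossing_step t (f j s0) (f j s)" if "j \<in> I" "t \<ge> T j" for j t
    using that by (elim ballE[of _ _ j] allE[of _ t] impE) auto
  define t0 where "t0 = Max (insert 0 (T ` I))"
  have t0: "T j \<le> t0" if "j \<in> I" for j using I that by (auto simp: t0_def)
  have cb: "card {j\<in>I. P j} = (\<Sum>j\<in>I. of_bool (P j))" for P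
    using I by (simp add: Int_def)
  show ?thesis
  proof (intro exI[of _ t0] allI impI)
    fix t assume t: "t0 \<le> t"
    have "\<forall>\<^sub>F s in F. \<forall>j\<in>I.
      crossing_step t (f j s0) (f j s)"
    proof (rule eventually_ball_finite[OF I], rule ballI)
      fix j assume j: "j \<in> I"
      show "\<forall>\<^sub>F s in F.
        crossing_step t (f j s0) (f j s)"
        by (rule T[OF j order.trans[OF t0[OF j] t]])
    qed
    then show "\<forall>\<^sub>F s in F.
      crossing_steps I t f s0 s"
    proof eventually_elim
      case (elim s)
      have "card {j\<in>I. cis (f j s) = 1} + card {j\<in>I. 0 < crossing t (cis (f j s))} + card {j\<in>I. 0 < crossing t (cnj (cis (f j s)))}
          = card {j\<in>I. cis (f j s0) = 1}"
        unfolding cb sum.distrib[symmetric] by (rule sum.cong) (use elim in blast)+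
      moreover have "(\<Sum>j\<in>I. \<lceil>f j s / (2 * pi)\<rceil>) - (\<Sum>j\<in>I. \<lceil>f j s0 / (2 * pi)\<rceil>)
          = (\<Sum>j\<in>I. of_bool (0 < crossing t (cis (f j s))))"
        unfolding sum_subtractf[symmetric] by (rule sum.cong) (use elim in blast)+
      ultimately show ?case unfolding cb by simp
    qed
  qed
qed

text \<open>Near \<open>s\<^sub>0\<close> the ceiling sum grows by the number of eigenvalues just above \<open>1\<close>.  Those just
  above, at and just below \<open>1\<close> add up to the multiplicity of \<open>1\<close> at \<open>s\<^sub>0\<close>, which turns the
  inequalities between the counts into equalities.\<close>

lemma ceiling_sum_eq:
  fixes f g :: "'i \<Rightarrow> real \<Rightarrow> real"
  assumes I: "finite I" and "a \<le> b"
    and f: "\<And>j. j \<in> I \<Longrightarrow> continuous_on {a..b} (f j)" and g: "\<And>j. j \<in> I \<Longrightarrow> continuous_on {a..b} (g j)"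
    and null: "\<And>s. s \<in> {a..b} \<Longrightarrow> card {j\<in>I. cis (f j s) = 1} = card {j\<in>I. cis (g j s) = 1}"
    and above: "\<And>t'. \<exists>t. \<forall>s\<in>{a..b}.
      card {j\<in>I. 0 < crossing t (cis (f j s))} \<le> card {j\<in>I. 0 < crossing t' (cis (g j s))}"
    and below: "\<And>t'. \<exists>t. \<forall>s\<in>{a..b}.
      card {j\<in>I. 0 < crossing t (cnj (cis (f j s)))} \<le> card {j\<in>I. 0 < crossing t' (cnj (cis (g j s)))}"
  shows "ceiling_change I f a b = ceiling_change I g a b"
proof -
  define D where "D s = (\<Sum>j\<in>I. \<lceil>f j s / (2 * pi)\<rceil>) - (\<Sum>j\<in>I. \<lceil>g j s / (2 * pi)\<rceil>)" for s
  have "D a = D b"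
  proof (rule connected_local_const[of "{a..b}"])
    show "\<forall>s0\<in>{a..b}. \<forall>\<^sub>F s in at s0 within {a..b}. D s0 = D s"
    proof
      fix s0 assume s0: "s0 \<in> {a..b}"
      have lf: "(f j \<longlongrightarrow> f j s0) (at s0 within {a..b})" and lg: "(g j \<longlongrightarrow> g j s0) (at s0 within {a..b})"
        if "j \<in> I" for j
        using f[OF that] g[OF that] s0 by (auto simp: continuous_on_def)
      obtain tf where tf: "\<And>t. t \<ge> tf \<Longrightarrow> \<forall>\<^sub>F s in at s0 within {a..b}.
          crossing_steps I t f s0 s"
        using local_crossing_family[of I f, OF I lf] by blast
      obtain tg where tg: "\<And>t. t \<ge> tg \<Longrightarrow> \<forall>\<^sub>F s in at s0 within {a..b}.
          crossing_steps I t g s0 s"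
        using local_crossing_family[of I g, OF I lg] by blast
      obtain t1 where t1: "\<And>s. s \<in> {a..b} \<Longrightarrow>
          card {j\<in>I. 0 < crossing t1 (cis (f j s))} \<le> card {j\<in>I. 0 < crossing tg (cis (g j s))}"
        using above[of tg] by blast
      obtain t2 where t2: "\<And>s. s \<in> {a..b} \<Longrightarrow>
          card {j\<in>I. 0 < crossing t2 (cnj (cis (f j s)))} \<le> card {j\<in>I. 0 < crossing tg (cnj (cis (g j s)))}"
        using below[of tg] by blast
      \<comment> \<open>\<open>tg\<close> is fixed first, and \<open>t1\<close>, \<open>t2\<close>
        come from the comparisons with \<open>tg\<close>. Enlarging the parameter only shrinks the
        arcs of \<open>f\<close>, so both comparisons survive.\<close>
      define t where "t = max tf (max t1 t2)"
      have evS: "\<forall>\<^sub>F s in at s0 within {a..b}. s \<in> {a..b}" by (simp add: eventually_at_filter)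
      have tt: "tf \<le> t" "t1 \<le> t" "t2 \<le> t" by (auto simp: t_def)
      show "\<forall>\<^sub>F s in at s0 within {a..b}. D s0 = D s"
        using evS tf[OF tt(1)] tg[OF order_refl]
      proof eventually_elim
        case (elim s)
        have m1: "card {j\<in>I. 0 < crossing t (cis (f j s))} \<le> card {j\<in>I. 0 < crossing t1 (cis (f j s))}"
          using I crossing_antimono[OF _ tt(2)] by (intro card_mono) (auto intro: less_le_trans)
        have m2: "card {j\<in>I. 0 < crossing t (cnj (cis (f j s)))} \<le> card {j\<in>I. 0 < crossing t2 (cnj (cis (f j s)))}"
          using I crossing_antimono[OF _ tt(3)] by (intro card_mono) (auto intro: less_le_trans)
        show ?case
          using elim(2,3) m1 m2 t1[OF elim(1)] t2[OF elim(1)] null[OF elim(1)] null[OF s0]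
          unfolding D_def by linarith
      qed
    qed
  qed (use \<open>a \<le> b\<close> in auto)
  then show ?thesis unfolding D_def sum_subtractf by linarith
qed

section \<open>Ceiling sums expressed by angle sums\<close>

context hermitian_space
begin

lemma unitary_inv:
  assumes W: "unitary W"
  shows "bij W" "unitary (inv W)"
proof -
  have lin: "Vector_Spaces.linear scale scale W" by (rule unitary_linear[OF W])
  interpret W: Vector_Spaces.linear scale scale W by (rule lin)
  have inj: "inj W"
  proof (rule injI)
    fix x y assume "W x = W y"
    then have "W (x - y) = 0" by (simp add: W.diff)
    then have "ip (x - y) (x - y) = 0" using W by (metis unitary_def ip_zero(1))
    then show "x = y" by (simp add: ip_self_eq_0)
  qed
  then have surj: "surj W" using linear_inj_imp_surj[OF lin] by blast
  show "bij W" using inj surj by (simp add: bij_def)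
  show "unitary (inv W)"
    unfolding unitary_def
  proof (intro conjI allI)
    show "Vector_Spaces.linear scale scale (inv W)" by (rule inj_linear_imp_inv_linear[OF lin inj])
    show "ip (inv W x) (inv W y) = ip x y" for x y
      using W surj by (metis unitary_def surj_f_inv_f)
  qed
qed

text \<open>Inversion conjugates the eigenvalues, and \<open>ang (cnj z) = 1 - ang z\<close> except
  at \<open>z = 1\<close>, where both angles are \<open>0\<close>.\<close>

lemma angsum_inv:
  assumes W: "unitary W"
  shows "angsum (inv W) = real (dim (UNIV :: 'v set)) - real (dim {x. W x = x}) - angsum W"
proof -
  obtain e z where d: "diag W e z" using unitary_diag[OF W] by blast
  have zu: "cmod (z j) = 1" if "j \<in> Idx" for j by (rule unitary_diag_norm[OF W d that])
  have "diag (inv W) e (\<lambda>j. cnj (z j))"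
  proof -
    have "inv W (e j) = cnj (z j) *s e j" if j: "j \<in> Idx" for j
    proof (rule inv_f_eq)
      show "inj W" using unitary_inv(1)[OF W] by (simp add: bij_def)
      interpret W: Vector_Spaces.linear scale scale W by (rule unitary_linear[OF W])
      have "cnj (z j) * z j = 1" using zu[OF j] complex_norm_square[of "z j"] by (simp add: mult.commute)
      then show "W (cnj (z j) *s e j) = e j" using d j by (simp add: W.scale diag_def)
    qed
    then show ?thesis using d unitary_inv(2)[OF W] by (simp add: diag_def unitary_def)
  qed
  then have "angsum (inv W) = (\<Sum>j\<in>Idx. ang (cnj (z j)))" using angsum_diag unitary_inv(2)[OF W] by blast
  also have "\<dots> = (\<Sum>j\<in>Idx. 1 - of_bool (z j = 1) - ang (z j))"
  proof (rule sum.cong)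
    fix j assume j: "j \<in> Idx"
    define x where "x = 2 * pi * ang (z j)"
    have zx: "z j = cis x" using cis_ang[OF zu[OF j]] by (simp add: x_def)
    have "ang (cnj (z j)) = frac (- (x / (2 * pi)))" unfolding zx cis_cnj ang_cis_frac by simp
    moreover have "ang (z j) = frac (x / (2 * pi))" unfolding zx ang_cis_frac ..
    ultimately show "ang (cnj (z j)) = 1 - of_bool (z j = 1) - ang (z j)"
      by (simp add: frac_neg zx cis_eq_1_iff)
  qed simp
  also have "\<dots> = real (card Idx) - real (card {j\<in>Idx. z j = 1}) - angsum W"
    unfolding angsum_diag[OF d W] sum_subtractf by (simp add: Int_def)
  finally show ?thesis using diag_eigenspace_dim[OF d, of 1] by (simp add: card_Idx)
qed

text \<open>Pointwise \<open>\<lceil>t\<rceil> = t + 1 - frac t\<close> unless \<open>t\<close> is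
  an integer, where the \<open>1\<close> is missing; these exceptions are the eigenvalues
  \<open>1\<close>.\<close>

lemma lifts_ceiling_sum:
  assumes th: "lifts a b W \<theta>" and s: "s \<in> {a..b}" and W: "unitary (W s)"
  shows "of_int (\<Sum>j\<in>Idx. \<lceil>\<theta> j s / (2 * pi)\<rceil>) =
    (\<Sum>j\<in>Idx. \<theta> j s) / (2 * pi) + real (dim (UNIV :: 'v set)) - real (dim {x. W s x = x}) - angsum (W s)"
proof -
  have c: "of_int \<lceil>t\<rceil> = t + 1 - of_bool (t \<in> \<int>) - frac t" for t :: real
  proof (cases "t \<in> \<int>")
    case True
    then show ?thesis by (auto elim!: Ints_cases)
  next
    case False
    then have "t \<noteq> of_int \<lfloor>t\<rfloor>" by (metis Ints_of_int)
    then show ?thesis using False by (simp add: frac_def ceiling_altdef)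
  qed
  have d: "dim {x. W s x = z *s x} = card {j\<in>Idx. cis (\<theta> j s) = z}" for z
    using th s by (simp add: lifts_def)
  have "angsum (W s) = (\<Sum>j\<in>Idx. frac (\<theta> j s / (2 * pi)))"
    using angsum_eq[OF d W] by (simp add: ang_cis_frac)
  moreover have "real (dim {x. W s x = x}) = (\<Sum>j\<in>Idx. of_bool (\<theta> j s / (2 * pi) \<in> \<int>))"
    using d[of 1] by (simp add: cis_eq_1_iff Int_def)
  ultimately show ?thesis
    by (simp add: c sum.distrib sum_subtractf card_Idx sum_divide_distrib)
qed

lemma lifts_eigenproduct:
  assumes th: "lifts a b W \<theta>" and s: "s \<in> {a..b}" and W: "unitary (W s)"
  shows "eigenproduct (W s) = cis (\<Sum>j\<in>Idx. \<theta> j s)"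
proof -
  define k where "k = int (dim (UNIV :: 'v set)) - int (dim {x. W s x = x}) - (\<Sum>j\<in>Idx. \<lceil>\<theta> j s / (2 * pi)\<rceil>)"
  have "2 * pi * angsum (W s) = (\<Sum>j\<in>Idx. \<theta> j s) + 2 * pi * of_int k"
    unfolding k_def of_int_diff lifts_ceiling_sum[OF assms] by (simp add: field_simps)
  then show ?thesis unfolding eigenproduct_angsum[OF W] by (simp add: cis_multiple_2pi flip: cis_mult)
qed

text \<open>By multiplicativity of \<open>eigenproduct\<close> the difference of the two angle sums
  has constant \<open>cis\<close>. It thus moves in a discrete set, and continuity makes it
  constant.\<close>

lemma lifts_sum_comp:
  assumes W: "\<And>s. s \<in> {a..b} \<Longrightarrow> unitary (W s)" and C: "unitary C" and "a \<le> b"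
    and th: "lifts a b W \<theta>" "lifts a b (\<lambda>s. C \<circ> W s) \<theta>'"
  shows "(\<Sum>j\<in>Idx. \<theta>' j b) - (\<Sum>j\<in>Idx. \<theta>' j a) = (\<Sum>j\<in>Idx. \<theta> j b) - (\<Sum>j\<in>Idx. \<theta> j a)"
proof -
  define D where "D s = (\<Sum>j\<in>Idx. \<theta>' j s) - (\<Sum>j\<in>Idx. \<theta> j s)" for s
  have cisD: "cis (D s) = eigenproduct C" if s: "s \<in> {a..b}" for s
  proof -
    have "cis (\<Sum>j\<in>Idx. \<theta>' j s) = eigenproduct C * cis (\<Sum>j\<in>Idx. \<theta> j s)"
      using lifts_eigenproduct[OF th(2) s] lifts_eigenproduct[OF th(1) s W[OF s]]
        unitary_comp[OF C W[OF s]] eigenproduct_comp[OF unitary_linear[OF C], of "W s"] by simp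
    then show ?thesis by (simp add: D_def flip: cis_divide)
  qed
  have "D constant_on {a..b}"
  proof (rule continuous_discrete_range_constant)
    show "continuous_on {a..b} D"
      unfolding D_def using th by (intro continuous_intros) (auto simp: lifts_def)
    show "\<exists>e>0. \<forall>s'. s' \<in> {a..b} \<and> D s' \<noteq> D s \<longrightarrow> e \<le> norm (D s' - D s)" if s: "s \<in> {a..b}" for s
    proof (intro exI[of _ "2 * pi"] conjI allI impI)
      fix s' assume s': "s' \<in> {a..b} \<and> D s' \<noteq> D s"
      then obtain n :: int where n: "D s' = D s + 2 * pi * of_int n"
        using cis_eq_cis_imp[of "D s'" "D s"] cisD s by metis
      then have "n \<noteq> 0" using s' by auto
      then have "1 \<le> \<bar>real_of_int n\<bar>" by linarith
      then show "2 * pi \<le> norm (D s' - D s)" using n by (simp add: abs_mult)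
    qed simp
  qed simp
  then have "D a = D b" using \<open>a \<le> b\<close> unfolding constant_on_def by (metis atLeastAtMost_iff order_refl)
  then show ?thesis by (simp add: D_def)
qed

text \<open>\<open>lifts_ceiling_sum\<close> at both ends leaves only nullities and angle sums,
  since the real angle sums cancel by \<open>lifts_sum_comp\<close>. The lower bound is then
  \<open>angsum_comp_le\<close> for \<open>C\<close> and \<open>W b\<close>; the upper one is the
  same inequality for their inverses, translated by \<open>angsum_inv\<close>.\<close>

lemma ceiling_sum_comp_bounds:
  assumes W: "\<And>s. s \<in> {a..b} \<Longrightarrow> unitary (W s)" "W a = id" and C: "unitary C" and ab: "a \<le> b"
    and th: "lifts a b W \<theta>" "lifts a b (\<lambda>s. C \<circ> W s) \<theta>'"
  defines "\<Delta> \<equiv> ceiling_change Idx \<theta>' a b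
      - ceiling_change Idx \<theta> a b"
    and "\<nu> \<equiv> \<lambda>A. int (dim {x. A x = x})"
  shows "\<nu> (W b) + \<nu> C - int (dim {x. W b x = x \<and> C x = x}) - int (dim (UNIV :: 'v set)) \<le> \<Delta>"
    and "\<Delta> \<le> int (dim {x. W b x = x \<and> C x = x}) - \<nu> (C \<circ> W b)"
proof -
  let ?A = "W b"
  let ?n = "dim (UNIV :: 'v set)"
  let ?d = "dim {x. W b x = x \<and> C x = x}"
  have mem: "a \<in> {a..b}" "b \<in> {a..b}" using ab by auto
  note U = W(1)[OF mem(2)]
  have UC: "unitary (C \<circ> W s)" if "s \<in> {a..b}" for s by (rule unitary_comp[OF C W(1)[OF that]])
  have D: "real_of_int \<Delta> = of_int (\<Sum>j\<in>Idx. \<lceil>\<theta>' j b / (2 * pi)\<rceil>) - of_int (\<Sum>j\<in>Idx. \<lceil>\<theta>' j a / (2 * pi)\<rceil>)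
      - (of_int (\<Sum>j\<in>Idx. \<lceil>\<theta> j b / (2 * pi)\<rceil>) - of_int (\<Sum>j\<in>Idx. \<lceil>\<theta> j a / (2 * pi)\<rceil>))"
    unfolding \<Delta>_def sum_subtractf by simp
  have a0: "angsum id = 0"
  proof -
    obtain e where e: "onb e" using onb_exists by blast
    have "diag id e (\<lambda>j. 1)" using e unitary_id by (simp add: diag_def unitary_def)
    from angsum_diag[OF this unitary_id] show ?thesis using ang_eq_0_iff[of 1] by simp
  qed
  have s: "(\<Sum>j\<in>Idx. \<theta>' j b) / (2 * pi) - (\<Sum>j\<in>Idx. \<theta>' j a) / (2 * pi) = (\<Sum>j\<in>Idx. \<theta> j b) / (2 * pi) - (\<Sum>j\<in>Idx. \<theta> j a) / (2 * pi)"
    using lifts_sum_comp[OF W(1) C ab th] by (simp flip: diff_divide_distrib)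
  have Ca: "C \<circ> W a = C" and di: "dim {x. W a x = x} = ?n" and aWa: "angsum (W a) = 0" by (simp_all add: W(2) a0)
  have Cax: "{x. (C \<circ> W a) x = x} = {x. C x = x}" by (simp add: W(2))
  have D': "real_of_int \<Delta> = real (dim {x. ?A x = x}) + real (dim {x. C x = x}) - real ?n
      - real (dim {x. (C \<circ> ?A) x = x}) + angsum ?A + angsum C - angsum (C \<circ> ?A)"
    unfolding D lifts_ceiling_sum[OF th(2) mem(2) UC[OF mem(2)]] lifts_ceiling_sum[OF th(2) mem(1) UC[OF mem(1)]]
      lifts_ceiling_sum[OF th(1) mem(2) U] lifts_ceiling_sum[OF th(1) mem(1) W(1)[OF mem(1)]] Cax Ca di aWa
    using s by linarith
  have "{x. C x = x \<and> ?A x = x} = {x. ?A x = x \<and> C x = x}" by blast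
  then have lower: "angsum (C \<circ> ?A) + real (dim {x. (C \<circ> ?A) x = x}) \<le> angsum C + angsum ?A + real ?d"
    using angsum_comp_le[OF C U] by simp
  have "real_of_int (\<nu> ?A + \<nu> C - int ?d - int ?n) \<le> real_of_int \<Delta>"
    unfolding D' \<nu>_def using lower by simp
  then show "\<nu> ?A + \<nu> C - int ?d - int ?n \<le> \<Delta>" by (simp only: of_int_le_iff)
  have bA: "bij ?A" "bij C" using unitary_inv(1) U C by auto
  have iA: "inv ?A x = y \<longleftrightarrow> x = ?A y" and iC: "inv C x = y \<longleftrightarrow> x = C y" for x y
    using bij_inv_eq_iff[OF bA(1), of y x] bij_inv_eq_iff[OF bA(2), of y x] by metis+
  have e1: "{x. inv ?A (inv C x) = x} = {x. (C \<circ> ?A) x = x}"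
  proof -
    have "inv ?A (inv C x) = x \<longleftrightarrow> (C \<circ> ?A) x = x" for x unfolding iA iC by auto
    then show ?thesis by simp
  qed
  have e2: "{x. inv ?A x = x \<and> inv C x = x} = {x. ?A x = x \<and> C x = x}"
  proof -
    have "inv ?A x = x \<and> inv C x = x \<longleftrightarrow> ?A x = x \<and> C x = x" for x unfolding iA iC by auto
    then show ?thesis by simp
  qed
  have "inv ?A \<circ> inv C = inv (C \<circ> ?A)" using o_inv_distrib[OF bA(2) bA(1)] by simp
  then have "angsum (inv (C \<circ> ?A)) + real (dim {x. (C \<circ> ?A) x = x}) \<le> angsum (inv ?A) + angsum (inv C) + real ?d"
    using angsum_comp_le[OF unitary_inv(2)[OF U] unitary_inv(2)[OF C]] unfolding e1 e2 by simp
  then have "real_of_int \<Delta> \<le> real_of_int (int ?d - \<nu> (C \<circ> ?A))"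
    unfolding D' \<nu>_def angsum_inv[OF UC[OF mem(2)]] angsum_inv[OF U] angsum_inv[OF C] by simp
  then show "\<Delta> \<le> int ?d - \<nu> (C \<circ> ?A)" by (simp only: of_int_le_iff)
qed

end

section \<open>Polarizations of \<open>V \<times> V\<close>\<close>

text \<open>The sign \<open>\<sigma>\<close>, equal to \<open>1\<close> or \<open>-1\<close>, lets
  one statement treat the arcs above and below \<open>1\<close>.\<close>

abbreviation cnj_if :: "real \<Rightarrow> complex \<Rightarrow> complex" where
  "cnj_if \<sigma> z \<equiv> if \<sigma> = 1 then z else cnj z"

context hermitian_space
begin

lemma ip_bound:
  assumes e: "onb e"
  shows "cmod (ip x y) \<le> real (card Idx) * (sqrt (Re (ip x x)) * sqrt (Re (ip y y)))"
proof -
  have "cmod (ip x y) \<le> (\<Sum>j\<in>Idx. cmod (ip x (e j) * cnj (ip y (e j))))"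
    by (subst onb_parseval[OF e]) (rule norm_sum)
  also have "\<dots> \<le> (\<Sum>j\<in>Idx. sqrt (Re (ip x x)) * sqrt (Re (ip y y)))"
    unfolding norm_mult complex_mod_cnj using coord_le[OF e]
    by (intro sum_mono mult_mono real_le_rsqrt) auto
  finally show ?thesis by simp
qed

lemma norm_continuous:
  assumes "\<And>y. continuous_on S (\<lambda>s. ip (w s) y)"
  shows "continuous_on S (\<lambda>s. Re (ip (w s - w0) (w s - w0)))"
proof -
  obtain e where e: "onb e" using onb_exists by blast
  have "continuous_on S (\<lambda>s. Re (\<Sum>j\<in>Idx. (ip (w s) (e j) - ip w0 (e j)) * cnj (ip (w s) (e j) - ip w0 (e j))))"
    by (intro continuous_intros assms)
  moreover have "ip (w s - w0) (w s - w0) = (\<Sum>j\<in>Idx. (ip (w s) (e j) - ip w0 (e j)) * cnj (ip (w s) (e j) - ip w0 (e j)))" for s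
    by (subst onb_parseval[OF e]) (simp add: ip_diff)
  ultimately show ?thesis by simp
qed

text \<open>Isometries stay close along a moving argument, so inverses need not be controlled.\<close>

lemma unitary_pathI:
  assumes U: "\<And>s. s \<in> S \<Longrightarrow> unitary (W s)"
    and ex: "\<And>s0 w0. s0 \<in> S \<Longrightarrow> \<exists>w v. w s0 = w0 \<and> (\<forall>s\<in>S. W s (w s) = v s) \<and>
      (\<forall>y. continuous_on S (\<lambda>s. ip (w s) y)) \<and> (\<forall>y. continuous_on S (\<lambda>s. ip (v s) y))"
  shows "unitary_path S W"
  unfolding unitary_path_def
proof (intro conjI allI ballI U)
  fix x y
  obtain e where e: "onb e" using onb_exists by blast
  show "continuous_on S (\<lambda>s. ip (W s x) y)"
    unfolding continuous_on_def
  proof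
    fix s0 assume s0: "s0 \<in> S"
    obtain w v where w: "w s0 = x" "\<And>s. s \<in> S \<Longrightarrow> W s (w s) = v s"
      and cw: "\<And>y. continuous_on S (\<lambda>s. ip (w s) y)" and cv: "\<And>y. continuous_on S (\<lambda>s. ip (v s) y)"
      using ex[OF s0, of x] by blast
    have "((\<lambda>s. Re (ip (w s - x) (w s - x))) \<longlongrightarrow> Re (ip (w s0 - x) (w s0 - x))) (at s0 within S)"
      using norm_continuous[OF cw] s0 by (simp add: continuous_on_def)
    then have n0: "((\<lambda>s. Re (ip (w s - x) (w s - x))) \<longlongrightarrow> 0) (at s0 within S)" by (simp add: w(1))
    have b: "cmod (ip (W s x) y - ip (v s) y)
        \<le> real (card Idx) * (sqrt (Re (ip (w s - x) (w s - x))) * sqrt (Re (ip y y)))" if s: "s \<in> S" for s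
    proof -
      interpret Ws: Vector_Spaces.linear scale scale "W s" by (rule unitary_linear[OF U[OF s]])
      have "ip (W s x) y - ip (v s) y = - ip (W s (w s - x)) y"
        using w(2)[OF s] by (simp add: Ws.diff ip_diff)
      then have "cmod (ip (W s x) y - ip (v s) y) = cmod (ip (W s (w s - x)) y)" by simp
      also have "\<dots> \<le> real (card Idx) * (sqrt (Re (ip (W s (w s - x)) (W s (w s - x)))) * sqrt (Re (ip y y)))"
        by (rule ip_bound[OF e])
      finally show ?thesis using U[OF s] by (simp add: unitary_def)
    qed
    have z: "((\<lambda>s. real (card Idx) * (sqrt (Re (ip (w s - x) (w s - x))) * sqrt (Re (ip y y)))) \<longlongrightarrow>
        real (card Idx) * (sqrt 0 * sqrt (Re (ip y y)))) (at s0 within S)"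
      by (intro tendsto_intros n0)
    have evS: "\<forall>\<^sub>F s in at s0 within S. s \<in> S" by (simp add: eventually_at_filter)
    have "((\<lambda>s. ip (W s x) y - ip (v s) y) \<longlongrightarrow> 0) (at s0 within S)"
      by (rule Lim_null_comparison[OF _ z[simplified]]) (use evS b in \<open>auto elim: eventually_mono\<close>)
    moreover have "((\<lambda>s. ip (v s) y) \<longlongrightarrow> ip (v s0) y) (at s0 within S)"
      using cv s0 by (simp add: continuous_on_def)
    ultimately have "((\<lambda>s. ip (W s x) y - ip (v s) y + ip (v s) y) \<longlongrightarrow> 0 + ip (v s0) y) (at s0 within S)"
      by (rule tendsto_add)
    moreover have "v s0 = W s0 x" using w s0 by metis
    ultimately show "((\<lambda>s. ip (W s x) y) \<longlongrightarrow> ip (W s0 x) y) (at s0 within S)" by simp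
  qed
qed

text \<open>For unitary \<open>W\<close> the squared length of \<open>W x - x\<close> is
  \<open>2 * Re (ip x x) - 2 * Re (ip (W x) x)\<close>, so the form has the weights
  \<open>crossing t\<close>. Writing it through \<open>W x - x\<close> is what makes it comparable
  between two inner products.\<close>

lemma count_crossing_le:
  assumes d: "diag W e z" and F: "subspace F"
    and pos: "\<And>x. x \<in> F \<Longrightarrow> x \<noteq> 0 \<Longrightarrow>
      0 < \<sigma> * Im (ip (W x) x) - t * Re (ip (W x - x) (W x - x))"
    and U: "unitary W" and \<sigma>: "\<sigma> = 1 \<or> \<sigma> = -1"
  shows "dim F \<le> card {j\<in>Idx. 0 < crossing t (cnj_if \<sigma> (z j))}"
proof -
  define c where "c = Complex (2 * t) (- \<sigma>)"
  have cr: "crossing t (cnj_if \<sigma> (z j)) = Re (c * z j) + - 2 * t" for j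
    using \<sigma> by (auto simp: c_def crossing_def algebra_simps)
  have "dim F \<le> card {j\<in>Idx. 0 < Re (c * z j) + - 2 * t}"
  proof (rule count_pos[OF d F])
    fix x assume x: "x \<in> F" "x \<noteq> 0"
    have ww: "ip (W x) (W x) = ip x x" using U by (simp add: unitary_def)
    have eq: "Re (ip (W x - x) (W x - x)) = 2 * Re (ip x x) - 2 * Re (ip (W x) x)"
      using ip_cnj[of x "W x"] by (simp add: ip_diff ww)
    then show "0 < Re (c * ip (W x) x) + - 2 * t * Re (ip x x)"
      using pos[OF x] unfolding eq by (simp add: c_def algebra_simps)
  qed
  then show ?thesis unfolding cr .
qed

lemma crossing_space:
  assumes d: "diag W e z" and U: "unitary W" and \<sigma>: "\<sigma> = 1 \<or> \<sigma> = -1"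
  obtains F where "subspace F" "dim F = card {j\<in>Idx. 0 < crossing t (cnj_if \<sigma> (z j))}"
    "\<And>x. x \<in> F \<Longrightarrow> x \<noteq> 0 \<Longrightarrow> 0 < \<sigma> * Im (ip (W x) x) - t * Re (ip (W x - x) (W x - x))"
proof -
  define c where "c = Complex (2 * t) (- \<sigma>)"
  have cr: "crossing t (cnj_if \<sigma> (z j)) = Re (c * z j) + - 2 * t" for j
    using \<sigma> by (auto simp: c_def crossing_def algebra_simps)
  define F where "F = span (e ` {j\<in>Idx. 0 < Re (c * z j) + - 2 * t})"
  show thesis
  proof
    show "subspace F" by (simp add: F_def)
    show "dim F = card {j\<in>Idx. 0 < crossing t (cnj_if \<sigma> (z j))}"
      unfolding F_def cr by (rule onb_dim_span) (use d in \<open>auto simp: diag_def\<close>)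
    fix x assume x: "x \<in> F" "x \<noteq> 0"
    have ww: "ip (W x) (W x) = ip x x" using U by (simp add: unitary_def)
    have eq: "Re (ip (W x - x) (W x - x)) = 2 * Re (ip x x) - 2 * Re (ip (W x) x)"
      using ip_cnj[of x "W x"] by (simp add: ip_diff ww)
    then show "0 < \<sigma> * Im (ip (W x) x) - t * Re (ip (W x - x) (W x - x))"
      using eigenspan_pos[OF d, of x c "- 2 * t"] x unfolding eq by (simp add: c_def F_def algebra_simps)
  qed
qed

end

definition gr :: "('v \<Rightarrow> 'v) \<Rightarrow> 'v \<Rightarrow> 'v \<times> 'v" where
  "gr M x = (x, M x)"

section \<open>The Hermitian form of the double space and the graphs\<close>

context complex_symplectic_space
begin

text \<open>\<open>finite_dimensional_vector_space\<close> takes a basis as a parameter, so one is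
  fixed globally.\<close>

definition Bas :: "'v set" where
  "Bas = (SOME B. finite B \<and> independent B \<and> span B = UNIV)"

lemma Bas: "finite Bas" "independent Bas" "span Bas = UNIV"
proof -
  obtain B0 where B0: "finite B0" "span B0 = UNIV" using finite_dim by blast
  obtain B where B: "B \<subseteq> B0" "independent B" "B0 \<subseteq> span B" using maximal_independent_subset[of B0] by blast
  have "span B = UNIV" using span_minimal[OF B(3) subspace_span] B0(2) by auto
  moreover have "finite B" by (rule finite_subset[OF B(1) B0(1)])
  ultimately have "\<exists>B. finite B \<and> independent B \<and> span B = UNIV" using B(2) by blast
  from someI_ex[OF this] show "finite Bas" "independent Bas" "span Bas = UNIV" by (auto simp: Bas_def)
qed

lemma finite_dimensional: "finite_dimensional_vector_space scale Bas"
  by unfold_locales (rule Bas)+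

lemma form_zero [simp]: "\<omega> 0 y = 0" "\<omega> y 0 = 0"
  using form_scale[of 0 0 y] form_skew[of y 0] by simp_all

lemma form_add_right: "\<omega> x (y + z) = \<omega> x y + \<omega> x z"
  by (metis (no_types, lifting) form_skew form_add complex_cnj_add minus_add_distrib)

lemma form_scale_right: "\<omega> x (c *s y) = cnj c * \<omega> x y"
  by (metis (no_types, lifting) form_skew form_scale complex_cnj_mult mult_minus_right)

text \<open>The Hermitian form \<open>-i\<Omega>\<close> of the double space: graphs of symplectic
  maps are isotropic for it, and it is positive definite on \<open>X\<^sup>+\<close> and negative
  definite on \<open>X\<^sup>-\<close>.\<close>

definition H :: "'v \<times> 'v \<Rightarrow> 'v \<times> 'v \<Rightarrow> complex" where
  "H p q = - \<i> * double_form \<omega> p q"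

lemma H_add: "H (p + q) r = H p r + H q r" "H r (p + q) = H r p + H r q"
  by (simp_all add: H_def double_form_def form_add form_add_right algebra_simps)

lemma H_scale: "H (double_scale scale c p) r = c * H p r" "H r (double_scale scale c p) = cnj c * H r p"
  by (simp_all add: H_def double_form_def double_scale_apply form_scale form_scale_right algebra_simps)

lemma H_cnj: "H q p = cnj (H p q)"
  using form_skew[of "fst q" "fst p"] form_skew[of "snd q" "snd p"]
  by (simp add: H_def double_form_def algebra_simps)

lemma H_zero [simp]: "H 0 p = 0" "H p 0 = 0"
  by (simp_all add: H_def double_form_def)

lemma H_diff: "H (p - q) r = H p r - H q r" "H r (p - q) = H r p - H r q"
  using H_add(1)[of "p - q" q r] H_add(2)[of r "p - q" q] by simp_all

lemma H_self_real [simp]: "Im (H p p) = 0"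
  using H_cnj[of p p] by (simp add: complex_eq_iff)

lemma SpD:
  assumes "M \<in> Sp"
  shows "Vector_Spaces.linear scale scale M" "bij M" "\<omega> (M x) (M y) = \<omega> x y"
    "M (x + y) = M x + M y" "M (c *s x) = c *s M x" "M 0 = 0" "M (x - y) = M x - M y"
proof -
  show l: "Vector_Spaces.linear scale scale M" "bij M" "\<omega> (M x) (M y) = \<omega> x y" using assms by (auto simp: Sp_def)
  interpret Vector_Spaces.linear scale scale M by (rule l)
  show "M (x + y) = M x + M y" "M (c *s x) = c *s M x" "M 0 = 0" "M (x - y) = M x - M y"
    by (rule add scale zero diff)+
qed

lemma H_graph: "M \<in> Sp \<Longrightarrow> H (gr M x) (gr M y) = 0"
  by (simp add: H_def double_form_def gr_def SpD)

lemma gr_add: "M \<in> Sp \<Longrightarrow> gr M (x + y) = gr M x + gr M y"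
  and gr_diff: "M \<in> Sp \<Longrightarrow> gr M (x - y) = gr M x - gr M y"
  and gr_scale: "M \<in> Sp \<Longrightarrow> gr M (c *s x) = double_scale scale c (gr M x)"
  by (simp_all add: gr_def double_scale_apply SpD)

lemma gr_eq_0: "gr M x = 0 \<Longrightarrow> x = 0"
  by (simp add: gr_def prod_eq_iff)

lemma gr_inj: "gr M x = gr K y \<longleftrightarrow> x = y \<and> M x = K y"
  by (simp add: gr_def)

lemma Sp_id: "id \<in> Sp"
  by (simp add: Sp_def linear_id)

lemma Sp_comp: "A \<in> Sp \<Longrightarrow> B \<in> Sp \<Longrightarrow> A \<circ> B \<in> Sp"
  by (auto simp: Sp_def intro: Vector_Spaces.linear_compose bij_comp)

lemma Sp_inv:
  assumes "M \<in> Sp"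
  shows "inv M \<in> Sp"
proof -
  interpret finite_dimensional_vector_space scale Bas by (rule finite_dimensional)
  note M = SpD[OF assms]
  have "Vector_Spaces.linear scale scale (inv M)"
    by (rule inj_linear_imp_inv_linear[OF M(1)]) (use M(2) in \<open>simp add: bij_def\<close>)
  moreover have "\<omega> (inv M x) (inv M y) = \<omega> x y" for x y
    using M(3)[of "inv M x" "inv M y"] M(2) by (simp add: bij_is_surj surj_f_inv_f)
  ultimately show ?thesis using bij_imp_bij_inv[OF M(2)] by (simp add: Sp_def)
qed

end

text \<open>\<open>P\<close> is the projection of \<open>V \<times> V\<close> onto \<open>X\<^sup>+\<close> along \<open>X\<^sup>-\<close>.\<close>

locale polarized = complex_symplectic_space scale \<omega>
  for scale :: "complex \<Rightarrow> 'v::ab_group_add \<Rightarrow> 'v" (infixr \<open>*s\<close> 75)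
    and \<omega> :: "'v \<Rightarrow> 'v \<Rightarrow> complex" +
  fixes P :: "'v \<times> 'v \<Rightarrow> 'v \<times> 'v"
  assumes P_add: "P (p + q) = P p + P q"
    and P_scale: "P (double_scale scale c p) = double_scale scale c (P p)"
    and P_idem [simp]: "P (P p) = P p"
    and P_orth: "H (P p) (q - P q) = 0"
    and P_pos: "P p \<noteq> 0 \<Longrightarrow> 0 < Re (H (P p) (P p))"
    and P_neg: "P p \<noteq> p \<Longrightarrow> Re (H (p - P p) (p - P p)) < 0"
begin

definition Q :: "'v \<times> 'v \<Rightarrow> 'v \<times> 'v" where "Q p = p - P p"

lemma P_zero [simp]: "P 0 = 0"
  using P_add[of 0 0] by simp

lemma P_diff: "P (p - q) = P p - P q"
  using P_add[of "p - q" q] by simp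

lemma Q_add: "Q (p + q) = Q p + Q q" and Q_diff: "Q (p - q) = Q p - Q q" and Q_zero [simp]: "Q 0 = 0"
  and P_Q [simp]: "P (Q p) = 0" and Q_P [simp]: "Q (P p) = 0" and Q_idem [simp]: "Q (Q p) = Q p"
  and PQ: "P p + Q p = p"
  by (simp_all add: Q_def P_add P_diff)

lemma double_scale_diff: "double_scale scale c (p - q) = double_scale scale c p - double_scale scale c q"
  by (simp add: double_scale_apply scale_right_diff_distrib prod_eq_iff)

lemma Q_scale: "Q (double_scale scale c p) = double_scale scale c (Q p)"
  by (simp add: Q_def P_scale double_scale_diff)

lemma H_split: "H p q = H (P p) (P q) + H (Q p) (Q q)"
proof -
  have "H (P p) (Q q) = 0" by (simp add: Q_def P_orth)
  moreover have "H (Q p) (P q) = 0" using P_orth[of q p] H_cnj[of "Q p" "P q"] by (simp add: Q_def)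
  ultimately have "H (P p + Q p) (P q + Q q) = H (P p) (P q) + H (Q p) (Q q)" by (simp add: H_add)
  then show ?thesis by (simp add: PQ)
qed

text \<open>On a graph \<open>H\<close> vanishes, so its positive part on \<open>P p\<close> and its
  negative part on \<open>Q p\<close> cancel; if one projection is \<open>0\<close>, definiteness
  kills the other.\<close>

lemma graph_eq_0:
  assumes M: "M \<in> Sp"
  shows "P (gr M y) = 0 \<Longrightarrow> y = 0" and "Q (gr M y) = 0 \<Longrightarrow> y = 0"
proof -
  have 0: "H (P (gr M y)) (P (gr M y)) + H (Q (gr M y)) (Q (gr M y)) = 0"
    using H_split H_graph[OF M] by metis
  have neg: "Re (H (Q (gr M y)) (Q (gr M y))) < 0" if "Q (gr M y) \<noteq> 0"
    using P_neg[of "gr M y"] that by (auto simp: Q_def)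
  show "y = 0" if "P (gr M y) = 0"
  proof -
    have "Q (gr M y) = 0" using 0 that neg by fastforce
    then have "(gr M y) = 0" using PQ[of "gr M y"] that by simp
    then show ?thesis by (rule gr_eq_0)
  qed
  show "y = 0" if "Q (gr M y) = 0"
  proof -
    have "P (gr M y) = 0" using 0 that P_pos[of "gr M y"] by fastforce
    then have "(gr M y) = 0" using PQ[of "gr M y"] that by simp
    then show ?thesis by (rule gr_eq_0)
  qed
qed

lemma P_graph_eq: "M \<in> Sp \<Longrightarrow> P (gr M x) = P (gr M y) \<longleftrightarrow> x = y"
  using graph_eq_0(1)[of M "x - y"] P_diff[of "gr M x" "gr M y"] by (auto simp: gr_diff)

lemma Q_graph_eq: "M \<in> Sp \<Longrightarrow> Q (gr M x) = Q (gr M y) \<longleftrightarrow> x = y"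
  using graph_eq_0(2)[of M "x - y"] Q_diff[of "gr M x" "gr M y"] by (auto simp: gr_diff)

text \<open>No dimension count is needed: \<open>V \<times> V\<close> is mapped injectively, hence onto, itself.\<close>

lemma graphs_span:
  assumes M: "M \<in> Sp" and M': "M' \<in> Sp"
  shows "\<exists>u v. q = Q (gr M u) + P (gr M' v)"
proof -
  interpret D: complex_symplectic_space "double_scale scale" "double_form \<omega>"
    by (rule complex_symplectic_space_double)
  interpret D: finite_dimensional_vector_space "double_scale scale" D.Bas by (rule D.finite_dimensional)
  define F where "F p = Q (gr M (fst p)) + P (gr M' (snd p))" for p
  have lin: "Vector_Spaces.linear (double_scale scale) (double_scale scale) F"
  proof unfold_locales
    fix p r c
    show "F (p + r) = F p + F r"
      by (simp add: F_def gr_add M M' Q_add P_add)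
    show "F (double_scale scale c p) = double_scale scale c (F p)"
    proof -
      have "fst (double_scale scale c p) = c *s fst p" "snd (double_scale scale c p) = c *s snd p"
        by (simp_all add: double_scale_apply)
      then show ?thesis by (simp add: F_def gr_scale M M' Q_scale P_scale D.scale_right_distrib)
    qed
  qed
  interpret F: Vector_Spaces.linear "double_scale scale" "double_scale scale" F by (rule lin)
  have "inj F"
  proof -
    have "p = 0" if "F p = 0" for p
    proof -
      have "P (F p) = 0" "Q (F p) = 0" using that by simp_all
      then have z: "P (gr M' (snd p)) = 0" "Q (gr M (fst p)) = 0" by (simp_all add: F_def P_add Q_add)
      have "snd p = 0" using z(1) by (rule graph_eq_0(1)[OF M'])
      moreover have "fst p = 0" using z(2) by (rule graph_eq_0(2)[OF M])
      ultimately show ?thesis by (simp add: prod_eq_iff)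
    qed
    then show ?thesis using F.inj_iff_eq_0 by blast
  qed
  then have "surj F" by (rule D.linear_inj_imp_surj[OF lin])
  then obtain p where "q = F p" by (metis surjD)
  then show ?thesis by (auto simp: F_def)
qed

lemma P_graph_exists: "M \<in> Sp \<Longrightarrow> \<exists>v. P q = P (gr M v)"
  using graphs_span[of M M q] by (auto simp: P_add)

lemma Q_graph_exists: "M \<in> Sp \<Longrightarrow> \<exists>v. Q q = Q (gr M v)"
  using graphs_span[of M M q] by (auto simp: Q_add)

text \<open>\<open>lam\<close> and \<open>kap\<close> are coordinates that identify
  \<open>X\<^sup>+\<close> and \<open>X\<^sup>-\<close> with \<open>V\<close> through the
  projections of the diagonal. In them \<open>Gr id\<close> becomes the graph of the
  identity.\<close>

definition lam :: "'v \<times> 'v \<Rightarrow> 'v" where "lam q = (THE v. P q = P (gr id v))"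
definition kap :: "'v \<times> 'v \<Rightarrow> 'v" where "kap q = (THE v. Q q = Q (gr id v))"

lemma P_diag_eq: "P (gr id x) = P (gr id y) \<longleftrightarrow> x = y" and Q_diag_eq: "Q (gr id x) = Q (gr id y) \<longleftrightarrow> x = y"
  using P_graph_eq[OF Sp_id] Q_graph_eq[OF Sp_id] by simp_all

lemma P_lam: "P (gr id (lam q)) = P q"
proof -
  have "\<exists>!v. P q = P (gr id v)" using P_graph_exists[OF Sp_id, of q] P_diag_eq by auto
  from theI'[OF this] show ?thesis by (simp add: lam_def)
qed

lemma Q_kap: "Q (gr id (kap q)) = Q q"
proof -
  have "\<exists>!v. Q q = Q (gr id v)" using Q_graph_exists[OF Sp_id, of q] Q_diag_eq by auto
  from theI'[OF this] show ?thesis by (simp add: kap_def)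
qed

lemma lam_eq: "lam q = v \<longleftrightarrow> P q = P (gr id v)" and kap_eq: "kap q = v \<longleftrightarrow> Q q = Q (gr id v)"
  using P_lam[of q] Q_kap[of q] P_diag_eq Q_diag_eq by metis+

lemmas diag_add = gr_add[OF Sp_id] and diag_diff = gr_diff[OF Sp_id] and diag_scale = gr_scale[OF Sp_id]

lemma lam_add: "lam (p + q) = lam p + lam q" and lam_scale: "lam (double_scale scale c p) = c *s lam p"
  by (simp_all add: lam_eq P_add P_scale P_lam diag_add diag_scale)

lemma kap_add: "kap (p + q) = kap p + kap q" and kap_scale: "kap (double_scale scale c p) = c *s kap p"
  by (simp_all add: kap_eq Q_add Q_scale Q_kap diag_add diag_scale)

lemma kap_diag [simp]: "kap (gr id x) = x" and lam_diag [simp]: "lam (gr id x) = x"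
  by (simp_all add: kap_eq lam_eq)

lemma kap_graph_bij: "M \<in> Sp \<Longrightarrow> \<exists>y. kap (gr M y) = w"
  using Q_graph_exists[of M "(gr id w)"] by (metis kap_eq)

lemma kap_graph_inj: "M \<in> Sp \<Longrightarrow> kap (gr M x) = kap (gr M y) \<Longrightarrow> x = y"
  by (metis kap_eq Q_graph_eq)

text \<open>\<open>rot M\<close> is \<open>U\<^sub>\<lambda> U\<^sub>\<mu>\<^sup>-\<^sup>1\<close> for \<open>\<lambda> = Gr M\<close> and \<open>\<mu> = Gr id\<close>, transported from \<open>X\<^sup>+\<close> to \<open>V\<close> along
  \<open>w \<mapsto> P (w, w)\<close>, so that all unitaries act on one type.\<close>

definition rot :: "('v \<Rightarrow> 'v) \<Rightarrow> 'v \<Rightarrow> 'v" where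
  "rot M w = lam (gr M (SOME y. kap (gr M y) = w))"

lemma rot_kap: "M \<in> Sp \<Longrightarrow> rot M (kap (gr M y)) = lam (gr M y)"
proof -
  assume M: "M \<in> Sp"
  have "kap (gr M (SOME x. kap (gr M x) = kap (gr M y))) = kap (gr M y)"
    by (rule someI[of _ y]) simp
  then have "(SOME x. kap (gr M x) = kap (gr M y)) = y" by (rule kap_graph_inj[OF M])
  then show ?thesis by (simp add: rot_def)
qed

definition ipP :: "'v \<Rightarrow> 'v \<Rightarrow> complex" where
  "ipP x y = H (P (gr id x)) (P (gr id y))"

lemma hermitian: "hermitian_space scale Bas ipP"
proof -
  interpret finite_dimensional_vector_space scale Bas by (rule finite_dimensional)
  show ?thesis
  proof unfold_locales
    show "ipP (x + y) z = ipP x z + ipP y z" for x y z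
      by (simp add: ipP_def P_add H_add diag_add)
    show "ipP (c *s x) z = c * ipP x z" for c x z
      by (simp add: ipP_def P_scale H_scale diag_scale)
    show "ipP y x = cnj (ipP x y)" for x y unfolding ipP_def by (rule H_cnj)
    show "0 < Re (ipP x x)" if "x \<noteq> 0" for x
      unfolding ipP_def using that graph_eq_0(1)[OF Sp_id, of x] by (intro P_pos) auto
  qed
qed

sublocale V: hermitian_space scale Bas ipP by (rule hermitian)

lemma rot_linear:
  assumes M: "M \<in> Sp"
  shows "Vector_Spaces.linear scale scale (rot M)"
proof unfold_locales
  fix v w c
  obtain x y where xy: "v = kap (gr M x)" "w = kap (gr M y)" using kap_graph_bij[OF M] by metis
  have "rot M (v + w) = rot M (kap (gr M (x + y)))" by (simp add: xy kap_add gr_add[OF M])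
  also have "\<dots> = rot M v + rot M w" unfolding xy rot_kap[OF M] by (simp add: lam_add gr_add[OF M])
  finally show "rot M (v + w) = rot M v + rot M w" .
  have "rot M (c *s v) = rot M (kap (gr M (c *s x)))" by (simp add: xy kap_scale gr_scale[OF M])
  also have "\<dots> = c *s rot M v" unfolding xy rot_kap[OF M] by (simp add: lam_scale gr_scale[OF M])
  finally show "rot M (c *s v) = c *s rot M v" .
qed

text \<open>Two points \<open>p\<close>, \<open>q\<close> of one graph satisfy
  \<open>H (P p) (P q) = - H (Q p) (Q q)\<close>. This is used once on \<open>Gr M\<close> and once
  on \<open>Gr id\<close>, and the two signs cancel.\<close>

lemma rot_unitary:
  assumes M: "M \<in> Sp"
  shows "V.unitary (rot M)"
  unfolding V.unitary_def
proof (intro conjI allI rot_linear M)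
  fix v w
  obtain x y where xy: "v = kap (gr M x)" "w = kap (gr M y)" using kap_graph_bij[OF M] by metis
  have "ipP (rot M v) (rot M w) = H (P (gr M x)) (P (gr M y))"
    by (simp add: ipP_def xy rot_kap[OF M] P_lam)
  also have "\<dots> = - H (Q (gr M x)) (Q (gr M y))"
    using H_split[of "gr M x" "gr M y"] H_graph[OF M] by (simp add: add_eq_0_iff2)
  also have "\<dots> = - H (Q (gr id v)) (Q (gr id w))" by (simp add: xy Q_kap)
  also have "\<dots> = ipP v w"
    using H_split[of "gr id v" "gr id w"] H_graph[OF Sp_id, of v w] by (simp add: ipP_def add_eq_0_iff2)
  finally show "ipP (rot M v) (rot M w) = ipP v w" .
qed

lemma rot_id: "rot id = id"
proof
  fix w
  show "rot id w = id w" using rot_kap[OF Sp_id, of w] by simp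
qed

text \<open>A fixed vector makes a point of \<open>Gr M\<close> and a point of the diagonal share
  both projections, so the points coincide. In particular the nullity does not depend on the
  polarization.\<close>

lemma rot_fixed: "M \<in> Sp \<Longrightarrow> {w. rot M w = w} = N1 M"
proof (intro Set.set_eqI)
  fix w assume M: "M \<in> Sp"
  obtain y where y: "w = kap (gr M y)" using kap_graph_bij[OF M] by metis
  have "rot M w = w \<longleftrightarrow> M w = w"
  proof
    assume "rot M w = w"
    then have "lam (gr M y) = w" using y rot_kap[OF M] by simp
    then have "P (gr M y) = P (gr id w)" "Q (gr M y) = Q (gr id w)" using y Q_kap[of "gr M y"] P_lam[of "gr M y"] by auto
    then have "gr M y = gr id w" using PQ by metis
    then show "M w = w" by (auto simp: gr_inj)
  next
    assume "M w = w"
    then have "gr M w = gr id w" by (simp add: gr_def)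
    then show "rot M w = w" using rot_kap[OF M, of w] by simp
  qed
  then show "w \<in> {w. rot M w = w} \<longleftrightarrow> w \<in> N1 M" by (simp add: N1_def)
qed

lemma rot_path:
  assumes g: "\<And>s. s \<in> S \<Longrightarrow> \<gamma> s \<in> Sp"
    and c: "\<And>f v. Vector_Spaces.linear scale (*) f \<Longrightarrow> continuous_on S (\<lambda>s. f (\<gamma> s v))"
  shows "V.unitary_path S (\<lambda>s. rot (\<gamma> s))"
proof (rule V.unitary_pathI)
  show "V.unitary (rot (\<gamma> s))" if "s \<in> S" for s by (rule rot_unitary[OF g[OF that]])
  fix s0 w0 assume s0: "s0 \<in> S"
  \<comment> \<open>The moving argument follows a fixed \<open>u\<close>:
    \<open>rot (\<gamma> s)\<close> sends \<open>kap (gr (\<gamma> s) u)\<close> to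
    \<open>lam (gr (\<gamma> s) u)\<close>, and both are affine in \<open>\<gamma> s u\<close>,
    hence continuous.\<close>
  obtain u where u: "kap (gr (\<gamma> s0) u) = w0" using kap_graph_bij[OF g[OF s0]] by blast
  have vs: "vector_space ((*) :: complex \<Rightarrow> complex \<Rightarrow> complex)"
    by unfold_locales (auto simp: algebra_simps)
  have split: "gr (\<gamma> s) u = (u, 0) + (0, \<gamma> s u)" for s by (simp add: gr_def)
  have sc: "(0 :: 'v, c *s v) = double_scale scale c (0, v)" for c v by (simp add: double_scale_apply)
  have ad: "(0 :: 'v, v + w) = (0, v) + (0, w)" for v w :: 'v by simp
  have l1: "Vector_Spaces.linear scale (*) (\<lambda>v. ipP (kap (0, v)) y)" for y
    unfolding Vector_Spaces.linear_iff
    using vs vector_space_axioms by (simp only: ad sc kap_add kap_scale V.ip_add V.ip_scale) simp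
  have l2: "Vector_Spaces.linear scale (*) (\<lambda>v. ipP (lam (0, v)) y)" for y
    unfolding Vector_Spaces.linear_iff
    using vs vector_space_axioms by (simp only: ad sc lam_add lam_scale V.ip_add V.ip_scale) simp
  show "\<exists>w v. w s0 = w0 \<and> (\<forall>s\<in>S. rot (\<gamma> s) (w s) = v s) \<and>
      (\<forall>y. continuous_on S (\<lambda>s. ipP (w s) y)) \<and> (\<forall>y. continuous_on S (\<lambda>s. ipP (v s) y))"
  proof (intro exI conjI allI ballI)
    show "kap (gr (\<gamma> s0) u) = w0" by (rule u)
    show "rot (\<gamma> s) (kap (gr (\<gamma> s) u)) = lam (gr (\<gamma> s) u)" if "s \<in> S" for s by (rule rot_kap[OF g[OF that]])
    show "continuous_on S (\<lambda>s. ipP (kap (gr (\<gamma> s) u)) y)" for y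
      by (subst split) (simp only: kap_add V.ip_add, intro continuous_intros c[OF l1])
    show "continuous_on S (\<lambda>s. ipP (lam (gr (\<gamma> s) u)) y)" for y
      by (subst split) (simp only: lam_add V.ip_add, intro continuous_intros c[OF l2])
  qed
qed

text \<open>\<open>gr M y\<close> and \<open>gr id w\<close> have the same component in
  \<open>X\<^sup>-\<close>, so their difference lies in \<open>X\<^sup>+\<close> and represents
  \<open>rot M w - w\<close>. For the imaginary part, the contribution of \<open>X\<^sup>-\<close>
  to \<open>H\<close> is real. Both ingredients of the crossing form are thus expressed by two
  points of the Lagrangians.\<close>

lemma rot_forms:
  assumes M: "M \<in> Sp" and y: "w = kap (gr M y)"
  defines "d \<equiv> rot M w - w"
  shows "P (gr id d) = (gr M y) - (gr id w)"
    and "Im (ipP (rot M w) w) = Im (H (gr M y) (gr id w))"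
proof -
  have r: "rot M w = lam (gr M y)" by (simp add: y rot_kap[OF M])
  have "P (gr id d) = P (gr M y) - P (gr id w)"
    by (simp add: d_def P_diff r P_lam diag_diff)
  also have "\<dots> = gr M y - gr id w"
    using Q_kap[of "gr M y"] unfolding y Q_def by (simp add: algebra_simps)
  finally show "P (gr id d) = (gr M y) - (gr id w)" .
  have "ipP (rot M w) w = H (P (gr M y)) (P (gr id w))" by (simp add: ipP_def r P_lam)
  also have "\<dots> = H (gr M y) (gr id w) - H (Q (gr id w)) (Q (gr id w))"
    using H_split[of "gr M y" "gr id w"] Q_kap[of "gr M y"] by (simp add: y)
  finally show "Im (ipP (rot M w) w) = Im (H (gr M y) (gr id w))" by simp
qed

end

section \<open>Independence of the polarization\<close>

locale two_polarizations = A: polarized scale \<omega> P + B: polarized scale \<omega> P'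
  for scale :: "complex \<Rightarrow> 'v::ab_group_add \<Rightarrow> 'v" (infixr \<open>*s\<close> 75)
    and \<omega> :: "'v \<Rightarrow> 'v \<Rightarrow> complex" and P P' :: "'v \<times> 'v \<Rightarrow> 'v \<times> 'v"
begin

text \<open>On a Lagrangian graph, \<open>Im \<langle>Ww, w\<rangle>\<close> for the two polarizations differs by a multiple of
  \<open>|Ww - w|\<^sup>2\<close>, which the parameter of \<open>crossing\<close> absorbs.\<close>

lemma crossing_count_compare:
  fixes \<sigma> t' :: real
  assumes \<sigma>: "\<sigma> = 1 \<or> \<sigma> = -1"
  shows "\<exists>t. \<forall>M e z e' z'. M \<in> A.Sp \<longrightarrow> A.V.diag (A.rot M) e z \<longrightarrow> B.V.diag (B.rot M) e' z' \<longrightarrow>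
    card {j\<in>A.V.Idx. 0 < crossing t (cnj_if \<sigma> (z j))}
      \<le> card {j\<in>A.V.Idx. 0 < crossing t' (cnj_if \<sigma> (z' j))}"
proof -
  \<comment> \<open>\<open>g d\<close> will be the displacement \<open>w' - w\<close> of the
    coordinate of one point of \<open>Gr M\<close>. \<open>B1\<close> gives the resulting change of
    the imaginary part, and \<open>B2\<close> the squared length of \<open>d'\<close> in terms of
    \<open>d\<close>.\<close>
  define g where "g d = B.kap (P (gr id d))" for d
  define B1 where "B1 x y = A.H (P (gr id x)) (gr id (g y))" for x y
  define B2 where "B2 x y = A.H (P (gr id x) - (gr id (g x))) (P (gr id y) - (gr id (g y)))" for x y
  have g_add: "g (x + y) = g x + g y" and g_scale: "g (c *s x) = c *s g x" for x y c
    by (simp_all add: g_def A.P_add A.P_scale B.kap_add B.kap_scale A.diag_add A.diag_scale)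
  obtain e0 where e0: "A.V.onb e0" using A.V.onb_exists by blast
  have "\<exists>C. \<forall>d. cmod (B1 d d) \<le> C * Re (A.ipP d d)"
    by (rule exI, rule allI, rule A.V.sesquilinear_bound[OF e0])
       (simp_all add: B1_def g_add g_scale A.P_add A.P_scale A.H_add A.H_scale A.diag_add A.diag_scale)
  then obtain C1 where C1: "\<And>d. cmod (B1 d d) \<le> C1 * Re (A.ipP d d)" by blast
  have "\<exists>C. \<forall>d. cmod (B2 d d) \<le> C * Re (A.ipP d d)"
    by (rule exI, rule allI, rule A.V.sesquilinear_bound[OF e0])
       (simp_all add: B2_def g_add g_scale A.P_add A.P_scale A.H_add A.H_scale A.H_diff A.diag_add A.diag_scale algebra_simps)
  then obtain C2 where C2: "\<And>d. cmod (B2 d d) \<le> C2 * Re (A.ipP d d)" by blast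
  \<comment> \<open>\<open>C1\<close> pays for the change \<open>B1\<close>, and
    \<open>\<bar>t'\<bar> * C2\<close> for the term with \<open>B2\<close>. Neither constant depends
    on \<open>M\<close>, so \<open>t\<close> works uniformly along a path.\<close>
  define t where "t = C1 + \<bar>t'\<bar> * C2"
  show ?thesis
  proof (intro exI[of _ t] allI impI)
    fix M e z e' z' assume M: "M \<in> A.Sp" and dA: "A.V.diag (A.rot M) e z" and dB: "B.V.diag (B.rot M) e' z'"
    obtain F where F: "A.subspace F"
      "A.dim F = card {j\<in>A.V.Idx. 0 < crossing t (cnj_if \<sigma> (z j))}"
      and pos: "\<And>x. x \<in> F \<Longrightarrow> x \<noteq> 0 \<Longrightarrow>
        0 < \<sigma> * Im (A.ipP (A.rot M x) x) - t * Re (A.ipP (A.rot M x - x) (A.rot M x - x))"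
      using A.V.crossing_space[OF dA A.rot_unitary[OF M] \<sigma>, of t] by blast
    define Y where "Y w = (SOME y. A.kap (gr M y) = w)" for w
    have Y: "A.kap (gr M (Y w)) = w" for w
      unfolding Y_def by (rule someI_ex) (rule A.kap_graph_bij[OF M])
    define T where "T w = B.kap (gr M (Y w))" for w
    have Y_eq: "Y w = y" if "A.kap (gr M y) = w" for w y
      by (rule A.kap_graph_inj[OF M]) (simp add: Y that)
    have Y_add: "Y (v + w) = Y v + Y w" for v w
      by (rule Y_eq) (simp add: A.kap_add Y A.gr_add[OF M])
    have Y_scale: "Y (c *s v) = c *s Y v" for c v
      by (rule Y_eq) (simp add: A.kap_scale Y A.gr_scale[OF M])
    have T: "Vector_Spaces.linear scale scale T"
    proof unfold_locales
      show "T (v + w) = T v + T w" for v w by (simp add: T_def Y_add B.kap_add A.gr_add[OF M])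
      show "T (c *s v) = c *s T v" for c v by (simp add: T_def Y_scale B.kap_scale A.gr_scale[OF M])
    qed
    interpret T: Vector_Spaces.linear scale scale T by (rule T)
    interpret finite_dimensional_vector_space_pair_1 scale A.Bas scale by unfold_locales
    have "inj T"
    proof (rule injI)
      fix v w assume "T v = T w"
      then have "Y v = Y w" unfolding T_def by (rule B.kap_graph_inj[OF M])
      then show "v = w" using Y by metis
    qed
    then have "A.dim (T ` F) = A.dim F" by (intro dim_image_eq[OF T]) (simp add: inj_on_def)
    moreover have "A.dim (T ` F) \<le> card {j\<in>A.V.Idx. 0 < crossing t' (cnj_if \<sigma> (z' j))}"
    proof (rule B.V.count_crossing_le[OF dB _ _ B.rot_unitary[OF M] \<sigma>])
      show "A.subspace (T ` F)" by (rule T.subspace_image[OF F(1)])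
      fix w' assume "w' \<in> T ` F" "w' \<noteq> 0"
      then obtain w where "w \<in> F" "w' = T w" by blast
      then have w: "w \<in> F" "w \<noteq> 0" "w' = T w" using T.zero \<open>w' \<noteq> 0\<close> by auto
      define y where "y = Y w"
      have wy: "w = A.kap (gr M y)" "w' = B.kap (gr M y)" by (simp_all add: y_def Y w(3) T_def)
      define d where "d = A.rot M w - w"
      define d' where "d' = B.rot M w' - w'"
      note fA = A.rot_forms[OF M wy(1), folded d_def]
      note fB = B.rot_forms[OF M wy(2), folded d'_def]
      have yM: "(gr M y) = P (gr id d) + (gr id w)" by (simp add: fA(1))
      have w': "w' = g d + w" unfolding wy(2) yM by (simp add: B.kap_add g_def)
      have "P' (gr id d') = P (gr id d) + (gr id w) - (gr id w')" using fB(1) yM by simp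
      then have u': "P' (gr id d') = P (gr id d) - (gr id (g d))" by (simp add: w' A.diag_add)
      \<comment> \<open>Isotropy of the diagonal removes \<open>w\<close>, so the change of the
        imaginary part is a form in \<open>d\<close> alone.\<close>
      have isot: "A.H (gr id w) (gr id (g d)) = 0" using A.H_graph[OF A.Sp_id, of w "g d"] by simp
      have "A.H (gr M y) (gr id w') = A.H (gr M y) (gr id w) + B1 d d"
        unfolding w' B1_def A.diag_add A.H_add(2) by (simp add: yM A.H_add(1) isot)
      then have im: "Im (B.ipP (B.rot M w') w') = Im (A.ipP (A.rot M w) w) + Im (B1 d d)"
        unfolding fB(2) fA(2) by simp
      have re: "B.ipP d' d' = B2 d d" by (simp add: B.ipP_def u' B2_def)
      have dd: "0 \<le> Re (A.ipP d d)" by simp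
      have b1: "\<bar>Im (B1 d d)\<bar> \<le> C1 * Re (A.ipP d d)" using C1[of d] abs_Im_le_cmod[of "B1 d d"] by linarith
      have "\<bar>Re (B2 d d)\<bar> \<le> C2 * Re (A.ipP d d)" using C2[of d] abs_Re_le_cmod[of "B2 d d"] by linarith
      then have "\<bar>t'\<bar> * \<bar>Re (B2 d d)\<bar> \<le> \<bar>t'\<bar> * (C2 * Re (A.ipP d d))" by (intro mult_left_mono) auto
      then have b2: "t' * Re (B2 d d) \<le> \<bar>t'\<bar> * (C2 * Re (A.ipP d d))"
        by (metis abs_ge_self abs_mult order.trans)
      have "0 < \<sigma> * Im (A.ipP (A.rot M w) w) - t * Re (A.ipP d d)" unfolding d_def by (rule pos[OF w(1,2)])
      also have "\<dots> \<le> \<sigma> * Im (B.ipP (B.rot M w') w') - t' * Re (B.ipP d' d')"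
        using \<sigma> b1 b2 unfolding im re t_def by (auto simp: algebra_simps)
      finally show "0 < \<sigma> * Im (B.ipP (B.rot M w') w') - t' * Re (B.ipP (B.rot M w' - w') (B.rot M w' - w'))"
        by (simp only: d'_def)
    qed
    ultimately show "card {j\<in>A.V.Idx. 0 < crossing t (cnj_if \<sigma> (z j))}
      \<le> card {j\<in>A.V.Idx. 0 < crossing t' (cnj_if \<sigma> (z' j))}"
      using F(2) by simp
  qed
qed

text \<open>Instance of \<open>ceiling_sum_eq\<close>: the nullities agree by
  \<open>rot_fixed\<close>, and the two arc comparisons are \<open>crossing_count_compare\<close>
  for the two signs.\<close>

lemma ceiling_sum_unique:
  assumes g: "\<And>s. s \<in> {a..b} \<Longrightarrow> \<gamma> s \<in> A.Sp" and "a \<le> b"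
    and th: "A.V.lifts a b (\<lambda>s. A.rot (\<gamma> s)) \<theta>" "B.V.lifts a b (\<lambda>s. B.rot (\<gamma> s)) \<theta>'"
  shows "ceiling_change A.V.Idx \<theta> a b
    = ceiling_change A.V.Idx \<theta>' a b"
proof (rule ceiling_sum_eq[OF A.V.finite_Idx \<open>a \<le> b\<close>])
  show "continuous_on {a..b} (\<theta> j)" "continuous_on {a..b} (\<theta>' j)" if "j \<in> A.V.Idx" for j
    using th that by (auto simp: A.V.lifts_def B.V.lifts_def)
  have dA: "A.dim {x. A.rot (\<gamma> s) x = z *s x} = card {j\<in>A.V.Idx. cis (\<theta> j s) = z}" if "s \<in> {a..b}" for s z
    using th that by (auto simp: A.V.lifts_def)
  have dB: "A.dim {x. B.rot (\<gamma> s) x = z *s x} = card {j\<in>A.V.Idx. cis (\<theta>' j s) = z}" if "s \<in> {a..b}" for s z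
    using th that by (auto simp: B.V.lifts_def)
  show "card {j\<in>A.V.Idx. cis (\<theta> j s) = 1} = card {j\<in>A.V.Idx. cis (\<theta>' j s) = 1}" if "s \<in> {a..b}" for s
    using dA[OF that, of 1] dB[OF that, of 1] A.rot_fixed[OF g[OF that]] B.rot_fixed[OF g[OF that]] by simp
  have cmp: "\<exists>t. \<forall>s\<in>{a..b}. card {j\<in>A.V.Idx. 0 < crossing t (cnj_if \<sigma> (cis (\<theta> j s)))}
      \<le> card {j\<in>A.V.Idx. 0 < crossing t' (cnj_if \<sigma> (cis (\<theta>' j s)))}"
    if \<sigma>: "\<sigma> = 1 \<or> \<sigma> = -1" for \<sigma> t' :: real
  proof -
    obtain t where t: "\<And>M e z e' z'. M \<in> A.Sp \<Longrightarrow> A.V.diag (A.rot M) e z \<Longrightarrow> B.V.diag (B.rot M) e' z' \<Longrightarrow>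
      card {j\<in>A.V.Idx. 0 < crossing t (cnj_if \<sigma> (z j))}
        \<le> card {j\<in>A.V.Idx. 0 < crossing t' (cnj_if \<sigma> (z' j))}"
      using crossing_count_compare[OF \<sigma>, of t'] by blast
    have "card {j\<in>A.V.Idx. 0 < crossing t (cnj_if \<sigma> (cis (\<theta> j s)))}
      \<le> card {j\<in>A.V.Idx. 0 < crossing t' (cnj_if \<sigma> (cis (\<theta>' j s)))}"
      if s: "s \<in> {a..b}" for s
    proof -
      obtain e z where z: "A.V.diag (A.rot (\<gamma> s)) e z" using A.V.unitary_diag[OF A.rot_unitary[OF g[OF s]]] by blast
      obtain e' z' where z': "B.V.diag (B.rot (\<gamma> s)) e' z'" using B.V.unitary_diag[OF B.rot_unitary[OF g[OF s]]] by blast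
      have "card {j\<in>A.V.Idx. cis (\<theta> j s) = c} = card {j\<in>A.V.Idx. z j = c}" for c
        using dA[OF s] A.V.diag_eigenspace_dim[OF z] by simp
      then obtain p where p: "p permutes A.V.Idx" "\<forall>j\<in>A.V.Idx. cis (\<theta> j s) = z (p j)"
        by (rule equal_counts_permutation[OF A.V.finite_Idx, of "\<lambda>j. cis (\<theta> j s)" z])
      have "card {j\<in>A.V.Idx. cis (\<theta>' j s) = c} = card {j\<in>A.V.Idx. z' j = c}" for c
        using dB[OF s] B.V.diag_eigenspace_dim[OF z'] by simp
      then obtain q where q: "q permutes A.V.Idx" "\<forall>j\<in>A.V.Idx. cis (\<theta>' j s) = z' (q j)"
        by (rule equal_counts_permutation[OF A.V.finite_Idx, of "\<lambda>j. cis (\<theta>' j s)" z'])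
      have "{j\<in>A.V.Idx. 0 < crossing t (cnj_if \<sigma> (cis (\<theta> j s)))}
          = {j\<in>A.V.Idx. 0 < crossing t (cnj_if \<sigma> (z (p j)))}" using p(2) by auto
      moreover have "{j\<in>A.V.Idx. 0 < crossing t' (cnj_if \<sigma> (cis (\<theta>' j s)))}
          = {j\<in>A.V.Idx. 0 < crossing t' (cnj_if \<sigma> (z' (q j)))}" using q(2) by auto
      ultimately show ?thesis
        using t[OF g[OF s] z z'] card_permutes[OF p(1), of "\<lambda>j. 0 < crossing t (cnj_if \<sigma> (z j))"]
          card_permutes[OF q(1), of "\<lambda>j. 0 < crossing t' (cnj_if \<sigma> (z' j))"] by simp
    qed
    then show ?thesis by blast
  qed
  show "\<exists>t. \<forall>s\<in>{a..b}. card {j\<in>A.V.Idx. 0 < crossing t (cis (\<theta> j s))} \<le> card {j\<in>A.V.Idx. 0 < crossing t' (cis (\<theta>' j s))}" for t'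
    using cmp[of 1 t'] by simp
  show "\<exists>t. \<forall>s\<in>{a..b}. card {j\<in>A.V.Idx. 0 < crossing t (cnj (cis (\<theta> j s)))} \<le> card {j\<in>A.V.Idx. 0 < crossing t' (cnj (cis (\<theta>' j s)))}" for t'
    using cmp[of "-1" t'] by simp
qed

end

section \<open>The index in terms of a polarization\<close>

context complex_symplectic_space
begin

lemma inner_product_hermitian:
  assumes "inner_product ip"
  shows "hermitian_space scale Bas ip"
proof -
  interpret finite_dimensional_vector_space scale Bas by (rule finite_dimensional)
  show ?thesis
    by unfold_locales (use assms in \<open>unfold inner_product_def, blast+\<close>)
qed

text \<open>\<open>Bas\<close> is declared orthonormal, and \<open>J x\<close> gets the coordinates
  \<open>\<omega> x b\<close>. This supplies the existence half of the definite description of the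
  index.\<close>

lemma inner_product_exists:
  "\<exists>ip J. inner_product ip \<and> Vector_Spaces.linear scale scale J \<and> bij J \<and> (\<forall>x y. \<omega> x y = ip (J x) y)"
proof -
  interpret finite_dimensional_vector_space scale Bas by (rule finite_dimensional)
  define r where "r x b = representation Bas x b" for x b
  have r_add: "r (x + y) b = r x b + r y b" and r_scale: "r (c *s x) b = c * r x b" for x y c b
    unfolding r_def using Bas by (simp_all add: representation_add representation_scale)
  have r_sum: "(\<Sum>b\<in>Bas. r x b *s b) = x" for x
    unfolding r_def by (rule sum_representation_eq) (use Bas in auto)
  have r_basis: "r (\<Sum>b\<in>Bas. c b *s b) b' = c b'" if "b' \<in> Bas" for c b'
  proof -
    have rb: "r b b' = (if b' = b then 1 else 0)" if "b \<in> Bas" for b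
      unfolding r_def using representation_basis[OF Bas(2) that] by simp
    have "r (sum f A) b' = (\<Sum>i\<in>A. r (f i) b')" for f and A :: "'v set"
      by (induction A rule: infinite_finite_induct) (use r_scale[of 0] in \<open>auto simp: r_add\<close>)
    then have "r (\<Sum>b\<in>Bas. c b *s b) b' = (\<Sum>b\<in>Bas. c b * (if b = b' then 1 else 0))"
      by (auto simp: r_scale rb intro!: sum.cong)
    then show ?thesis using sum_mult_delta[OF Bas(1) that, of c] by simp
  qed
  define ip where "ip x y = (\<Sum>b\<in>Bas. r x b * cnj (r y b))" for x y
  define J where "J x = (\<Sum>b\<in>Bas. \<omega> x b *s b)" for x
  have "inner_product ip"
    unfolding inner_product_def
  proof (intro conjI allI impI)
    show "ip (x + y) z = ip x z + ip y z" "ip (c *s x) z = c * ip x z" "ip y x = cnj (ip x y)" for x y z c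
      by (simp_all add: ip_def r_add r_scale sum.distrib sum_distrib_left algebra_simps)
    fix x :: 'v assume "x \<noteq> 0"
    then obtain b where b: "b \<in> Bas" "r x b \<noteq> 0" using r_sum[of x]
      by (metis (no_types, lifting) scale_zero_left sum.neutral)
    have "0 < (\<Sum>b\<in>Bas. (cmod (r x b))\<^sup>2)" by (rule sum_pos2[OF Bas(1) b(1)]) (use b in auto)
    also have "\<dots> = Re (ip x x)" unfolding ip_def complex_norm_square[symmetric] by (simp del: of_real_power)
    finally show "0 < Re (ip x x)" .
  qed
  moreover have om: "\<omega> x y = ip (J x) y" for x y
  proof -
    have ws: "\<omega> x (sum f A) = (\<Sum>b\<in>A. \<omega> x (f b))" for f and A :: "'v set"
      by (induction A rule: infinite_finite_induct) (auto simp: form_add_right)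
    have "\<omega> x y = \<omega> x (\<Sum>b\<in>Bas. r y b *s b)" by (simp add: r_sum)
    also have "\<dots> = (\<Sum>b\<in>Bas. \<omega> x b * cnj (r y b))" by (simp add: ws form_scale_right mult.commute)
    also have "\<dots> = ip (J x) y" unfolding ip_def J_def by (rule sum.cong) (auto simp: r_basis)
    finally show ?thesis .
  qed
  moreover have lin: "Vector_Spaces.linear scale scale J"
    by unfold_locales
      (auto simp: J_def form_add form_scale scale_left_distrib sum.distrib scale_sum_right)
  moreover have "bij J"
  proof -
    interpret J: Vector_Spaces.linear scale scale J by (rule lin)
    have "x = 0" if "J x = 0" for x
    proof (rule form_nondegenerate)
      show "\<omega> x y = 0" for y unfolding om that by (simp add: ip_def r_scale[of 0 0, simplified])
    qed
    then have "inj J" using J.inj_iff_eq_0 by blast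
    then show ?thesis using linear_inj_imp_surj[OF lin] by (simp add: bij_def)
  qed
  ultimately show ?thesis by blast
qed

text \<open>\<open>T\<close> is self-adjoint and invertible, so it has an orthonormal eigenbasis
  with nonzero real eigenvalues; \<open>P\<close> keeps the coordinates with negative eigenvalue. By
  \<open>-\<i> * \<omega> x x = - ip (T x) x\<close> these are the positive directions of the
  Hermitian form.\<close>

lemma polarization_of_inner_product:
  assumes ip: "inner_product ip" and J: "Vector_Spaces.linear scale scale J" "bij J"
    and om: "\<And>x y. \<omega> x y = ip (J x) y"
  shows "\<exists>P. (\<forall>x y. P (x + y) = P x + P y) \<and> (\<forall>c x. P (c *s x) = c *s P x) \<and> (\<forall>x. P (P x) = P x) \<and>
    (\<forall>x y. - \<i> * \<omega> (P x) (y - P y) = 0) \<and> (\<forall>x. P x \<noteq> 0 \<longrightarrow> 0 < Re (- \<i> * \<omega> (P x) (P x))) \<and>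
    (\<forall>x. P x \<noteq> x \<longrightarrow> Re (- \<i> * \<omega> (x - P x) (x - P x)) < 0) \<and>
    Xplus J = {x. P x = x} \<and> Xminus J = {x. P x = 0}"
proof -
  interpret hermitian_space scale Bas ip by (rule inner_product_hermitian[OF ip])
  interpret J: Vector_Spaces.linear scale scale J by (rule J)
  define T where "T x = \<i> *s J x" for x
  have linT: "Vector_Spaces.linear scale scale T"
    by unfold_locales (auto simp: T_def J.add J.scale scale_right_distrib mult.commute)
  interpret T: Vector_Spaces.linear scale scale T by (rule linT)
  have ipT: "ip (T x) y = \<i> * \<omega> x y" for x y by (simp add: T_def ip_scale om)
  have sa: "ip (T x) y = ip x (T y)" for x y
    using ip_cnj[of x "T y"] form_skew[of y x] by (simp add: ipT)
  obtain e z where e: "onb e" and ev: "\<And>j. j \<in> Idx \<Longrightarrow> T (e j) = z j *s e j"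
    using eigenbasis_exists[OF linT] by (auto simp: sa ip_scale_right)
  have dT: "diag T e z" using linT e ev by (simp add: diag_def)
  have on: "ip (e i) (e j) = (if i = j then 1 else 0)" if "i \<in> Idx" "j \<in> Idx" for i j
    using e that by (simp add: onb_def)
  have zr: "complex_of_real (Re (z j)) = z j" if j: "j \<in> Idx" for j
  proof -
    have "z j = cnj (z j)" using sa[of "e j" "e j"] ev[OF j] on[OF j j] by (simp add: ip_scale ip_scale_right)
    then show ?thesis by (simp add: complex_eq_iff)
  qed
  have z0: "Re (z j) \<noteq> 0" if j: "j \<in> Idx" for j
  proof
    assume "Re (z j) = 0"
    then have "z j = 0" using zr[OF j] by simp
    then have "T (e j) = 0" using ev[OF j] by simp
    then have "J (e j) = 0" by (simp add: T_def)
    then have "e j = 0" using J(2) J.zero by (metis bij_pointE)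
    then show False using on[OF j j] by simp
  qed
  define P where "P x = (\<Sum>j\<in>Idx. (of_bool (Re (z j) < 0) * ip x (e j)) *s e j)" for x
  have cP: "ip (P x) (e j) = of_bool (Re (z j) < 0) * ip x (e j)" if "j \<in> Idx" for x j
    unfolding P_def by (rule onb_coord[OF e that])
  have cT: "ip (T x) (e j) = z j * ip x (e j)" if "j \<in> Idx" for x j
    using diag_apply[OF dT, of x] onb_coord[OF e that] by simp
  have ext: "x = y" if "\<And>j. j \<in> Idx \<Longrightarrow> ip x (e j) = ip y (e j)" for x y
    using onb_expand[OF e, of x] onb_expand[OF e, of y] that by simp
  have Pa: "P (x + y) = P x + P y" for x y by (rule ext) (simp add: cP ip_add distrib_left)
  have Ps: "P (c *s x) = c *s P x" for c x by (rule ext) (simp add: cP ip_scale)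
  have Pi: "P (P x) = P x" for x by (rule ext) (simp add: cP)
  have om': "- \<i> * \<omega> x y = - (\<Sum>j\<in>Idx. (z j * ip x (e j)) * cnj (ip y (e j)))" for x y
  proof -
    have "- \<i> * \<omega> x y = - ip (T x) y" by (simp add: ipT)
    also have "ip (T x) y = (\<Sum>j\<in>Idx. (z j * ip x (e j)) * cnj (ip y (e j)))"
      by (subst onb_parseval[OF e]) (simp add: cT)
    finally show ?thesis .
  qed
  have quad: "Re (- \<i> * \<omega> x x) = (\<Sum>j\<in>Idx. - Re (z j) * (cmod (ip x (e j)))\<^sup>2)" for x
  proof -
    have "- \<i> * \<omega> x x = (\<Sum>j\<in>Idx. complex_of_real (- Re (z j) * (cmod (ip x (e j)))\<^sup>2))"
      unfolding om' sum_negf[symmetric]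
    proof (rule sum.cong)
      fix j assume j: "j \<in> Idx"
      show "- (z j * ip x (e j) * cnj (ip x (e j))) = complex_of_real (- Re (z j) * (cmod (ip x (e j)))\<^sup>2)"
        by (simp add: zr[OF j] complex_norm_square mult.assoc del: of_real_power)
    qed simp
    then show ?thesis by simp
  qed
  have orth: "- \<i> * \<omega> (P x) (y - P y) = 0" for x y
    unfolding om' by (auto simp: ip_diff cP intro!: sum.neutral)
  have nz: "\<exists>j\<in>Idx. ip x (e j) \<noteq> 0" if "x \<noteq> 0" for x
    using ext[of x 0] that by auto
  have pos: "0 < Re (- \<i> * \<omega> (P x) (P x))" if Px: "P x \<noteq> 0" for x
  proof -
    obtain j where j: "j \<in> Idx" "ip (P x) (e j) \<noteq> 0" using nz[OF Px] by blast
    show ?thesis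
      unfolding quad
    proof (rule sum_pos2[OF finite_Idx j(1)])
      show "0 < - Re (z j) * (cmod (ip (P x) (e j)))\<^sup>2"
        using j by (cases "Re (z j) < 0") (auto simp: cP mult_neg_pos)
      show "0 \<le> - Re (z i) * (cmod (ip (P x) (e i)))\<^sup>2" if "i \<in> Idx" for i
        using that by (cases "Re (z i) < 0") (auto simp: cP mult_nonpos_nonneg)
    qed
  qed
  have neg: "Re (- \<i> * \<omega> (x - P x) (x - P x)) < 0" if Px: "P x \<noteq> x" for x
  proof -
    obtain j where j: "j \<in> Idx" "ip (x - P x) (e j) \<noteq> 0" using nz[of "x - P x"] Px by auto
    have "0 < (\<Sum>j\<in>Idx. Re (z j) * (cmod (ip (x - P x) (e j)))\<^sup>2)"
    proof (rule sum_pos2[OF finite_Idx j(1)])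
      show "0 < Re (z j) * (cmod (ip (x - P x) (e j)))\<^sup>2"
        using j z0[OF j(1)] by (cases "Re (z j) < 0") (auto simp: cP ip_diff)
      show "0 \<le> Re (z i) * (cmod (ip (x - P x) (e i)))\<^sup>2" if "i \<in> Idx" for i
        using that by (cases "Re (z i) < 0") (auto simp: cP ip_diff)
    qed
    then show ?thesis unfolding quad by (simp add: sum_negf)
  qed
  have sP: "subspace {x. P x = x}" "subspace {x. P x = 0}"
    using Ps[of 0 0] by (auto simp: subspace_def Pa Ps)
  have co: "ip x (e j) = 0 \<or> Re (z j) = r" if "\<i> *s J x = complex_of_real r *s x" "j \<in> Idx" for x r j
  proof -
    have "T x = complex_of_real r *s x" using that by (simp add: T_def)
    then have "z j * ip x (e j) = complex_of_real r * ip x (e j)" using cT[OF that(2), of x] by (metis ip_scale)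
    then show ?thesis by (metis Re_complex_of_real mult_cancel_right)
  qed
  have ej: "e j \<noteq> 0" "\<i> *s J (e j) = complex_of_real (Re (z j)) *s e j" if j: "j \<in> Idx" for j
  proof -
    show "e j \<noteq> 0" using on[OF j j] by auto
    have "T (e j) = complex_of_real (Re (z j)) *s e j" by (simp add: ev[OF j] zr[OF j])
    then show "\<i> *s J (e j) = complex_of_real (Re (z j)) *s e j" by (simp add: T_def)
  qed
  have "Xplus J = {x. P x = x}"
  proof
    show "Xplus J \<subseteq> {x. P x = x}"
      unfolding Xplus_def
    proof (rule span_minimal[OF subsetI sP(1)])
      fix x assume "x \<in> {x. x \<noteq> 0 \<and> (\<exists>r. r < 0 \<and> \<i> *s J x = complex_of_real r *s x)}"
      then obtain r where x: "r < 0" "\<i> *s J x = complex_of_real r *s x" by blast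
      have "P x = x" by (rule ext) (use co[OF x(2)] x(1) in \<open>auto simp: cP\<close>)
      then show "x \<in> {x. P x = x}" by simp
    qed
    show "{x. P x = x} \<subseteq> Xplus J"
    proof
      fix x assume "x \<in> {x. P x = x}"
      then have "x = (\<Sum>j\<in>Idx. (of_bool (Re (z j) < 0) * ip x (e j)) *s e j)" by (simp add: P_def)
      also have "\<dots> \<in> Xplus J"
        unfolding Xplus_def
      proof (rule span_sum)
        fix j assume j: "j \<in> Idx"
        show "(of_bool (Re (z j) < 0) * ip x (e j)) *s e j \<in> span {x. x \<noteq> 0 \<and> (\<exists>r<0. \<i> *s J x = complex_of_real r *s x)}"
        proof (cases "Re (z j) < 0")
          case True
          then show ?thesis using ej[OF j] by (intro span_scale span_base) blast
        qed (simp add: span_zero)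
      qed
      finally show "x \<in> Xplus J" .
    qed
  qed
  moreover have "Xminus J = {x. P x = 0}"
  proof
    show "Xminus J \<subseteq> {x. P x = 0}"
      unfolding Xminus_def
    proof (rule span_minimal[OF subsetI sP(2)])
      fix x assume "x \<in> {x. x \<noteq> 0 \<and> (\<exists>r. 0 < r \<and> \<i> *s J x = complex_of_real r *s x)}"
      then obtain r where x: "0 < r" "\<i> *s J x = complex_of_real r *s x" by blast
      have "P x = 0"
      proof (rule ext)
        fix j assume j: "j \<in> Idx"
        show "ip (P x) (e j) = ip 0 (e j)" using co[OF x(2) j] x(1) by (auto simp: cP[OF j])
      qed
      then show "x \<in> {x. P x = 0}" by simp
    qed
    show "{x. P x = 0} \<subseteq> Xminus J"
    proof
      fix x assume "x \<in> {x. P x = 0}"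
      then have "ip x (e j) = 0" if "j \<in> Idx" "Re (z j) < 0" for j using cP[OF that(1), of x] that by simp
      moreover have "x = (\<Sum>j\<in>Idx. ip x (e j) *s e j)" by (rule onb_expand[OF e])
      moreover have "(\<Sum>j\<in>Idx. ip x (e j) *s e j) \<in> Xminus J" if *: "\<And>j. j \<in> Idx \<Longrightarrow> Re (z j) < 0 \<Longrightarrow> ip x (e j) = 0"
        unfolding Xminus_def
      proof (rule span_sum)
        fix j assume j: "j \<in> Idx"
        show "ip x (e j) *s e j \<in> span {x. x \<noteq> 0 \<and> (\<exists>r>0. \<i> *s J x = complex_of_real r *s x)}"
        proof (cases "Re (z j) < 0")
          case False
          then have "0 < Re (z j)" using z0[OF j] by simp
          then show ?thesis using ej[OF j] by (intro span_scale span_base) blast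
        qed (simp add: *[OF j] span_zero)
      qed
      ultimately show "x \<in> Xminus J" by metis
    qed
  qed
  ultimately show ?thesis using Pa Ps Pi orth pos neg by (intro exI[of _ P]) simp
qed

lemma dim_double: "vector_space.dim (double_scale scale) (UNIV :: ('v \<times> 'v) set) = 2 * dim (UNIV :: 'v set)"
proof -
  interpret finite_dimensional_vector_space scale Bas by (rule finite_dimensional)
  interpret p: finite_dimensional_vector_space_prod scale scale Bas Bas by unfold_locales
  show ?thesis
    using p.dimension_pair unfolding p.p.dimension_def dimension_def by (simp add: double_scale_def)
qed

end

context complex_symplectic_space
begin

interpretation D: complex_symplectic_space "double_scale scale" "double_form \<omega>"
  by (rule complex_symplectic_space_double)

lemma polarized_exists:
  assumes ipJ: "D.inner_product ip" "Vector_Spaces.linear (double_scale scale) (double_scale scale) J" "bij J"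
    "\<forall>x y. double_form \<omega> x y = ip (J x) y"
  shows "\<exists>P. polarized scale \<omega> P \<and> D.Xplus J = {x. P x = x} \<and> D.Xminus J = {x. P x = 0}"
proof -
  obtain P where P: "\<forall>x y. P (x + y) = P x + P y" "\<forall>c x. P (double_scale scale c x) = double_scale scale c (P x)"
    "\<forall>x. P (P x) = P x" "\<forall>x y. - \<i> * double_form \<omega> (P x) (y - P y) = 0"
    "\<forall>x. P x \<noteq> 0 \<longrightarrow> 0 < Re (- \<i> * double_form \<omega> (P x) (P x))"
    "\<forall>x. P x \<noteq> x \<longrightarrow> Re (- \<i> * double_form \<omega> (x - P x) (x - P x)) < 0"
    "D.Xplus J = {x. P x = x}" "D.Xminus J = {x. P x = 0}"
    using D.polarization_of_inner_product[OF ipJ(1-3)] ipJ(4) by blast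
  have "polarized scale \<omega> P"
    by unfold_locales (use P in \<open>unfold H_def, blast+\<close>)
  then show ?thesis using P by blast
qed

end

context polarized
begin

interpretation D: complex_symplectic_space "double_scale scale" "double_form \<omega>"
  by (rule complex_symplectic_space_double)

text \<open>The graph operator of \<open>Gr K\<close> sends \<open>Q p\<close> to \<open>P p\<close>
  for each \<open>p\<close> on the graph. Hence \<open>w \<mapsto> P (gr id w)\<close> intertwines
  \<open>rot M\<close> with the relative operator and matches their eigenspaces.\<close>

lemma relative_operator_dim:
  assumes J: "D.Xplus J = {x. P x = x}" "D.Xminus J = {x. P x = 0}" and M: "M \<in> Sp"
  shows "D.dim {x \<in> D.Xplus J. D.relative_operator J (Gr M) (Gr id) x = double_scale scale z x}
    = dim {w. rot M w = z *s w}"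
proof -
  have go: "D.graph_operator J (Gr K) (Q (gr K u)) = P (gr K u)" if K: "K \<in> Sp" for K u
    unfolding D.graph_operator_def
  proof (rule the_equality)
    show "P (gr K u) \<in> D.Xplus J \<and> Q (gr K u) + P (gr K u) \<in> Gr K"
      using PQ[of "gr K u"] by (auto simp: J Gr_def gr_def add.commute)
    fix y assume y: "y \<in> D.Xplus J \<and> Q (gr K u) + y \<in> Gr K"
    then obtain v where v: "Q (gr K u) + y = gr K v" by (auto simp: Gr_def gr_def)
    have Py: "P y = y" using y J by simp
    then have "Q y = 0" by (simp add: Q_def)
    then have "Q (gr K u) = Q (gr K v)" using v by (metis Q_add Q_idem add_0_right)
    then have "u = v" using Q_graph_eq[OF K] by simp
    then show "y = P (gr K u)" using v Py by (metis P_add P_Q add_0)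
  qed
  have inj: "inj_on (D.graph_operator J (Gr id)) (D.Xminus J)"
  proof (rule inj_onI)
    fix x y assume xy: "x \<in> D.Xminus J" "y \<in> D.Xminus J" "D.graph_operator J (Gr id) x = D.graph_operator J (Gr id) y"
    have "x = Q x" "y = Q y" using xy J by (auto simp: Q_def)
    then obtain u v where uv: "x = Q (gr id u)" "y = Q (gr id v)" using Q_graph_exists[OF Sp_id] by metis
    then have "P (gr id u) = P (gr id v)" using xy(3) go[OF Sp_id] by simp
    then show "x = y" using uv P_diag_eq by simp
  qed
  have rel: "D.relative_operator J (Gr M) (Gr id) (P (gr id w)) = P (gr id (rot M w))" for w
  proof -
    have "inv_into (D.Xminus J) (D.graph_operator J (Gr id)) (P (gr id w)) = Q (gr id w)"
      by (rule inv_into_f_eq[OF inj]) (simp_all add: J go[OF Sp_id])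
    moreover obtain y where y: "w = kap (gr M y)" using kap_graph_bij[OF M] by metis
    moreover have "Q (gr id w) = Q (gr M y)" by (simp add: y Q_kap)
    ultimately show ?thesis
      by (simp add: D.relative_operator_def go[OF M] rot_kap[OF M] P_lam)
  qed
  have "{x \<in> D.Xplus J. D.relative_operator J (Gr M) (Gr id) x = double_scale scale z x}
      = (\<lambda>w. P (gr id w)) ` {w. rot M w = z *s w}"
  proof (intro Set.set_eqI iffI)
    fix x assume x: "x \<in> {x \<in> D.Xplus J. D.relative_operator J (Gr M) (Gr id) x = double_scale scale z x}"
    then have "x = P x" by (simp add: J)
    then obtain w where w: "x = P (gr id w)" using P_graph_exists[OF Sp_id] by metis
    then have "P (gr id (rot M w)) = P (gr id (z *s w))" using x rel by (simp add: diag_scale P_scale)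
    then show "x \<in> (\<lambda>w. P (gr id w)) ` {w. rot M w = z *s w}" using w by (simp add: P_diag_eq)
  next
    fix x assume "x \<in> (\<lambda>w. P (gr id w)) ` {w. rot M w = z *s w}"
    then show "x \<in> {x \<in> D.Xplus J. D.relative_operator J (Gr M) (Gr id) x = double_scale scale z x}"
      by (auto simp: J rel diag_scale P_scale)
  qed
  moreover have "D.dim ((\<lambda>w. P (gr id w)) ` {w. rot M w = z *s w}) = dim {w. rot M w = z *s w}"
  proof -
    interpret pr: finite_dimensional_vector_space_pair_1 scale Bas "double_scale scale"
      by unfold_locales
    show ?thesis
    proof (rule pr.dim_image_eq)
      show "Vector_Spaces.linear scale (double_scale scale) (\<lambda>w. P (gr id w))"
        by unfold_locales (simp_all add: diag_add diag_scale P_add P_scale)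
      show "inj_on (\<lambda>w. P (gr id w)) (span {w. rot M w = z *s w})" by (rule inj_onI) (simp add: P_diag_eq)
    qed
  qed
  ultimately show ?thesis by simp
qed

lemma eigenangles_iff_lifts:
  assumes J: "D.Xplus J = {x. P x = x}" "D.Xminus J = {x. P x = 0}"
    and g: "\<And>s. s \<in> {a..b} \<Longrightarrow> \<gamma> s \<in> Sp"
  shows "D.eigenangles J a b (\<lambda>s. Gr (\<gamma> s)) (\<lambda>s. Gr id) \<theta> \<longleftrightarrow> V.lifts a b (\<lambda>s. rot (\<gamma> s)) \<theta>"
proof -
  have I: "{1..D.dim UNIV div 2} = V.Idx" using dim_double by (simp add: V.Idx_def)
  show ?thesis
    unfolding D.eigenangles_def V.lifts_def I
    using relative_operator_dim[OF J g] by (intro conj_cong refl ball_cong) simp_all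
qed

text \<open>\<open>P\<close> is any polarization, not one derived from an inner product. Every
  admissible inner product yields a second polarization \<open>P'\<close>, and
  \<open>ceiling_sum_unique\<close> identifies the two ceiling sums; this settles both halves of the
  definite description.\<close>

lemma i1_eq_ceiling_sum:
  assumes "0 \<le> \<tau>" and g: "\<And>s. s \<in> {0..\<tau>} \<Longrightarrow> \<gamma> s \<in> Sp"
    and c: "\<And>f v. Vector_Spaces.linear scale (*) f \<Longrightarrow> continuous_on {0..\<tau>} (\<lambda>s. f (\<gamma> s v))"
    and th: "V.lifts 0 \<tau> (\<lambda>s. rot (\<gamma> s)) \<theta>"
  shows "i1 \<tau> \<gamma> = ceiling_change V.Idx \<theta> 0 \<tau>"
proof -
  have I: "{1..D.dim UNIV div 2} = V.Idx" using dim_double by (simp add: V.Idx_def)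
  show ?thesis
    unfolding i1_def D.maslov_index_def I
  proof (rule the_equality)
    obtain ip J where ipJ: "D.inner_product ip" "Vector_Spaces.linear (double_scale scale) (double_scale scale) J" "bij J"
      "\<forall>x y. double_form \<omega> x y = ip (J x) y"
      using D.inner_product_exists by blast
    obtain P' where P': "polarized scale \<omega> P'" "D.Xplus J = {x. P' x = x}" "D.Xminus J = {x. P' x = 0}"
      using polarized_exists[OF ipJ] by blast
    interpret B: polarized scale \<omega> P' by (rule P')
    interpret two_polarizations scale \<omega> P P' by unfold_locales
    obtain \<theta>' where th': "B.V.lifts 0 \<tau> (\<lambda>s. B.rot (\<gamma> s)) \<theta>'"
      using B.V.lifts_exist[OF B.rot_path[of "{0..\<tau>}" \<gamma>, OF g c] \<open>0 \<le> \<tau>\<close>] by blast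
    have "D.eigenangles J 0 \<tau> (\<lambda>s. Gr (\<gamma> s)) (\<lambda>s. Gr id) \<theta>'"
      using B.eigenangles_iff_lifts[of J 0 \<tau> \<gamma>, OF P'(2,3) g] th' by blast
    moreover have "ceiling_change V.Idx \<theta> 0 \<tau>
      = ceiling_change V.Idx \<theta>' 0 \<tau>"
      by (rule ceiling_sum_unique[OF g \<open>0 \<le> \<tau>\<close> th th'])
    ultimately show "\<exists>ip J \<theta>'. D.inner_product ip \<and> Vector_Spaces.linear (double_scale scale) (double_scale scale) J \<and> bij J \<and>
      (\<forall>x y. double_form \<omega> x y = ip (J x) y) \<and> D.eigenangles J 0 \<tau> (\<lambda>s. Gr (\<gamma> s)) (\<lambda>s. Gr id) \<theta>' \<and>
      ceiling_change V.Idx \<theta> 0 \<tau> = ceiling_change V.Idx \<theta>' 0 \<tau>"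
      using ipJ by blast
  next
    fix n assume "\<exists>ip J \<theta>'. D.inner_product ip \<and> Vector_Spaces.linear (double_scale scale) (double_scale scale) J \<and> bij J \<and>
      (\<forall>x y. double_form \<omega> x y = ip (J x) y) \<and> D.eigenangles J 0 \<tau> (\<lambda>s. Gr (\<gamma> s)) (\<lambda>s. Gr id) \<theta>' \<and>
      n = ceiling_change V.Idx \<theta>' 0 \<tau>"
    then obtain ip J \<theta>' where ipJ: "D.inner_product ip" "Vector_Spaces.linear (double_scale scale) (double_scale scale) J" "bij J"
      "\<forall>x y. double_form \<omega> x y = ip (J x) y" and ea: "D.eigenangles J 0 \<tau> (\<lambda>s. Gr (\<gamma> s)) (\<lambda>s. Gr id) \<theta>'"
      and n: "n = ceiling_change V.Idx \<theta>' 0 \<tau>" by blast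
    obtain P' where P': "polarized scale \<omega> P'" "D.Xplus J = {x. P' x = x}" "D.Xminus J = {x. P' x = 0}"
      using polarized_exists[OF ipJ] by blast
    interpret B: polarized scale \<omega> P' by (rule P')
    interpret two_polarizations scale \<omega> P P' by unfold_locales
    have "B.V.lifts 0 \<tau> (\<lambda>s. B.rot (\<gamma> s)) \<theta>'" using B.eigenangles_iff_lifts[of J 0 \<tau> \<gamma>, OF P'(2,3) g] ea by blast
    from ceiling_sum_unique[OF g \<open>0 \<le> \<tau>\<close> th this] show "n = ceiling_change V.Idx \<theta> 0 \<tau>"
      by (simp add: n)
  qed
qed

end

section \<open>Shifting a path and iteration\<close>

context polarized
begin

text \<open>Conjugate of \<open>P\<close> by \<open>map_prod K id\<close>, which preserves the form
  of the double space when \<open>K\<close> is symplectic.\<close>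

definition shift :: "('v \<Rightarrow> 'v) \<Rightarrow> 'v \<times> 'v \<Rightarrow> 'v \<times> 'v" where
  "shift K q = map_prod (inv K) id (P (map_prod K id q))"

lemma shift_polarized:
  assumes K: "K \<in> Sp"
  shows "polarized scale \<omega> (shift K)"
proof -
  let ?G = "map_prod K (id :: 'v \<Rightarrow> 'v)" and ?G' = "map_prod (inv K) (id :: 'v \<Rightarrow> 'v)"
  note K' = Sp_inv[OF K]
  have bij: "K (inv K x) = x" "inv K (K x) = x" for x
    using SpD(2)[OF K] by (simp_all add: bij_is_surj surj_f_inv_f bij_is_inj)
  have add: "?G (p + q) = ?G p + ?G q" "?G' (p + q) = ?G' p + ?G' q" for p q
    by (simp_all add: SpD[OF K] SpD[OF K'] prod_eq_iff)
  have diff: "?G' (p - q) = ?G' p - ?G' q" for p q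
    by (simp add: SpD[OF K'] prod_eq_iff)
  have sc: "?G (double_scale scale c p) = double_scale scale c (?G p)"
      "?G' (double_scale scale c p) = double_scale scale c (?G' p)" for c p
    by (simp_all add: SpD[OF K] SpD[OF K'] double_scale_apply)
  have H: "H (?G' p) (?G' q) = H p q" for p q
    by (simp add: H_def double_form_def SpD[OF K'])
  have GG': "?G (?G' p) = p" "?G' (?G p) = p" for p by (simp_all add: prod_eq_iff bij)
  have cmp: "p - shift K p = ?G' (?G p - P (?G p))" for p by (simp add: shift_def diff GG')
  have zero: "?G' 0 = 0" using diff[of 0 0] by simp
  show ?thesis
  proof unfold_locales
    show "shift K (p + q) = shift K p + shift K q" for p q by (simp only: shift_def add P_add)
    show "shift K (double_scale scale c p) = double_scale scale c (shift K p)" for c p by (simp only: shift_def sc P_scale)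
    show "shift K (shift K p) = shift K p" for p by (simp only: shift_def GG' P_idem)
    show "H (shift K p) (q - shift K q) = 0" for p q
      unfolding cmp unfolding shift_def H by (rule P_orth)
    show "0 < Re (H (shift K p) (shift K p))" if "shift K p \<noteq> 0" for p
      unfolding shift_def H by (rule P_pos) (use that zero in \<open>auto simp: shift_def\<close>)
    show "Re (H (p - shift K p) (p - shift K p)) < 0" if "shift K p \<noteq> p" for p
      unfolding cmp H
    proof (rule P_neg, rule notI)
      assume "P (?G p) = ?G p"
      then have "shift K p = ?G' (?G p)" by (simp only: shift_def)
      then show False using that unfolding GG' by (rule notE[rotated])
    qed
  qed
qed

text \<open>\<open>map_prod K id\<close> carries \<open>Gr (M \<circ> K)\<close> to \<open>Gr M\<close> and \<open>Gr id\<close> to \<open>Gr (inv K)\<close>, so that replacing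
  \<open>M\<close> by \<open>M \<circ> K\<close> amounts to changing the second Lagrangian.\<close>

lemma shift_rot_dim:
  assumes K: "K \<in> Sp" and M: "M \<in> Sp"
  shows "dim {w. polarized.rot (shift K) (M \<circ> K) w = z *s w} = dim {w. (inv (rot (inv K)) \<circ> rot M) w = z *s w}"
proof -
  let ?G = "map_prod K (id :: 'v \<Rightarrow> 'v)" and ?G' = "map_prod (inv K) (id :: 'v \<Rightarrow> 'v)"
  interpret S: polarized scale \<omega> "shift K" by (rule shift_polarized[OF K])
  note K' = Sp_inv[OF K]
  note MK = Sp_comp[OF M K]
  have bij: "K (inv K x) = x" "inv K (K x) = x" for x
    using SpD(2)[OF K] by (simp_all add: bij_is_surj surj_f_inv_f bij_is_inj)
  have GG': "?G (?G' p) = p" "?G' (?G p) = p" for p by (simp_all add: prod_eq_iff bij)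
  have Gd: "?G (gr id v) = gr (inv K) (K v)" and GM: "?G (gr (M \<circ> K) v) = gr M (K v)" for v
    by (simp_all add: gr_def bij)
  have SP: "S.Q p = ?G' (Q (?G p))" for p
  proof -
    have "?G' (p - q) = ?G' p - ?G' q" for p q by (simp add: SpD[OF K'] prod_eq_iff)
    then show ?thesis by (simp add: S.Q_def Q_def shift_def GG')
  qed
  have injG': "?G' p = ?G' q \<longleftrightarrow> p = q" for p q using GG'(1) by metis
  \<comment> \<open>The image of the diagonal point \<open>gr id w\<close> under
    \<open>map_prod K id\<close>, read in the coordinate \<open>kap\<close> of \<open>P\<close>;
    this map intertwines the two operators.\<close>
  define \<zeta> where "\<zeta> w = kap (gr (inv K) (K w))" for w
  have rel: "rot M (\<zeta> w) = rot (inv K) (\<zeta> (S.rot (M \<circ> K) w))" for w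
  proof -
    obtain y where y: "w = S.kap (gr (M \<circ> K) y)" using S.kap_graph_bij[OF MK] by metis
    define v where "v = S.lam (gr (M \<circ> K) y)"
    have v: "S.rot (M \<circ> K) w = v" by (simp add: y v_def S.rot_kap[OF MK])
    have "S.Q (gr id w) = S.Q (gr (M \<circ> K) y)" by (simp add: y S.Q_kap)
    then have "Q (gr (inv K) (K w)) = Q (gr M (K y))" by (simp only: SP injG' Gd GM)
    then have k: "\<zeta> w = kap (gr M (K y))" unfolding \<zeta>_def by (metis kap_eq)
    have "shift K (gr id v) = shift K (gr (M \<circ> K) y)" by (simp add: v_def S.P_lam)
    then have "P (gr (inv K) (K v)) = P (gr M (K y))" by (simp only: shift_def injG' Gd GM)
    then have "lam (gr (inv K) (K v)) = lam (gr M (K y))" by (metis lam_eq)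
    then have "rot (inv K) (\<zeta> v) = rot M (\<zeta> w)" unfolding k unfolding \<zeta>_def by (simp add: rot_kap[OF K'] rot_kap[OF M])
    then show ?thesis by (simp add: v)
  qed
  have bijB: "bij (rot (inv K))" by (rule V.unitary_inv(1)[OF rot_unitary[OF K']])
  have rel': "(inv (rot (inv K)) \<circ> rot M) (\<zeta> w) = \<zeta> (S.rot (M \<circ> K) w)" for w
    using rel[of w] bijB by (simp add: bij_is_inj)
  have lin: "Vector_Spaces.linear scale scale \<zeta>"
    by unfold_locales (simp_all add: \<zeta>_def SpD[OF K] gr_add[OF K'] gr_scale[OF K'] kap_add kap_scale)
  interpret \<zeta>: Vector_Spaces.linear scale scale \<zeta> by (rule lin)
  have inj: "\<zeta> v = \<zeta> w \<longleftrightarrow> v = w" for v w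
  proof
    assume "\<zeta> v = \<zeta> w"
    then have "K v = K w" unfolding \<zeta>_def by (rule kap_graph_inj[OF K'])
    then show "v = w" using bij by metis
  qed simp
  have "{w. (inv (rot (inv K)) \<circ> rot M) w = z *s w} = \<zeta> ` {w. S.rot (M \<circ> K) w = z *s w}"
  proof (intro Set.set_eqI iffI)
    fix x assume x: "x \<in> {w. (inv (rot (inv K)) \<circ> rot M) w = z *s w}"
    obtain y where "kap (gr (inv K) y) = x" using kap_graph_bij[OF K'] by blast
    then have xw: "x = \<zeta> (inv K y)" by (simp add: \<zeta>_def bij)
    then have "\<zeta> (S.rot (M \<circ> K) (inv K y)) = \<zeta> (z *s inv K y)" using x rel'[of "inv K y"] by (simp add: \<zeta>.scale del: o_apply)
    then show "x \<in> \<zeta> ` {w. S.rot (M \<circ> K) w = z *s w}" using xw inj by blast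
  next
    fix x assume "x \<in> \<zeta> ` {w. S.rot (M \<circ> K) w = z *s w}"
    then obtain w where "x = \<zeta> w" "S.rot (M \<circ> K) w = z *s w" by blast
    then show "x \<in> {w. (inv (rot (inv K)) \<circ> rot M) w = z *s w}" using rel'[of w] by (simp add: \<zeta>.scale del: o_apply)
  qed
  moreover have "dim (\<zeta> ` {w. S.rot (M \<circ> K) w = z *s w}) = dim {w. S.rot (M \<circ> K) w = z *s w}"
  proof -
    interpret pr: finite_dimensional_vector_space_pair_1 scale Bas scale by unfold_locales
    show ?thesis by (rule pr.dim_image_eq[OF lin]) (simp add: inj_on_def inj)
  qed
  ultimately show ?thesis by simp
qed

end

section \<open>Bounds for one factor, catenation and nullities\<close>

context complex_symplectic_space
begin

text \<open>\<open>symplectic_paths\<close> without the condition at \<open>0\<close>, because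
  \<open>\<gamma> s \<circ> K\<close> starts at \<open>K\<close>.\<close>

definition Sp_path :: "real \<Rightarrow> (real \<Rightarrow> 'v \<Rightarrow> 'v) \<Rightarrow> bool" where
  "Sp_path \<tau> \<gamma> \<longleftrightarrow> (\<forall>s\<in>{0..\<tau>}. \<gamma> s \<in> Sp) \<and>
    (\<forall>f v. Vector_Spaces.linear scale (*) f \<longrightarrow> continuous_on {0..\<tau>} (\<lambda>s. f (\<gamma> s v)))"

lemma Sp_path_comp: "Sp_path \<tau> \<gamma> \<Longrightarrow> K \<in> Sp \<Longrightarrow> Sp_path \<tau> (\<lambda>s. \<gamma> s \<circ> K)"
  by (auto simp: Sp_path_def intro: Sp_comp)

lemma polarization_exists: "\<exists>P. polarized scale \<omega> P"
proof -
  interpret D: complex_symplectic_space "double_scale scale" "double_form \<omega>"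
    by (rule complex_symplectic_space_double)
  show ?thesis using D.inner_product_exists polarized_exists by blast
qed

lemma (in polarized) Sp_path_lifts:
  assumes "Sp_path \<tau> \<gamma>" "0 \<le> \<tau>"
  shows "\<exists>\<theta>. V.lifts 0 \<tau> (\<lambda>s. rot (\<gamma> s)) \<theta>"
proof -
  have "V.unitary_path {0..\<tau>} (\<lambda>s. rot (\<gamma> s))"
    by (rule rot_path) (use assms(1) in \<open>auto simp: Sp_path_def\<close>)
  then show ?thesis by (rule V.lifts_exist[OF _ assms(2)])
qed

lemma (in polarized) i1_eq:
  assumes "Sp_path \<tau> \<gamma>" "0 \<le> \<tau>" "V.lifts 0 \<tau> (\<lambda>s. rot (\<gamma> s)) \<theta>"
  shows "i1 \<tau> \<gamma> = ceiling_change V.Idx \<theta> 0 \<tau>"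
  by (rule i1_eq_ceiling_sum[OF assms(2) _ _ assms(3)]) (use assms(1) in \<open>auto simp: Sp_path_def\<close>)

text \<open>By \<open>shift_rot_dim\<close>, a lift for \<open>\<gamma> s \<circ> K\<close> in the
  polarization \<open>shift K\<close> is also a lift for \<open>C \<circ> rot (\<gamma> s)\<close>
  with a constant unitary \<open>C\<close>. So \<open>ceiling_sum_comp_bounds\<close> applies, and
  \<open>C\<close> has the fixed vectors \<open>N1 K\<close>.\<close>

lemma i1_comp_bounds:
  assumes g: "Sp_path \<tau> \<gamma>" and start: "\<gamma> 0 = id" and t: "0 \<le> \<tau>" and K: "K \<in> Sp"
  shows "int (nu1 (\<gamma> \<tau>)) + int (nu1 K) - int (dim (N1 (\<gamma> \<tau>) \<inter> N1 K)) - int (dim (UNIV :: 'v set))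
      \<le> i1 \<tau> (\<lambda>s. \<gamma> s \<circ> K) - i1 \<tau> \<gamma>"
    and "i1 \<tau> (\<lambda>s. \<gamma> s \<circ> K) - i1 \<tau> \<gamma> \<le> int (dim (N1 (\<gamma> \<tau>) \<inter> N1 K)) - int (nu1 (\<gamma> \<tau> \<circ> K))"
proof -
  obtain P where "polarized scale \<omega> P" using polarization_exists by blast
  then interpret polarized scale \<omega> P .
  interpret S: polarized scale \<omega> "shift K" by (rule shift_polarized[OF K])
  have gS: "\<gamma> s \<in> Sp" if "s \<in> {0..\<tau>}" for s using g that by (simp add: Sp_path_def)
  have gK: "Sp_path \<tau> (\<lambda>s. \<gamma> s \<circ> K)" by (rule Sp_path_comp[OF g K])
  define C where "C = inv (rot (inv K))"
  have UB: "V.unitary (rot (inv K))" by (rule rot_unitary[OF Sp_inv[OF K]])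
  have UC: "V.unitary C" unfolding C_def by (rule V.unitary_inv(2)[OF UB])
  obtain \<theta> where th: "V.lifts 0 \<tau> (\<lambda>s. rot (\<gamma> s)) \<theta>" using Sp_path_lifts[OF g t] by blast
  obtain \<theta>' where th': "S.V.lifts 0 \<tau> (\<lambda>s. S.rot (\<gamma> s \<circ> K)) \<theta>'" using S.Sp_path_lifts[OF gK t] by blast
  have dims: "dim {w. S.rot (\<gamma> s \<circ> K) w = z *s w} = dim {w. (C \<circ> rot (\<gamma> s)) w = z *s w}" if "s \<in> {0..\<tau>}" for s z
    unfolding C_def by (rule shift_rot_dim[OF K gS[OF that]])
  have thC: "V.lifts 0 \<tau> (\<lambda>s. C \<circ> rot (\<gamma> s)) \<theta>'"
    using th' dims by (simp add: V.lifts_def S.V.lifts_def del: o_apply)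
  have mem: "\<tau> \<in> {0..\<tau>}" using t by simp
  have fW: "{x. rot (\<gamma> \<tau>) x = x} = N1 (\<gamma> \<tau>)" by (rule rot_fixed[OF gS[OF mem]])
  have iff: "C x = x \<longleftrightarrow> K x = x" for x
  proof -
    have "bij (rot (inv K))" "bij K" using V.unitary_inv(1)[OF UB] SpD(2)[OF K] by auto
    then have "C x = x \<longleftrightarrow> rot (inv K) x = x" "inv K x = x \<longleftrightarrow> K x = x"
      unfolding C_def by (metis bij_inv_eq_iff)+
    moreover have "rot (inv K) x = x \<longleftrightarrow> inv K x = x"
      using rot_fixed[OF Sp_inv[OF K]] by (auto simp: N1_def)
    ultimately show ?thesis by simp
  qed
  then have fC: "{x. C x = x} = N1 K" by (simp add: N1_def)
  have fCW: "dim {x. (C \<circ> rot (\<gamma> \<tau>)) x = x} = nu1 (\<gamma> \<tau> \<circ> K)"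
    using dims[OF mem, of 1] S.rot_fixed[OF Sp_comp[OF gS[OF mem] K]] by (simp add: nu1_def del: o_apply)
  have fI: "{x. rot (\<gamma> \<tau>) x = x \<and> C x = x} = N1 (\<gamma> \<tau>) \<inter> N1 K"
    using fW fC by blast
  have W: "V.unitary (rot (\<gamma> s))" if "s \<in> {0..\<tau>}" for s by (rule rot_unitary[OF gS[OF that]])
  have W0: "rot (\<gamma> 0) = id" by (simp add: start rot_id)
  note bounds = V.ceiling_sum_comp_bounds[of 0 \<tau> "\<lambda>s. rot (\<gamma> s)", OF W W0 UC t th thC]
  have i: "i1 \<tau> \<gamma> = ceiling_change V.Idx \<theta> 0 \<tau>"
    by (rule i1_eq[OF g t th])
  have iK: "i1 \<tau> (\<lambda>s. \<gamma> s \<circ> K) = ceiling_change V.Idx \<theta>' 0 \<tau>"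
    by (rule S.i1_eq[OF gK t th'])
  show "int (nu1 (\<gamma> \<tau>)) + int (nu1 K) - int (dim (N1 (\<gamma> \<tau>) \<inter> N1 K)) - int (dim (UNIV :: 'v set))
      \<le> i1 \<tau> (\<lambda>s. \<gamma> s \<circ> K) - i1 \<tau> \<gamma>"
    using bounds(1) unfolding fW fC fI i iK nu1_def .
  show "i1 \<tau> (\<lambda>s. \<gamma> s \<circ> K) - i1 \<tau> \<gamma> \<le> int (dim (N1 (\<gamma> \<tau>) \<inter> N1 K)) - int (nu1 (\<gamma> \<tau> \<circ> K))"
    using bounds(2) unfolding fCW fI i iK .
qed

text \<open>One lift over the whole interval restricts, after a translation for the second piece, to
  lifts of both pieces, and the ceiling sums telescope at the joint.\<close>

lemma Sp_path_glue:
  assumes a: "Sp_path S \<alpha>" and b: "Sp_path \<tau> \<beta>" and S: "0 \<le> S" and t: "0 \<le> \<tau>" and eq: "\<alpha> S = \<beta> 0"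
  defines "\<eta> \<equiv> \<lambda>s. if s \<le> S then \<alpha> s else \<beta> (s - S)"
  shows "Sp_path (S + \<tau>) \<eta>" and "i1 (S + \<tau>) \<eta> = i1 S \<alpha> + i1 \<tau> \<beta>"
proof -
  have e1: "\<eta> s = \<alpha> s" if "s \<in> {0..S}" for s using that by (simp add: \<eta>_def)
  have e2: "\<eta> (s + S) = \<beta> s" if "s \<in> {0..\<tau>}" for s
    using that eq by (cases "s = 0") (auto simp: \<eta>_def)
  show p: "Sp_path (S + \<tau>) \<eta>"
    unfolding Sp_path_def
  proof (intro conjI ballI allI impI)
    fix s assume s: "s \<in> {0..S + \<tau>}"
    show "\<eta> s \<in> Sp" using a b s by (auto simp: \<eta>_def Sp_path_def)
  next
    fix f v assume f: "Vector_Spaces.linear scale (*) f"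
    have U: "{0..S + \<tau>} = {0..S} \<union> {S..S + \<tau>}" using S t by auto
    have c2: "continuous_on {S..S + \<tau>} (\<lambda>s. f (\<beta> (s - S) v))"
    proof (rule continuous_on_compose2[of "{0..\<tau>}" "\<lambda>s. f (\<beta> s v)" "{S..S + \<tau>}" "\<lambda>s. s - S"])
      show "continuous_on {0..\<tau>} (\<lambda>s. f (\<beta> s v))" using b f unfolding Sp_path_def by blast
    qed (auto intro!: continuous_intros)
    have "continuous_on ({0..S} \<union> {S..S + \<tau>}) (\<lambda>s. if s \<le> S then f (\<alpha> s v) else f (\<beta> (s - S) v))"
      by (rule continuous_on_cases[OF _ _ _ c2]) (use a f eq in \<open>auto simp: Sp_path_def\<close>)
    moreover have "f (\<eta> s v) = (if s \<le> S then f (\<alpha> s v) else f (\<beta> (s - S) v))" for s by (simp add: \<eta>_def)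
    ultimately show "continuous_on {0..S + \<tau>} (\<lambda>s. f (\<eta> s v))" by (simp add: U)
  qed
  obtain P where "polarized scale \<omega> P" using polarization_exists by blast
  then interpret polarized scale \<omega> P .
  obtain \<theta> where th: "V.lifts 0 (S + \<tau>) (\<lambda>s. rot (\<eta> s)) \<theta>" using Sp_path_lifts[OF p] S t by auto
  have la: "V.lifts 0 S (\<lambda>s. rot (\<alpha> s)) \<theta>"
    unfolding V.lifts_def
  proof (intro conjI ballI allI)
    show "continuous_on {0..S} (\<theta> j)" if "j \<in> V.Idx" for j
      using th that t by (auto simp: V.lifts_def intro: continuous_on_subset)
    show "dim {x. rot (\<alpha> s) x = z *s x} = card {j\<in>V.Idx. cis (\<theta> j s) = z}" if "s \<in> {0..S}" for s z
    proof -
      have "s \<in> {0..S + \<tau>}" using that t by simp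
      then have "dim {x. rot (\<eta> s) x = z *s x} = card {j\<in>V.Idx. cis (\<theta> j s) = z}"
        using th unfolding V.lifts_def by blast
      then show ?thesis unfolding e1[OF that] .
    qed
  qed
  have lb: "V.lifts 0 \<tau> (\<lambda>s. rot (\<beta> s)) (\<lambda>j s. \<theta> j (s + S))"
    unfolding V.lifts_def
  proof (intro conjI ballI allI)
    show "continuous_on {0..\<tau>} (\<lambda>s. \<theta> j (s + S))" if "j \<in> V.Idx" for j
    proof (rule continuous_on_compose2[of "{0..S + \<tau>}" "\<theta> j" "{0..\<tau>}" "\<lambda>s. s + S"])
      show "continuous_on {0..S + \<tau>} (\<theta> j)" using th that unfolding V.lifts_def by blast
    qed (use S in \<open>auto intro!: continuous_intros\<close>)
    show "dim {x. rot (\<beta> s) x = z *s x} = card {j\<in>V.Idx. cis (\<theta> j (s + S)) = z}" if "s \<in> {0..\<tau>}" for s z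
    proof -
      have "s + S \<in> {0..S + \<tau>}" using that S by simp
      then have "dim {x. rot (\<eta> (s + S)) x = z *s x} = card {j\<in>V.Idx. cis (\<theta> j (s + S)) = z}"
        using th unfolding V.lifts_def by blast
      then show ?thesis unfolding e2[OF that] .
    qed
  qed
  have St: "0 \<le> S + \<tau>" using S t by simp
  show "i1 (S + \<tau>) \<eta> = i1 S \<alpha> + i1 \<tau> \<beta>"
    unfolding i1_eq[OF p St th] i1_eq[OF a S la] i1_eq[OF b t lb] sum.distrib[symmetric]
    by (simp add: add.commute)
qed

lemma i1_const_interval: "Sp_path 0 \<gamma> \<Longrightarrow> i1 0 \<gamma> = 0"
proof -
  assume g: "Sp_path 0 \<gamma>"
  obtain P where "polarized scale \<omega> P" using polarization_exists by blast
  then interpret polarized scale \<omega> P .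
  obtain \<theta> where "V.lifts 0 0 (\<lambda>s. rot (\<gamma> s)) \<theta>" using Sp_path_lifts[OF g] by auto
  then show ?thesis using i1_eq[OF g order_refl] by simp
qed

lemma iteration_index:
  assumes "\<And>l. l \<in> {1..k} \<Longrightarrow> \<tau> l \<ge> 0" "\<And>l. l \<in> {1..k} \<Longrightarrow> \<gamma> l \<in> symplectic_paths (\<tau> l)"
  defines "C \<equiv> cumulative (\<lambda>l. \<gamma> l (\<tau> l))"
  shows "Sp_path (total_time \<tau> k) (iteration \<tau> \<gamma> k) \<and> iteration \<tau> \<gamma> k (total_time \<tau> k) = C k \<and> C k \<in> Sp \<and>
    0 \<le> total_time \<tau> k \<and>
    i1 (total_time \<tau> k) (iteration \<tau> \<gamma> k) = (\<Sum>l=1..k. i1 (\<tau> l) (\<lambda>s. \<gamma> l s \<circ> C (l - 1)))"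
  using assms(1,2)
proof (induction k)
  case 0
  have it: "iteration \<tau> \<gamma> 0 = (\<lambda>t. id)" by auto
  have p: "Sp_path 0 (\<lambda>t. id)" by (auto simp: Sp_path_def Sp_id)
  have T0: "total_time \<tau> 0 = 0" and C0: "C 0 = id" by (simp_all add: total_time_def C_def)
  show ?case
    unfolding it T0 C0 i1_const_interval[OF p] using p Sp_id by (intro conjI) (simp_all add: id_def)
next
  case (Suc k)
  let ?T = "total_time \<tau> k" and ?l = "Suc k"
  define F where "F l = i1 (\<tau> l) (\<lambda>s. \<gamma> l s \<circ> C (l - 1))" for l
  have IH: "Sp_path ?T (iteration \<tau> \<gamma> k)" "iteration \<tau> \<gamma> k ?T = C k" "C k \<in> Sp" "0 \<le> ?T"
    "i1 ?T (iteration \<tau> \<gamma> k) = sum F {1..k}"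
  proof -
    have "Sp_path ?T (iteration \<tau> \<gamma> k) \<and> iteration \<tau> \<gamma> k ?T = C k \<and> C k \<in> Sp \<and> 0 \<le> ?T \<and>
      i1 ?T (iteration \<tau> \<gamma> k) = sum F {1..k}"
      unfolding F_def by (rule Suc.IH) (use Suc.prems in auto)
    then show "Sp_path ?T (iteration \<tau> \<gamma> k)" "iteration \<tau> \<gamma> k ?T = C k" "C k \<in> Sp" "0 \<le> ?T"
      "i1 ?T (iteration \<tau> \<gamma> k) = sum F {1..k}" by blast+
  qed
  have t: "0 \<le> \<tau> ?l" and g: "\<gamma> ?l \<in> symplectic_paths (\<tau> ?l)" using Suc.prems by auto
  have gp: "Sp_path (\<tau> ?l) (\<gamma> ?l)" and g0: "\<gamma> ?l 0 = id" using g by (auto simp: symplectic_paths_def Sp_path_def)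
  define \<beta> where "\<beta> s = \<gamma> ?l s \<circ> C k" for s
  have bp: "Sp_path (\<tau> ?l) \<beta>" unfolding \<beta>_def[abs_def] by (rule Sp_path_comp[OF gp IH(3)])
  have it: "iteration \<tau> \<gamma> ?l = (\<lambda>s. if s \<le> ?T then iteration \<tau> \<gamma> k s else \<beta> (s - ?T))"
    by (auto simp: \<beta>_def C_def)
  have T: "total_time \<tau> ?l = ?T + \<tau> ?l" by (simp add: total_time_def)
  have m: "iteration \<tau> \<gamma> k ?T = \<beta> 0" by (simp add: \<beta>_def g0 IH(2))
  note glue = Sp_path_glue[OF IH(1) bp IH(4) t m, folded it T]
  have Cs: "C ?l = \<gamma> ?l (\<tau> ?l) \<circ> C k" by (simp add: C_def)
  have "iteration \<tau> \<gamma> ?l (total_time \<tau> ?l) = C ?l"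
  \<comment> \<open>For a piece of length \<open>0\<close> the end time still falls into the first
    branch of the glued path.\<close>
  proof (cases "\<tau> ?l = 0")
    case True
    then show ?thesis using IH(2) by (simp add: T Cs g0)
  next
    case False
    then show ?thesis using t unfolding it T Cs \<beta>_def by simp
  qed
  moreover have "C ?l \<in> Sp" unfolding Cs
    by (rule Sp_comp[OF _ IH(3)]) (use gp t in \<open>auto simp: Sp_path_def\<close>)
  moreover have "i1 (total_time \<tau> ?l) (iteration \<tau> \<gamma> ?l) = sum F {1..?l}"
  proof -
    have "F ?l = i1 (\<tau> ?l) \<beta>" unfolding F_def \<beta>_def by simp
    moreover have "sum F {1..?l} = sum F {1..k} + F ?l" by simp
    ultimately show ?thesis using glue(2) IH(5) by simp
  qed
  moreover have "0 \<le> total_time \<tau> ?l" using T IH(4) t by simp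
  ultimately show ?case using glue(1) unfolding F_def by blast
qed

text \<open>A further factor adds \<open>dim Y - nu1 (cumulative M n)\<close> to
  \<open>B_index\<close>. Both \<open>X\<close> and \<open>Y\<close> lie in
  \<open>N1 (cumulative M n)\<close>, so \<open>dim X + dim Y - dim (X \<inter> Y)\<close> is at
  most its dimension, and \<open>X \<inter> Y\<close> is the new space of common fixed
  vectors.\<close>

lemma B_index_le_A_index:
  assumes "k \<ge> 2"
    and M: "\<And>l. l \<in> {1..k} \<Longrightarrow> M l \<in> Sp"
  shows "B_index k M \<le> A_index k M"
  using assms
proof (induction k rule: dec_induct)
  case base
  have "{1..2::nat} = {1, 2}" by auto
  then have "(\<Inter>l\<in>{1..2}. N1 (M l)) = N1 (M 2) \<inter> N1 (cumulative M 1)" by auto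
  then show ?case by (simp add: A_index_def B_index_def)
next
  case (step n)
  interpret finite_dimensional_vector_space scale Bas by (rule finite_dimensional)
  define X where "X = (\<Inter>l\<in>{1..n}. N1 (M l))"
  define Y where "Y = N1 (M (Suc n)) \<inter> N1 (cumulative M n)"
  have sN: "subspace (N1 K)" if "K \<in> Sp" for K
    using SpD(4-6)[OF that] by (auto simp: subspace_def N1_def algebra_simps)
  have cum: "cumulative M l \<in> Sp" if "l \<le> n" for l
    using that by (induction l) (auto simp: Sp_id intro!: Sp_comp step.prems)
  have fix_cum: "x \<in> N1 (cumulative M l)" if "\<forall>i\<in>{1..l}. x \<in> N1 (M i)" for x l
    using that by (induction l) (auto simp: N1_def)
  have sX: "subspace X" unfolding X_def by (rule subspace_Inter) (use step sN in auto)
  have sY: "subspace Y" unfolding Y_def by (rule subspace_inter) (use step sN cum in auto)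
  have XC: "X \<subseteq> N1 (cumulative M n)" using fix_cum unfolding X_def by blast
  have "{x + y |x y. x \<in> X \<and> y \<in> Y} \<subseteq> N1 (cumulative M n)"
    using XC subspace_add[OF sN[OF cum[OF order_refl]]] by (auto simp: Y_def)
  then have "dim {x + y |x y. x \<in> X \<and> y \<in> Y} \<le> nu1 (cumulative M n)" unfolding nu1_def by (rule dim_subset)
  moreover have "dim {x + y |x y. x \<in> X \<and> y \<in> Y} + dim (X \<inter> Y) = dim X + dim Y"
    by (rule dim_sums_Int[OF sX sY])
  moreover have "X \<inter> Y = (\<Inter>l\<in>{1..Suc n}. N1 (M l))"
    using XC unfolding X_def Y_def by (auto simp: atLeastAtMostSuc_conv)
  moreover have "{2..Suc n - 1} = insert n {2..n - 1}" "n \<notin> {2..n - 1}" using step.hyps by auto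
  then have "B_index (Suc n) M = B_index n M + int (dim Y) - int (nu1 (cumulative M n))"
    using step.hyps by (simp add: B_index_def Y_def)
  moreover have "B_index n M \<le> A_index n M" using step by simp
  ultimately show ?case by (simp add: A_index_def X_def)
qed

end

theorem theorem4p1:
  fixes scale :: "complex \<Rightarrow> 'v::ab_group_add \<Rightarrow> 'v"
    and \<omega> :: "'v \<Rightarrow> 'v \<Rightarrow> complex"
    and m k :: nat
    and \<tau> :: "nat \<Rightarrow> real"
    and \<gamma> :: "nat \<Rightarrow> real \<Rightarrow> 'v \<Rightarrow> 'v"
  defines "M \<equiv> \<lambda>l. \<gamma> l (\<tau> l)"
    and "\<nu>\<^sub>1 \<equiv> \<lambda>L. int (complex_symplectic_space.nu1 scale L)"
    and "i\<^sub>1 \<equiv> complex_symplectic_space.i1 scale \<omega>"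
    and "A \<equiv> complex_symplectic_space.A_index scale"
    and "B \<equiv> complex_symplectic_space.B_index scale"
  assumes "complex_symplectic_space scale \<omega>"
    and "vector_space.dim scale (UNIV :: 'v set) = m"
    and "k \<ge> 2"
    and "\<And>l. l \<in> {1..k} \<Longrightarrow> \<tau> l \<ge> 0"
    and "\<And>l. l \<in> {1..k} \<Longrightarrow> \<gamma> l \<in> complex_symplectic_space.symplectic_paths scale \<omega> (\<tau> l)"
  shows "(\<Sum>l=1..k. \<nu>\<^sub>1 (M l)) - B k M - int m * (int k - 1)
            \<le> i\<^sub>1 (total_time \<tau> k) (iteration \<tau> \<gamma> k) - (\<Sum>l=1..k. i\<^sub>1 (\<tau> l) (\<gamma> l)) \<and>
         i\<^sub>1 (total_time \<tau> k) (iteration \<tau> \<gamma> k) - (\<Sum>l=1..k. i\<^sub>1 (\<tau> l) (\<gamma> l))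
            \<le> B k M - \<nu>\<^sub>1 (cumulative M k) \<and>
         B k M \<le> A k M"
proof -
  interpret complex_symplectic_space scale \<omega> by fact
  define C where "C = cumulative M"
  define d where "d l = int (dim (N1 (M l) \<inter> N1 (C (l - 1))))" for l
  define \<Delta> where "\<Delta> l = i1 (\<tau> l) (\<lambda>s. \<gamma> l s \<circ> C (l - 1)) - i1 (\<tau> l) (\<gamma> l)" for l
  have path: "Sp_path (\<tau> l) (\<gamma> l)" "\<gamma> l 0 = id" "0 \<le> \<tau> l" "M l \<in> Sp" if "l \<in> {1..k}" for l
    using assms(9,10)[OF that] by (auto simp: symplectic_paths_def Sp_path_def M_def)
  have CSp: "C l \<in> Sp" if "l \<le> k" for l
    using that unfolding C_def by (induction l) (auto simp: Sp_id intro!: Sp_comp path(4))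
  have lo: "\<nu>\<^sub>1 (M l) + \<nu>\<^sub>1 (C (l - 1)) - d l - int m \<le> \<Delta> l" and up: "\<Delta> l \<le> d l - \<nu>\<^sub>1 (C l)" if l: "l \<in> {1..k}" for l
  proof -
    have K: "C (l - 1) \<in> Sp" using l by (intro CSp) auto
    have Cl: "C l = M l \<circ> C (l - 1)" using l unfolding C_def by (cases l) auto
    note b = i1_comp_bounds[OF path(1,2,3)[OF l] K]
    show "\<nu>\<^sub>1 (M l) + \<nu>\<^sub>1 (C (l - 1)) - d l - int m \<le> \<Delta> l"
      using b(1) assms(7) by (simp add: \<nu>\<^sub>1_def d_def \<Delta>_def M_def)
    show "\<Delta> l \<le> d l - \<nu>\<^sub>1 (C l)"
      using b(2) by (simp add: \<nu>\<^sub>1_def d_def \<Delta>_def M_def Cl del: o_apply)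
  qed
  have split: "(\<Sum>l=1..k. f l) = f 1 + (\<Sum>l=2..k. f l)" for f :: "nat \<Rightarrow> int"
  proof -
    have "{1..k} = insert 1 {2..k}" using \<open>k \<ge> 2\<close> by auto
    then show ?thesis by simp
  qed
  have split': "(\<Sum>l=2..k. f l) = (\<Sum>l=2..k-1. f l) + f k" for f :: "nat \<Rightarrow> int"
  proof -
    have "{2..k} = insert k {2..k-1}" "k \<notin> {2..k-1}" using \<open>k \<ge> 2\<close> by auto
    then show ?thesis by simp
  qed
  \<comment> \<open>The term of \<open>C 1 = M 1\<close> completes the sum of the
    \<open>\<nu>\<^sub>1 (M l)\<close> in the lower bound; the others are those subtracted in
    \<open>B_index\<close>.\<close>
  have shift_sum: "(\<Sum>l=2..k. \<nu>\<^sub>1 (C (l - 1))) = \<nu>\<^sub>1 (M 1) + (\<Sum>l=2..k-1. \<nu>\<^sub>1 (C l))"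
  proof -
    have "(\<Sum>l=2..k. \<nu>\<^sub>1 (C (l - 1))) = (\<Sum>l=1..k-1. \<nu>\<^sub>1 (C l))"
      by (rule sum.reindex_bij_witness[of _ Suc "\<lambda>l. l - 1"]) auto
    moreover have "{1..k-1} = insert 1 {2..k-1}" using \<open>k \<ge> 2\<close> by auto
    moreover have "C 1 = M 1" by (simp add: C_def)
    ultimately show ?thesis by simp
  qed
  have B: "B k M = (\<Sum>l=2..k. d l) - (\<Sum>l=2..k-1. \<nu>\<^sub>1 (C l))"
    by (simp add: B_def B_index_def d_def C_def \<nu>\<^sub>1_def)
  have "i\<^sub>1 (total_time \<tau> k) (iteration \<tau> \<gamma> k) = (\<Sum>l=1..k. i1 (\<tau> l) (\<lambda>s. \<gamma> l s \<circ> C (l - 1)))"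
    using iteration_index[of k \<tau> \<gamma>, OF assms(9,10)] by (simp add: i\<^sub>1_def C_def M_def)
  then have "i\<^sub>1 (total_time \<tau> k) (iteration \<tau> \<gamma> k) - (\<Sum>l=1..k. i\<^sub>1 (\<tau> l) (\<gamma> l)) = (\<Sum>l=1..k. \<Delta> l)"
    by (simp add: \<Delta>_def sum_subtractf i\<^sub>1_def)
  \<comment> \<open>\<open>\<Delta> 1 = 0\<close> because \<open>C 0 = id\<close>. Only
    \<open>k - 1\<close> estimates are added, whence the term \<open>m * (k - 1)\<close>.\<close>
  also have "\<dots> = (\<Sum>l=2..k. \<Delta> l)" unfolding split by (simp add: \<Delta>_def C_def)
  finally have D: "i\<^sub>1 (total_time \<tau> k) (iteration \<tau> \<gamma> k) - (\<Sum>l=1..k. i\<^sub>1 (\<tau> l) (\<gamma> l)) = (\<Sum>l=2..k. \<Delta> l)" .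
  have "(\<Sum>l=2..k. \<nu>\<^sub>1 (M l) + \<nu>\<^sub>1 (C (l - 1)) - d l - int m) \<le> (\<Sum>l=2..k. \<Delta> l)"
    by (rule sum_mono) (use lo in auto)
  moreover have "(\<Sum>l=2..k. \<nu>\<^sub>1 (M l) + \<nu>\<^sub>1 (C (l - 1)) - d l - int m) = (\<Sum>l=1..k. \<nu>\<^sub>1 (M l)) - B k M - int m * (int k - 1)"
    using \<open>k \<ge> 2\<close> unfolding B split sum_subtractf sum.distrib shift_sum by (simp add: of_nat_diff algebra_simps)
  moreover have "(\<Sum>l=2..k. \<Delta> l) \<le> (\<Sum>l=2..k. d l - \<nu>\<^sub>1 (C l))"
    by (rule sum_mono) (use up in auto)
  moreover have "(\<Sum>l=2..k. d l - \<nu>\<^sub>1 (C l)) = B k M - \<nu>\<^sub>1 (cumulative M k)"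
    unfolding B sum_subtractf split'[of "\<lambda>l. \<nu>\<^sub>1 (C l)"] by (simp add: C_def)
  moreover have "B k M \<le> A k M"
    unfolding A_def B_def using \<open>k \<ge> 2\<close> path(4) by (rule B_index_le_A_index)
  ultimately show ?thesis unfolding D by simp
qed

end
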